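(* (i) Let $\mathcal{C}$ be a category with finite coproducts and $\mathcal{W}$ a saturated class of morphisms in $\Delta^{op}\mathcal{C}$. Then the following are equivalent: (1) $\mathcal{W}$ is $(\Delta,\amalg_{<\infty})$-closed; (2) $(\Delta^{op}\mathcal{C},\mathcal{W},\mathrm{D}:\Delta^{op}\Delta^{op}\mathcal{C}\to\Delta^{op}\mathcal{C})$ is a simplicial descent category, i.e. $(\Delta^{op}\mathcal{C},\mathcal{W})$ is a simplicial descent category with simple functor the diagonal functor $\mathrm{D}$. (ii) Given a simplicial descent category $(\mathcal{D},\mathrm{E})$ with simple functor $\mathbf{s}$, the class $\mathcal{S}=\mathbf{s}^{-1}\mathrm{E}=\{f \text{ in }\Delta^{op}\mathcal{D}\;:\;\mathbf{s}(f)\in\mathrm{E}\}$ is $(\Delta,\amalg_{<\infty})$-closed.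
   Context: **$\Delta$-closed classes.** Let $\mathcal{C}$ be a category with finite coproducts (including an initial object). A class $\mathcal{W}$ of morphisms of $\Delta^{op}\mathcal{C}$ is $\Delta$-closed if: (1) it contains the simplicial homotopy equivalences; (2) it satisfies 2-out-of-3; (3) if $F:Z_{\cdot,\cdot}\to T_{\cdot,\cdot}$ is a map of bisimplicial objects with $F_{n,\cdot}\in\mathcal{W}$ for all $n\ge0$ (or $F_{\cdot,n}\in\mathcal{W}$ for all $n\ge 0$), then the diagonal $\mathrm{D}(F)\in\mathcal{W}$. It is $(\Delta,\amalg_{<\infty})$-closed if moreover (4) $F,G\in\mathcal{W}$ implies $F\sqcup G\in\mathcal{W}$. Simplicial homotopies are defined with the cylinder $X\boxtimes\Delta[1]$ and its two inclusions $d_0^X,d_1^X:X\to X\boxtimes\Delta[1]$. **Simplicial descent categories.** $\Delta$ is the category of ordered sets $[n]=\{0,\dots,n\}$ and order preserving maps. $\Delta^{op}\mathcal{D}$ is the category of simplicial objects in $\mathcal{D}$; $c(A)$ is the constant simplicial object on $A$; $\mathrm{D}(Z)_n=Z_{n,n}$ is the diagonal of a bisimplicial object. If $\mathcal D$ has finite coproducts and $K$ is a simplicial finite set, $(X\boxtimes K)_n=\coprod_{K_n}X_n$; the maps $d^0,d^1:[0]\to[1]$ induce $d_0^X,d_1^X:X\to X\boxtimes\Delta[1]$, and we write $A$ for $c(A)$. A class $\mathrm{E}$ of morphisms of $\mathcal{D}$ is saturated if it consists of exactly the morphisms that become invertible in $\mathcal{D}[\mathrm{E}^{-1}]$. A relative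 category $(\mathcal{D},\mathrm{E})$ is a category with a saturated class of morphisms (weak equivalences); it is closed by finite coproducts if $\mathcal{D}$ has an initial object and finite coproducts, and $f\sqcup g\in\mathrm{E}$ whenever $f,g\in\mathrm{E}$. A zigzag of natural weak equivalences $F\dashrightarrow G$ is a finite chain of natural transformations, in either direction, connecting $F$ to $G$, each objectwise in $\mathrm{E}$; $Fun(\mathcal{C},\mathcal{D})[\mathrm{E}^{-1}]$ is the localization at the objectwise weak equivalences. A simplicial descent structure on a relative category $(\mathcal{D},\mathrm{E})$ closed by finite coproducts is a triple $(\mathbf{s},\mu,\lambda)$ with: (S1) $\mathbf{s}:\Delta^{op}\mathcal{D}\to\mathcal{D}$ is a functor (the simple functor) such that $\mathbf{s}(X)\sqcup\mathbf{s}(Y)\to\mathbf{s}(X\sqcup Y)$ is in $\mathrm{E}$ for all $X,Y$. (S2) $\mu:\mathbf{s}\circ\mathrm{D}\dashrightarrow\mathbf{s}\circ\mathbf{s}$ is a zigzag of natural weak equivalences, where $\mathbf{s}\mathbf{s}(Z)=\mathbf{s}(n\mapsto\mathbf{s}(m\mapsto Z_{n,m}))$. (S3) $\lambda:\mathbf{s}\circ c\dashrightarrow 1_{\mathcal{D}}$ is a zigzag of natural weak equivalences compatible with $\mu$: with $(X\times\Delta)_{n,m}=X_n$, $(\Delta\times X)_{n,m}=X_m$, the composites $\mathbf{s}(X)\xrightarrow{\mu_{\Delta\times X}}\mathbf{s}c\mathbf{s}(X)\xrightarrow{\lambda_{\mathbf{s}(X)}}\mathbf{s}(X)$ and $\mathbf{s}(X)\xrightarrow{\mu_{X\times\Delta}}\mathbf{s}(n\mapsto\mathbf{s}c(X_n))\xrightarrow{\mathbf{s}(\lambda_X)}\mathbf{s}(X)$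 are the identity in $Fun(\Delta^{op}\mathcal{D},\mathcal{D})[\mathrm{E}^{-1}]$. (S4) If $f:X\to Y$ in $\Delta^{op}\mathcal{D}$ has $f_n\in\mathrm{E}$ for all $n$, then $\mathbf{s}(f)\in\mathrm{E}$. (S5) $\mathbf{s}(d_0^A:A\to A\boxtimes\Delta[1])\in\mathrm{E}$ for each object $A$ of $\mathcal{D}$. A simplicial descent category is a relative category closed by finite coproducts endowed with a simplicial descent structure; one writes $(\mathcal{D},\mathrm{E},\mathbf{s})$, leaving $\mu,\lambda$ implicit. *)

theory Defs
  imports "HOL-Library.FuncSet"
begin

section \<open>Categories, functors, natural transformations\<close>

text \<open>\<open>Cmp C g f\<close> is the composite "g after f".  The fields of a category are only
  meaningful on the carriers \<open>Obj C\<close> and \<open>Arr C\<close>.\<close>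

record ('o, 'm) category =
  Obj :: "'o set"
  Arr :: "'m set"
  Dom :: "'m \<Rightarrow> 'o"
  Cod :: "'m \<Rightarrow> 'o"
  Idn :: "'o \<Rightarrow> 'm"
  Cmp :: "'m \<Rightarrow> 'm \<Rightarrow> 'm"

definition Hom :: "('o, 'm) category \<Rightarrow> 'o \<Rightarrow> 'o \<Rightarrow> 'm set" where
  "Hom C a b = {f \<in> Arr C. Dom C f = a \<and> Cod C f = b}"

locale category =
  fixes C :: "('o, 'm) category"
  assumes Dom_Obj: "f \<in> Arr C \<Longrightarrow> Dom C f \<in> Obj C"
    and Cod_Obj: "f \<in> Arr C \<Longrightarrow> Cod C f \<in> Obj C"
    and Idn_Hom: "a \<in> Obj C \<Longrightarrow> Idn C a \<in> Hom C a a"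
    and Cmp_Hom: "f \<in> Hom C a b \<Longrightarrow> g \<in> Hom C b c \<Longrightarrow> Cmp C g f \<in> Hom C a c"
    and Cmp_Idn_left: "f \<in> Hom C a b \<Longrightarrow> Cmp C (Idn C b) f = f"
    and Cmp_Idn_right: "f \<in> Hom C a b \<Longrightarrow> Cmp C f (Idn C a) = f"
    and Cmp_assoc: "f \<in> Hom C a b \<Longrightarrow> g \<in> Hom C b c \<Longrightarrow> h \<in> Hom C c d
      \<Longrightarrow> Cmp C h (Cmp C g f) = Cmp C (Cmp C h g) f"

definition opposite :: "('o, 'm) category \<Rightarrow> ('o, 'm) category" where
  "opposite C = \<lparr>Obj = Obj C, Arr = Arr C, Dom = Cod C, Cod = Dom C, Idn = Idn C,
     Cmp = (\<lambda>g f. Cmp C f g)\<rparr>"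

definition is_iso :: "('o, 'm) category \<Rightarrow> 'm \<Rightarrow> bool" where
  "is_iso C f \<longleftrightarrow> f \<in> Arr C \<and>
     (\<exists>g \<in> Hom C (Cod C f) (Dom C f).
        Cmp C g f = Idn C (Dom C f) \<and> Cmp C f g = Idn C (Cod C f))"

text \<open>Functors and natural transformations are kept extensional (\<open>undefined\<close> outside the
  carrier of the source category), so that equality of functors and of natural
  transformations is equality in HOL.  A natural transformation carries its source and target
  functors.\<close>

datatype ('o1, 'm1, 'o2, 'm2) ftor =
  Ftor (Fo: "'o1 \<Rightarrow> 'o2") (Fm: "'m1 \<Rightarrow> 'm2")

datatype ('o1, 'm1, 'o2, 'm2) ntrans =
  Nt (src: "('o1, 'm1, 'o2, 'm2) ftor") (tgt: "('o1, 'm1, 'o2, 'm2) ftor") (cmpnt: "'o1 \<Rightarrow> 'm2")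

definition is_functor ::
  "('o1, 'm1) category \<Rightarrow> ('o2, 'm2) category \<Rightarrow> ('o1, 'm1, 'o2, 'm2) ftor \<Rightarrow> bool" where
  "is_functor A B F \<longleftrightarrow>
     Fo F \<in> Obj A \<rightarrow>\<^sub>E Obj B \<and> Fm F \<in> Arr A \<rightarrow>\<^sub>E Arr B \<and>
     (\<forall>f \<in> Arr A. Dom B (Fm F f) = Fo F (Dom A f) \<and> Cod B (Fm F f) = Fo F (Cod A f)) \<and>
     (\<forall>a \<in> Obj A. Fm F (Idn A a) = Idn B (Fo F a)) \<and>
     (\<forall>f \<in> Arr A. \<forall>g \<in> Arr A. Cod A f = Dom A g \<longrightarrow>
        Fm F (Cmp A g f) = Cmp B (Fm F g) (Fm F f))"

definition is_ntrans ::
  "('o1, 'm1) category \<Rightarrow> ('o2, 'm2) category \<Rightarrow> ('o1, 'm1, 'o2, 'm2) ntrans \<Rightarrow> bool" where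
  "is_ntrans A B \<eta> \<longleftrightarrow>
     is_functor A B (src \<eta>) \<and> is_functor A B (tgt \<eta>) \<and> cmpnt \<eta> \<in> extensional (Obj A) \<and>
     (\<forall>a \<in> Obj A. cmpnt \<eta> a \<in> Hom B (Fo (src \<eta>) a) (Fo (tgt \<eta>) a)) \<and>
     (\<forall>f \<in> Arr A. Cmp B (cmpnt \<eta> (Cod A f)) (Fm (src \<eta>) f)
                  = Cmp B (Fm (tgt \<eta>) f) (cmpnt \<eta> (Dom A f)))"

definition functor_category ::
  "('o1, 'm1) category \<Rightarrow> ('o2, 'm2) category \<Rightarrow>
   (('o1, 'm1, 'o2, 'm2) ftor, ('o1, 'm1, 'o2, 'm2) ntrans) category" where
  "functor_category A B = \<lparr>Obj = {F. is_functor A B F}, Arr = {\<eta>. is_ntrans A B \<eta>},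
     Dom = src, Cod = tgt,
     Idn = (\<lambda>F. Nt F F (\<lambda>a \<in> Obj A. Idn B (Fo F a))),
     Cmp = (\<lambda>\<theta> \<eta>. Nt (src \<eta>) (tgt \<theta>) (\<lambda>a \<in> Obj A. Cmp B (cmpnt \<theta> a) (cmpnt \<eta> a)))\<rparr>"

definition id_ftor :: "('o, 'm) category \<Rightarrow> ('o, 'm, 'o, 'm) ftor" where
  "id_ftor A = Ftor (\<lambda>a \<in> Obj A. a) (\<lambda>f \<in> Arr A. f)"

text \<open>\<open>comp_ftor A G F\<close> is "G after F" for a functor \<open>F\<close> with source \<open>A\<close>.\<close>

definition comp_ftor ::
  "('o1, 'm1) category \<Rightarrow> ('o2, 'm2, 'o3, 'm3) ftor \<Rightarrow> ('o1, 'm1, 'o2, 'm2) ftor \<Rightarrow>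
   ('o1, 'm1, 'o3, 'm3) ftor" where
  "comp_ftor A G F = Ftor (compose (Obj A) (Fo G) (Fo F)) (compose (Arr A) (Fm G) (Fm F))"

text \<open>Whiskering: \<open>whisker_left A G \<eta>\<close> has components \<open>G(\<eta>\<^sub>a)\<close>, and \<open>whisker_right A \<eta> F\<close> has
  components \<open>\<eta>\<^bsub>F(a)\<^esub>\<close>; in both cases \<open>A\<close> is the source category of the result.\<close>

definition whisker_left ::
  "('o1, 'm1) category \<Rightarrow> ('o2, 'm2, 'o3, 'm3) ftor \<Rightarrow> ('o1, 'm1, 'o2, 'm2) ntrans \<Rightarrow>
   ('o1, 'm1, 'o3, 'm3) ntrans" where
  "whisker_left A G \<eta> = Nt (comp_ftor A G (src \<eta>)) (comp_ftor A G (tgt \<eta>))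
     (\<lambda>a \<in> Obj A. Fm G (cmpnt \<eta> a))"

definition whisker_right ::
  "('o1, 'm1) category \<Rightarrow> ('o2, 'm2, 'o3, 'm3) ntrans \<Rightarrow> ('o1, 'm1, 'o2, 'm2) ftor \<Rightarrow>
   ('o1, 'm1, 'o3, 'm3) ntrans" where
  "whisker_right A \<eta> F = Nt (comp_ftor A (src \<eta>) F) (comp_ftor A (tgt \<eta>) F)
     (\<lambda>a \<in> Obj A. cmpnt \<eta> (Fo F a))"

text \<open>Functors between functor categories: the constant diagram functor \<open>B \<rightarrow> Fun(J, B)\<close>,
  evaluation at \<open>j\<close>, postcomposition \<open>Fun(J, A) \<rightarrow> Fun(J, B)\<close> with a functor \<open>A \<rightarrow> B\<close>
  (together with its action on natural transformations), and the diagonal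
  \<open>Fun(J, Fun(J, B)) \<rightarrow> Fun(J, B)\<close>.\<close>

definition const_ftor ::
  "('j, 'k) category \<Rightarrow> ('o, 'm) category \<Rightarrow>
   ('o, 'm, ('j, 'k, 'o, 'm) ftor, ('j, 'k, 'o, 'm) ntrans) ftor" where
  "const_ftor J B =
     (let c = (\<lambda>b. Ftor (\<lambda>j \<in> Obj J. b) (\<lambda>u \<in> Arr J. Idn B b))
      in Ftor (\<lambda>b \<in> Obj B. c b)
              (\<lambda>f \<in> Arr B. Nt (c (Dom B f)) (c (Cod B f)) (\<lambda>j \<in> Obj J. f)))"

definition eval_ftor ::
  "('j, 'k) category \<Rightarrow> ('o, 'm) category \<Rightarrow> 'j \<Rightarrow>
   (('j, 'k, 'o, 'm) ftor, ('j, 'k, 'o, 'm) ntrans, 'o, 'm) ftor" where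
  "eval_ftor J B j =
     Ftor (\<lambda>X \<in> Obj (functor_category J B). Fo X j)
          (\<lambda>\<eta> \<in> Arr (functor_category J B). cmpnt \<eta> j)"

definition post_ftor ::
  "('j, 'k) category \<Rightarrow> ('o1, 'm1) category \<Rightarrow> ('o1, 'm1, 'o2, 'm2) ftor \<Rightarrow>
   (('j, 'k, 'o1, 'm1) ftor, ('j, 'k, 'o1, 'm1) ntrans,
    ('j, 'k, 'o2, 'm2) ftor, ('j, 'k, 'o2, 'm2) ntrans) ftor" where
  "post_ftor J A F =
     Ftor (\<lambda>X \<in> Obj (functor_category J A). comp_ftor J F X)
          (\<lambda>\<eta> \<in> Arr (functor_category J A). whisker_left J F \<eta>)"

definition post_nt ::
  "('j, 'k) category \<Rightarrow> ('o1, 'm1) category \<Rightarrow> ('o1, 'm1, 'o2, 'm2) ntrans \<Rightarrow>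
   (('j, 'k, 'o1, 'm1) ftor, ('j, 'k, 'o1, 'm1) ntrans,
    ('j, 'k, 'o2, 'm2) ftor, ('j, 'k, 'o2, 'm2) ntrans) ntrans" where
  "post_nt J A \<eta> = Nt (post_ftor J A (src \<eta>)) (post_ftor J A (tgt \<eta>))
     (\<lambda>X \<in> Obj (functor_category J A). whisker_right J \<eta> X)"

definition diag_ftor ::
  "('j, 'k) category \<Rightarrow> ('o, 'm) category \<Rightarrow>
   (('j, 'k, ('j, 'k, 'o, 'm) ftor, ('j, 'k, 'o, 'm) ntrans) ftor,
    ('j, 'k, ('j, 'k, 'o, 'm) ftor, ('j, 'k, 'o, 'm) ntrans) ntrans,
    ('j, 'k, 'o, 'm) ftor, ('j, 'k, 'o, 'm) ntrans) ftor" where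
  "diag_ftor J B =
     (let JB = functor_category J B;
          d = (\<lambda>Z. Ftor (\<lambda>j \<in> Obj J. Fo (Fo Z j) j)
                 (\<lambda>u \<in> Arr J. Cmp B (cmpnt (Fm Z u) (Cod J u)) (Fm (Fo Z (Dom J u)) u)))
      in Ftor (\<lambda>Z \<in> Obj (functor_category J JB). d Z)
              (\<lambda>\<eta> \<in> Arr (functor_category J JB).
                 Nt (d (src \<eta>)) (d (tgt \<eta>)) (\<lambda>j \<in> Obj J. cmpnt (cmpnt \<eta> j) j)))"


section \<open>Zigzags, localization, saturated classes\<close>

text \<open>The localization \<open>C[W\<^sup>-\<^sup>1]\<close> in the Gabriel-Zisman construction: arrows are classes of
  zigzags, read from left to right, where \<open>Fwd f\<close> traverses \<open>f\<close> and \<open>Bwd w\<close> traverses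
  \<open>w \<in> W\<close> backwards.\<close>

datatype 'm letter = Fwd 'm | Bwd 'm

fun zz_path :: "('o, 'm) category \<Rightarrow> 'm set \<Rightarrow> 'o \<Rightarrow> 'm letter list \<Rightarrow> 'o \<Rightarrow> bool" where
  "zz_path C W a [] b \<longleftrightarrow> a \<in> Obj C \<and> a = b"
| "zz_path C W a (Fwd f # us) b \<longleftrightarrow> f \<in> Arr C \<and> Dom C f = a \<and> zz_path C W (Cod C f) us b"
| "zz_path C W a (Bwd w # us) b \<longleftrightarrow> w \<in> W \<and> w \<in> Arr C \<and> Cod C w = a \<and> zz_path C W (Dom C w) us b"

inductive zz_basic ::
  "('o, 'm) category \<Rightarrow> 'm set \<Rightarrow> 'm letter list \<Rightarrow> 'm letter list \<Rightarrow> bool"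
  for C :: "('o, 'm) category" and W :: "'m set" where
  zz_comp: "f \<in> Arr C \<Longrightarrow> g \<in> Arr C \<Longrightarrow> Cod C f = Dom C g \<Longrightarrow>
     zz_basic C W [Fwd f, Fwd g] [Fwd (Cmp C g f)]"
| zz_id: "a \<in> Obj C \<Longrightarrow> zz_basic C W [Fwd (Idn C a)] []"
| zz_cancel1: "w \<in> W \<Longrightarrow> zz_basic C W [Fwd w, Bwd w] []"
| zz_cancel2: "w \<in> W \<Longrightarrow> zz_basic C W [Bwd w, Fwd w] []"

inductive zz_equiv ::
  "('o, 'm) category \<Rightarrow> 'm set \<Rightarrow> 'o \<Rightarrow> 'o \<Rightarrow> 'm letter list \<Rightarrow> 'm letter list \<Rightarrow> bool"
  for C :: "('o, 'm) category" and W :: "'m set" and a b :: 'o where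
  zz_refl: "zz_path C W a u b \<Longrightarrow> zz_equiv C W a b u u"
| zz_sym: "zz_equiv C W a b u v \<Longrightarrow> zz_equiv C W a b v u"
| zz_trans: "zz_equiv C W a b u v \<Longrightarrow> zz_equiv C W a b v w \<Longrightarrow> zz_equiv C W a b u w"
| zz_step: "zz_basic C W r r' \<Longrightarrow> zz_path C W a u x \<Longrightarrow> zz_path C W x r y \<Longrightarrow>
     zz_path C W x r' y \<Longrightarrow> zz_path C W y v b \<Longrightarrow>
     zz_equiv C W a b (u @ r @ v) (u @ r' @ v)"

text \<open>The arrow of the localization represented by a zigzag.\<close>

definition zz_arr ::
  "('o, 'm) category \<Rightarrow> 'm set \<Rightarrow> 'o \<Rightarrow> 'o \<Rightarrow> 'm letter list \<Rightarrow> 'o \<times> 'o \<times> 'm letter list set" where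
  "zz_arr C W a b u = (a, b, {v. zz_equiv C W a b u v})"

definition localization ::
  "('o, 'm) category \<Rightarrow> 'm set \<Rightarrow> ('o, 'o \<times> 'o \<times> 'm letter list set) category" where
  "localization C W = \<lparr>Obj = Obj C,
     Arr = {zz_arr C W a b u | a b u. zz_path C W a u b},
     Dom = fst, Cod = (\<lambda>p. fst (snd p)),
     Idn = (\<lambda>a. zz_arr C W a a []),
     Cmp = (\<lambda>(_, c, Q) (a, _, P). (a, c, {w. \<exists>u \<in> P. \<exists>v \<in> Q. zz_equiv C W a c (u @ v) w}))\<rparr>"

definition saturated :: "('o, 'm) category \<Rightarrow> 'm set \<Rightarrow> bool" where
  "saturated C W \<longleftrightarrow>
     W = {f \<in> Arr C. is_iso (localization C W) (zz_arr C W (Dom C f) (Cod C f) [Fwd f])}"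

text \<open>Zigzags of weak equivalences (in which the forward letters also lie in \<open>W\<close>), and the
  objectwise weak equivalences of a functor category.\<close>

definition weq_zigzag ::
  "('o, 'm) category \<Rightarrow> 'm set \<Rightarrow> 'o \<Rightarrow> 'm letter list \<Rightarrow> 'o \<Rightarrow> bool" where
  "weq_zigzag C W a us b \<longleftrightarrow> zz_path C W a us b \<and> (\<forall>l \<in> set us. set_letter l \<subseteq> W)"

definition objectwise ::
  "('o1, 'm1) category \<Rightarrow> ('o2, 'm2) category \<Rightarrow> 'm2 set \<Rightarrow> ('o1, 'm1, 'o2, 'm2) ntrans set" where
  "objectwise A B E = {\<eta> \<in> Arr (functor_category A B). \<forall>a \<in> Obj A. cmpnt \<eta> a \<in> E}"


section \<open>Finite coproducts\<close>

definition is_coproduct ::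
  "('o, 'm) category \<Rightarrow> 'i set \<Rightarrow> ('i \<Rightarrow> 'o) \<Rightarrow> 'o \<Rightarrow> ('i \<Rightarrow> 'm) \<Rightarrow> bool" where
  "is_coproduct C I X P \<iota> \<longleftrightarrow>
     P \<in> Obj C \<and> (\<forall>i \<in> I. \<iota> i \<in> Hom C (X i) P) \<and>
     (\<forall>Q \<in> Obj C. \<forall>q. (\<forall>i \<in> I. q i \<in> Hom C (X i) Q) \<longrightarrow>
        (\<exists>!h. h \<in> Hom C P Q \<and> (\<forall>i \<in> I. Cmp C h (\<iota> i) = q i)))"

text \<open>The case \<open>n = 0\<close> gives an initial object.\<close>

definition has_finite_coproducts :: "('o, 'm) category \<Rightarrow> bool" where
  "has_finite_coproducts C \<longleftrightarrow>
     (\<forall>(n::nat) X. (\<forall>i<n. X i \<in> Obj C) \<longrightarrow> (\<exists>P \<iota>. is_coproduct C {..<n} X P \<iota>))"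

text \<open>Chosen coproducts, their injections, and the arrow induced by a cocone with vertex \<open>Q\<close>.\<close>

definition coprod_cocone ::
  "('o, 'm) category \<Rightarrow> 'i set \<Rightarrow> ('i \<Rightarrow> 'o) \<Rightarrow> 'o \<times> ('i \<Rightarrow> 'm)" where
  "coprod_cocone C I X = (SOME p. is_coproduct C I X (fst p) (snd p))"

definition coprod :: "('o, 'm) category \<Rightarrow> 'i set \<Rightarrow> ('i \<Rightarrow> 'o) \<Rightarrow> 'o" where
  "coprod C I X = fst (coprod_cocone C I X)"

definition coprod_inj :: "('o, 'm) category \<Rightarrow> 'i set \<Rightarrow> ('i \<Rightarrow> 'o) \<Rightarrow> 'i \<Rightarrow> 'm" where
  "coprod_inj C I X = snd (coprod_cocone C I X)"

definition cotuple ::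
  "('o, 'm) category \<Rightarrow> 'i set \<Rightarrow> ('i \<Rightarrow> 'o) \<Rightarrow> 'o \<Rightarrow> ('i \<Rightarrow> 'm) \<Rightarrow> 'm" where
  "cotuple C I X Q q =
     (THE h. h \<in> Hom C (coprod C I X) Q \<and> (\<forall>i \<in> I. Cmp C h (coprod_inj C I X i) = q i))"

text \<open>Binary coproducts are indexed by \<open>bool\<close>, with \<open>True\<close> for the left summand.\<close>

definition coprod2 :: "('o, 'm) category \<Rightarrow> 'o \<Rightarrow> 'o \<Rightarrow> 'o" where
  "coprod2 C a b = coprod C UNIV (case_bool a b)"

definition inj_left :: "('o, 'm) category \<Rightarrow> 'o \<Rightarrow> 'o \<Rightarrow> 'm" where
  "inj_left C a b = coprod_inj C UNIV (case_bool a b) True"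

definition inj_right :: "('o, 'm) category \<Rightarrow> 'o \<Rightarrow> 'o \<Rightarrow> 'm" where
  "inj_right C a b = coprod_inj C UNIV (case_bool a b) False"

definition copair :: "('o, 'm) category \<Rightarrow> 'o \<Rightarrow> 'o \<Rightarrow> 'o \<Rightarrow> 'm \<Rightarrow> 'm \<Rightarrow> 'm" where
  "copair C a b q f g = cotuple C UNIV (case_bool a b) q (case_bool f g)"

definition coprod2_arr :: "('o, 'm) category \<Rightarrow> 'm \<Rightarrow> 'm \<Rightarrow> 'm" where
  "coprod2_arr C f g =
     copair C (Dom C f) (Dom C g) (coprod2 C (Cod C f) (Cod C g))
       (Cmp C (inj_left C (Cod C f) (Cod C g)) f)
       (Cmp C (inj_right C (Cod C f) (Cod C g)) g)"


section \<open>Simplicial objects\<close>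

text \<open>The object \<open>n\<close> of \<open>Delta\<close> is the ordered set \<open>{0..n}\<close>; an arrow \<open>(m, n, f)\<close> is an order
  preserving map \<open>f\<close> from \<open>{0..m}\<close> to \<open>{0..n}\<close>.\<close>

type_synonym dmor = "nat \<times> nat \<times> (nat \<Rightarrow> nat)"

definition Delta :: "(nat, dmor) category" where
  "Delta = \<lparr>Obj = UNIV,
     Arr = {(m, n, f). f \<in> {0..m} \<rightarrow>\<^sub>E {0..n} \<and> mono_on {0..m} f},
     Dom = fst, Cod = (\<lambda>p. fst (snd p)),
     Idn = (\<lambda>n. (n, n, \<lambda>i \<in> {0..n}. i)),
     Cmp = (\<lambda>(_, k, g) (m, _, f). (m, k, compose {0..m} g f))\<rparr>"

abbreviation Delta_op :: "(nat, dmor) category" where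
  "Delta_op \<equiv> opposite Delta"

type_synonym ('o, 'm) sobj = "(nat, dmor, 'o, 'm) ftor"
type_synonym ('o, 'm) smor = "(nat, dmor, 'o, 'm) ntrans"

abbreviation Simp :: "('o, 'm) category \<Rightarrow> (('o, 'm) sobj, ('o, 'm) smor) category" where
  "Simp C \<equiv> functor_category Delta_op C"

abbreviation const_simp :: "('o, 'm) category \<Rightarrow> ('o, 'm, ('o, 'm) sobj, ('o, 'm) smor) ftor" where
  "const_simp C \<equiv> const_ftor Delta_op C"

abbreviation diagonal ::
  "('o, 'm) category \<Rightarrow>
   ((('o, 'm) sobj, ('o, 'm) smor) sobj, (('o, 'm) sobj, ('o, 'm) smor) smor,
    ('o, 'm) sobj, ('o, 'm) smor) ftor" where
  "diagonal C \<equiv> diag_ftor Delta_op C"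

text \<open>A simplicial set is given by its levels and by the action of the arrows of \<open>Delta\<close>.\<close>

type_synonym 'k sset = "(nat, dmor, 'k set, 'k \<Rightarrow> 'k) ftor"

definition simplex :: "nat \<Rightarrow> dmor sset" where
  "simplex p = Ftor (\<lambda>n. Hom Delta n p) (\<lambda>\<phi> u. Cmp Delta u \<phi>)"

definition tensor :: "('o, 'm) category \<Rightarrow> ('o, 'm) sobj \<Rightarrow> 'k sset \<Rightarrow> ('o, 'm) sobj" where
  "tensor C X K = Ftor
     (\<lambda>n. coprod C (Fo K n) (\<lambda>_. Fo X n))
     (\<lambda>\<phi> \<in> Arr Delta_op. let m = Dom Delta \<phi>; n = Cod Delta \<phi> in
        cotuple C (Fo K n) (\<lambda>_. Fo X n) (coprod C (Fo K m) (\<lambda>_. Fo X m))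
          (\<lambda>k. Cmp C (coprod_inj C (Fo K m) (\<lambda>_. Fo X m) (Fm K \<phi> k)) (Fm X \<phi>)))"

definition cylinder :: "('o, 'm) category \<Rightarrow> ('o, 'm) sobj \<Rightarrow> ('o, 'm) sobj" where
  "cylinder C X = tensor C X (simplex 1)"

text \<open>The coface \<open>d\<^sup>i : [0] \<rightarrow> [1]\<close> omits the value \<open>i\<close>.  In degree \<open>n\<close> the induced inclusion
  of \<open>X\<close> (identified with its tensor with the 0-simplex) into the cylinder is the injection of
  the summand indexed by the composite \<open>[n] \<rightarrow> [0] \<rightarrow> [1]\<close>.\<close>

definition coface01 :: "nat \<Rightarrow> dmor" where
  "coface01 i = (0, 1, \<lambda>_ \<in> {0..0}. 1 - i)"

definition cyl_incl :: "('o, 'm) category \<Rightarrow> nat \<Rightarrow> ('o, 'm) sobj \<Rightarrow> ('o, 'm) smor" where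
  "cyl_incl C i X = Nt X (cylinder C X)
     (\<lambda>n. coprod_inj C (Hom Delta n 1) (\<lambda>_. Fo X n)
            (Cmp Delta (coface01 i) (n, 0, \<lambda>_ \<in> {0..n}. 0)))"

definition simplicial_homotopy ::
  "('o, 'm) category \<Rightarrow> ('o, 'm) smor \<Rightarrow> ('o, 'm) smor \<Rightarrow> ('o, 'm) smor \<Rightarrow> bool" where
  "simplicial_homotopy C f g H \<longleftrightarrow>
     f \<in> Arr (Simp C) \<and> g \<in> Hom (Simp C) (src f) (tgt f) \<and>
     H \<in> Hom (Simp C) (cylinder C (src f)) (tgt f) \<and>
     Cmp (Simp C) H (cyl_incl C 0 (src f)) = f \<and> Cmp (Simp C) H (cyl_incl C 1 (src f)) = g"

text \<open>Simplicial homotopies need not be reversible or composable, so being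
  simplicially homotopic is the equivalence relation they generate.\<close>

definition simplicially_homotopic ::
  "('o, 'm) category \<Rightarrow> ('o, 'm) smor \<Rightarrow> ('o, 'm) smor \<Rightarrow> bool" where
  "simplicially_homotopic C = equivclp (\<lambda>f g. \<exists>H. simplicial_homotopy C f g H)"

definition simplicial_homotopy_equivalence ::
  "('o, 'm) category \<Rightarrow> ('o, 'm) smor \<Rightarrow> bool" where
  "simplicial_homotopy_equivalence C f \<longleftrightarrow> f \<in> Arr (Simp C) \<and>
     (\<exists>g \<in> Hom (Simp C) (tgt f) (src f).
        simplicially_homotopic C (Cmp (Simp C) g f) (Idn (Simp C) (src f)) \<and>
        simplicially_homotopic C (Cmp (Simp C) f g) (Idn (Simp C) (tgt f)))"


section \<open>Closed classes of simplicial maps\<close>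

definition two_out_of_three :: "('o, 'm) category \<Rightarrow> 'm set \<Rightarrow> bool" where
  "two_out_of_three C W \<longleftrightarrow>
     (\<forall>f \<in> Arr C. \<forall>g \<in> Arr C. Cod C f = Dom C g \<longrightarrow>
        (f \<in> W \<and> g \<in> W \<longrightarrow> Cmp C g f \<in> W) \<and>
        (f \<in> W \<and> Cmp C g f \<in> W \<longrightarrow> g \<in> W) \<and>
        (g \<in> W \<and> Cmp C g f \<in> W \<longrightarrow> f \<in> W))"

text \<open>For a map \<open>F\<close> of bisimplicial objects, \<open>cmpnt F n\<close> is the map obtained by fixing the
  first simplicial index to be \<open>n\<close>, and applying evaluation at \<open>n\<close> levelwise fixes the second
  index.\<close>

definition Delta_closed :: "('o, 'm) category \<Rightarrow> ('o, 'm) smor set \<Rightarrow> bool" where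
  "Delta_closed C W \<longleftrightarrow> W \<subseteq> Arr (Simp C) \<and>
     (\<forall>f. simplicial_homotopy_equivalence C f \<longrightarrow> f \<in> W) \<and>
     two_out_of_three (Simp C) W \<and>
     (\<forall>F \<in> Arr (Simp (Simp C)).
        (\<forall>n. cmpnt F n \<in> W) \<or>
        (\<forall>n. Fm (post_ftor Delta_op (Simp C) (eval_ftor Delta_op C n)) F \<in> W)
        \<longrightarrow> Fm (diagonal C) F \<in> W)"

definition Delta_coprod_closed :: "('o, 'm) category \<Rightarrow> ('o, 'm) smor set \<Rightarrow> bool" where
  "Delta_coprod_closed C W \<longleftrightarrow> Delta_closed C W \<and>
     (\<forall>F \<in> W. \<forall>G \<in> W. coprod2_arr (Simp C) F G \<in> W)"


section \<open>Simplicial descent categories\<close>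

definition relative_category :: "('o, 'm) category \<Rightarrow> 'm set \<Rightarrow> bool" where
  "relative_category D E \<longleftrightarrow> category D \<and> saturated D E"

definition closed_by_finite_coproducts :: "('o, 'm) category \<Rightarrow> 'm set \<Rightarrow> bool" where
  "closed_by_finite_coproducts D E \<longleftrightarrow> has_finite_coproducts D \<and>
     (\<forall>f \<in> E. \<forall>g \<in> E. coprod2_arr D f g \<in> E)"

text \<open>The functor \<open>Z \<mapsto> s(n \<mapsto> s(m \<mapsto> Z\<^bsub>n,m\<^esub>))\<close> is \<open>s\<close> after \<open>post_ftor \<dots> s\<close>.  In the
  compatibility conditions, \<open>\<Delta> \<times> X\<close> is \<open>n \<mapsto> X\<close>, that is the constant simplicial object on
  \<open>X\<close> in \<open>Simp D\<close>, and \<open>X \<times> \<Delta>\<close> is \<open>n \<mapsto> c(X\<^sub>n)\<close>; the natural composites are zigzags from \<open>s\<close>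
  to \<open>s\<close> obtained by whiskering \<open>mu\<close> and \<open>lam\<close> letter by letter.\<close>

locale simplicial_descent_structure =
  fixes D :: "('o, 'm) category"
    and E :: "'m set"
    and s :: "(('o, 'm) sobj, ('o, 'm) smor, 'o, 'm) ftor"
    and mu :: "((('o, 'm) sobj, ('o, 'm) smor) sobj, (('o, 'm) sobj, ('o, 'm) smor) smor, 'o, 'm)
                 ntrans letter list"
    and lam :: "('o, 'm, 'o, 'm) ntrans letter list"
  assumes relative: "relative_category D E"
    and coproducts: "closed_by_finite_coproducts D E"
    and S1_functor: "is_functor (Simp D) D s"
    and S1_coproduct: "\<And>X Y. X \<in> Obj (Simp D) \<Longrightarrow> Y \<in> Obj (Simp D) \<Longrightarrow>
      copair D (Fo s X) (Fo s Y) (Fo s (coprod2 (Simp D) X Y))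
        (Fm s (inj_left (Simp D) X Y)) (Fm s (inj_right (Simp D) X Y)) \<in> E"
    and S2: "weq_zigzag (functor_category (Simp (Simp D)) D) (objectwise (Simp (Simp D)) D E)
      (comp_ftor (Simp (Simp D)) s (diagonal D)) mu
      (comp_ftor (Simp (Simp D)) s (post_ftor Delta_op (Simp D) s))"
    and S3: "weq_zigzag (functor_category D D) (objectwise D D E)
      (comp_ftor D s (const_simp D)) lam (id_ftor D)"
    and S3_left: "zz_arr (functor_category (Simp D) D) (objectwise (Simp D) D E) s s
        (map (map_letter (\<lambda>\<eta>. whisker_right (Simp D) \<eta> (const_simp (Simp D)))) mu @
         map (map_letter (\<lambda>\<eta>. whisker_right (Simp D) \<eta> s)) lam)
      = Idn (localization (functor_category (Simp D) D) (objectwise (Simp D) D E)) s"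
    and S3_right: "zz_arr (functor_category (Simp D) D) (objectwise (Simp D) D E) s s
        (map (map_letter (\<lambda>\<eta>. whisker_right (Simp D) \<eta> (post_ftor Delta_op D (const_simp D)))) mu @
         map (map_letter (\<lambda>\<eta>. whisker_left (Simp D) s (post_nt Delta_op D \<eta>))) lam)
      = Idn (localization (functor_category (Simp D) D) (objectwise (Simp D) D E)) s"
    and S4: "\<And>f. f \<in> Arr (Simp D) \<Longrightarrow> (\<And>n. cmpnt f n \<in> E) \<Longrightarrow> Fm s f \<in> E"
    and S5: "\<And>A. A \<in> Obj D \<Longrightarrow> Fm s (cyl_incl D 0 (Fo (const_simp D) A)) \<in> E"

definition simplicial_descent_category ::
  "('o, 'm) category \<Rightarrow> 'm set \<Rightarrow> (('o, 'm) sobj, ('o, 'm) smor, 'o, 'm) ftor \<Rightarrow> bool" where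
  "simplicial_descent_category D E s \<longleftrightarrow> (\<exists>mu lam. simplicial_descent_structure D E s mu lam)"

end

theory Submission
  imports Defs
begin

text \<open>
  Both parts come down to the inclusions of simplicial objects into their cylinders.

  \<^bold>\<open>Homotopy equivalences.\<close>  The only closure property of \<open>s\<^sup>-\<^sup>1E\<close> that is not a formal consequence of
  the descent axioms is that it contains the simplicial homotopy equivalences.  For every simplicial
  object \<open>X\<close> the two inclusions \<open>d\<^sub>0, d\<^sub>1\<close> of \<open>X\<close> into its cylinder are sections of one projection
  (\<open>cylinder_projection\<close>).  Hence, if a functor \<open>T\<close> inverts all \<open>d\<^sub>0\<close>, then it inverts the projections,
  so \<open>T d\<^sub>0 = T d\<^sub>1\<close>, so \<open>T\<close> identifies homotopic maps and inverts homotopy equivalences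
  (\<open>functor_homotopy_equivalence\<close>).  Applying this to \<open>T\<close> followed by a localization functor at a
  saturated class \<open>E\<close> reduces the claim to \<open>T d\<^sub>0 \<in> E\<close> (\<open>homotopy_equivalence_saturated\<close>).

  \<^bold>\<open>Inclusions into cylinders.\<close>  For a simplicial object \<open>A\<close>, let \<open>G\<^bsub>n,m\<^esub>\<close> be the coproduct of copies of
  \<open>A\<^sub>m\<close> indexed by the \<open>n\<close>-simplices of the standard 1-simplex, and let \<open>F\<close> be the map from the
  bisimplicial object \<open>(n, m) \<mapsto> A\<^sub>m\<close> to \<open>G\<close> that includes the summand of the constant simplex \<open>1\<close>.  The
  lemma \<open>bisimplicial_cylinder\<close> reads \<open>F\<close> in three ways: its diagonal is \<open>d\<^sub>0\<close> for \<open>A\<close>; its columns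
  are the maps \<open>d\<^sub>0\<close> for the constant objects on the \<open>A\<^sub>m\<close>; and, up to a comparison map \<open>\<Phi>\<close> that is an
  isomorphism in each row, \<open>F\<close> is itself the map \<open>d\<^sub>0\<close> for the constant simplicial object on \<open>A\<close> in
  simplicial objects.

  \<^bold>\<open>The class \<open>s\<^sup>-\<^sup>1E\<close>.\<close>  Closure under diagonals follows from S4 and S2, for either simplicial direction
  because a bisimplicial map and its transpose have the same diagonal.  By S5 the columns of \<open>F\<close> lie in
  \<open>s\<^sup>-\<^sup>1E\<close>, hence so does its diagonal \<open>d\<^sub>0\<close>.  Closure under coproducts follows from S1 and naturality.

  \<^bold>\<open>The diagonal as a simple functor.\<close>  If the diagonal is a simple functor for \<open>W\<close>, then S5 puts the
  diagonal of \<open>d\<^sub>0\<close> for the constant object on \<open>A\<close> in \<open>W\<close>, and S4 does so for the diagonal of \<open>\<Phi>\<close>;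
  their composite is \<open>d\<^sub>0\<close> for \<open>A\<close>.  Conversely, let \<open>W\<close> be closed.  The zigzags \<open>\<mu>\<close> and \<open>\<lambda>\<close> may be taken
  empty, as the functors that they should connect are equal (\<open>diag_diag\<close>, \<open>diag_const\<close>), which makes
  the compatibility conditions trivial; S1 holds because diagonals preserve coproducts; S4 is
  closure under diagonals; and S5 follows by reading the previous composite backwards, since \<open>d\<^sub>0\<close> for
  \<open>A\<close> is a homotopy equivalence (\<open>cyl_incl_homotopy_equivalence\<close>).
\<close>

section \<open>Functors and natural transformations\<close>

lemma Hom_Arr: "f \<in> Hom C a b \<Longrightarrow> f \<in> Arr C"
  and Hom_Dom: "f \<in> Hom C a b \<Longrightarrow> Dom C f = a"
  and Hom_Cod: "f \<in> Hom C a b \<Longrightarrow> Cod C f = b"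
  and Arr_Hom: "f \<in> Arr C \<Longrightarrow> f \<in> Hom C (Dom C f) (Cod C f)"
  by (auto simp: Hom_def)

lemma (in category) Hom_objs:
  assumes "f \<in> Hom C a b" shows "a \<in> Obj C" "b \<in> Obj C"
  using assms Dom_Obj Cod_Obj by (auto simp: Hom_def)

lemma is_functorI:
  assumes "Fo F \<in> extensional (Obj A)" "Fm F \<in> extensional (Arr A)"
    and "\<And>a. a \<in> Obj A \<Longrightarrow> Fo F a \<in> Obj B"
    and "\<And>f a b. f \<in> Hom A a b \<Longrightarrow> Fm F f \<in> Hom B (Fo F a) (Fo F b)"
    and "\<And>a. a \<in> Obj A \<Longrightarrow> Fm F (Idn A a) = Idn B (Fo F a)"
    and "\<And>f g a b c. f \<in> Hom A a b \<Longrightarrow> g \<in> Hom A b c \<Longrightarrow>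
           Fm F (Cmp A g f) = Cmp B (Fm F g) (Fm F f)"
  shows "is_functor A B F"
  using assms unfolding is_functor_def Hom_def PiE_def Pi_def by fastforce

lemma functor_Obj: "is_functor A B F \<Longrightarrow> a \<in> Obj A \<Longrightarrow> Fo F a \<in> Obj B"
  and functor_Hom: "is_functor A B F \<Longrightarrow> f \<in> Hom A a b \<Longrightarrow> Fm F f \<in> Hom B (Fo F a) (Fo F b)"
  and functor_Arr: "is_functor A B F \<Longrightarrow> f \<in> Arr A \<Longrightarrow> Fm F f \<in> Arr B"
  and functor_Idn: "is_functor A B F \<Longrightarrow> a \<in> Obj A \<Longrightarrow> Fm F (Idn A a) = Idn B (Fo F a)"
  and functor_Cmp: "is_functor A B F \<Longrightarrow> f \<in> Hom A a b \<Longrightarrow> g \<in> Hom A b c \<Longrightarrow>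
        Fm F (Cmp A g f) = Cmp B (Fm F g) (Fm F f)"
  by (auto simp: is_functor_def Hom_def)

lemma functor_eqI:
  assumes "is_functor A B F" "is_functor A B G"
    and "\<And>a. a \<in> Obj A \<Longrightarrow> Fo F a = Fo G a" "\<And>f. f \<in> Arr A \<Longrightarrow> Fm F f = Fm G f"
  shows "F = G"
proof (rule ftor.expand)
  have "Fo F = Fo G" "Fm F = Fm G"
    using assms by (auto simp: is_functor_def PiE_def intro: extensionalityI)
  then show "Fo F = Fo G \<and> Fm F = Fm G" by blast
qed

lemma functor_Hom_eq: 
  "\<eta> \<in> Hom (functor_category A B) F G \<longleftrightarrow> is_ntrans A B \<eta> \<and> src \<eta> = F \<and> tgt \<eta> = G"
  by (auto simp: Hom_def functor_category_def)

lemma Obj_functor_category [simp]: "F \<in> Obj (functor_category A B) \<longleftrightarrow> is_functor A B F"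
  and Dom_functor_category [simp]: "Dom (functor_category A B) = src"
  and Cod_functor_category [simp]: "Cod (functor_category A B) = tgt"
  by (auto simp: functor_category_def)

lemma cmpnt_Idn [simp]: "a \<in> Obj A \<Longrightarrow> cmpnt (Idn (functor_category A B) F) a = Idn B (Fo F a)"
  and cmpnt_Cmp [simp]: "a \<in> Obj A \<Longrightarrow> cmpnt (Cmp (functor_category A B) \<theta> \<eta>) a
        = Cmp B (cmpnt \<theta> a) (cmpnt \<eta> a)"
  by (auto simp: functor_category_def)

lemma nt_HomI:
  assumes "is_functor A B F" "is_functor A B G" "t \<in> extensional (Obj A)"
    and "\<And>a. a \<in> Obj A \<Longrightarrow> t a \<in> Hom B (Fo F a) (Fo G a)"
    and "\<And>f a b. f \<in> Hom A a b \<Longrightarrow> Cmp B (t b) (Fm F f) = Cmp B (Fm G f) (t a)"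
  shows "Nt F G t \<in> Hom (functor_category A B) F G"
  using assms by (auto simp: Hom_def functor_category_def is_ntrans_def)

lemma nt_functors:
  assumes "\<eta> \<in> Hom (functor_category A B) F G" shows "is_functor A B F" "is_functor A B G"
  using assms by (auto simp: functor_Hom_eq is_ntrans_def)

lemma nt_src: "\<eta> \<in> Hom (functor_category A B) F G \<Longrightarrow> src \<eta> = F"
  and nt_tgt: "\<eta> \<in> Hom (functor_category A B) F G \<Longrightarrow> tgt \<eta> = G"
  by (auto simp: functor_Hom_eq)

lemma nt_cmpnt: "\<eta> \<in> Hom (functor_category A B) F G \<Longrightarrow> a \<in> Obj A \<Longrightarrow>
    cmpnt \<eta> a \<in> Hom B (Fo F a) (Fo G a)"
  by (auto simp: functor_Hom_eq is_ntrans_def)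

lemma nt_natural: "\<eta> \<in> Hom (functor_category A B) F G \<Longrightarrow> f \<in> Hom A a b \<Longrightarrow>
    Cmp B (cmpnt \<eta> b) (Fm F f) = Cmp B (Fm G f) (cmpnt \<eta> a)"
  by (auto simp: Hom_def functor_category_def is_ntrans_def)

lemma nt_eqI:
  assumes "\<eta> \<in> Hom (functor_category A B) F G" "\<theta> \<in> Hom (functor_category A B) F G"
    and "\<And>a. a \<in> Obj A \<Longrightarrow> cmpnt \<eta> a = cmpnt \<theta> a"
  shows "\<eta> = \<theta>"
proof (rule ntrans.expand)
  have "cmpnt \<eta> = cmpnt \<theta>" 
    using assms by (auto simp: functor_Hom_eq is_ntrans_def intro: extensionalityI)
  then show "src \<eta> = src \<theta> \<and> tgt \<eta> = tgt \<theta> \<and> cmpnt \<eta> = cmpnt \<theta>" 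
    using assms by (simp add: functor_Hom_eq)
qed

lemma category_functor_category:
  assumes "category A" "category B" shows "category (functor_category A B)"
proof -
  interpret A: category A by fact
  interpret B: category B by fact
  let ?M = "functor_category A B"
  have Id: "Idn ?M F \<in> Hom ?M F F" if "F \<in> Obj ?M" for F
  proof -
    have F: "is_functor A B F" using that by simp
    have "Nt F F (\<lambda>a\<in>Obj A. Idn B (Fo F a)) \<in> Hom ?M F F"
    proof (rule nt_HomI[OF F F])
      fix f a b assume f: "f \<in> Hom A a b"
      show "Cmp B ((\<lambda>a\<in>Obj A. Idn B (Fo F a)) b) (Fm F f) 
          = Cmp B (Fm F f) ((\<lambda>a\<in>Obj A. Idn B (Fo F a)) a)"
        using A.Hom_objs[OF f] functor_Hom[OF F f] by (simp add: B.Cmp_Idn_left B.Cmp_Idn_right)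
    qed (simp_all add: B.Idn_Hom functor_Obj[OF F])
    then show ?thesis by (simp add: functor_category_def)
  qed
  have Co: "Cmp ?M \<theta> \<eta> \<in> Hom ?M F H" if e: "\<eta> \<in> Hom ?M F G" and t: "\<theta> \<in> Hom ?M G H" for \<eta> \<theta> F G H
  proof -
    note F = nt_functors(1)[OF e] and G = nt_functors(2)[OF e] and H = nt_functors(2)[OF t]
    have "Nt F H (\<lambda>a \<in> Obj A. Cmp B (cmpnt \<theta> a) (cmpnt \<eta> a)) \<in> Hom ?M F H"
    proof (rule nt_HomI[OF F H])
      fix f a b assume f: "f \<in> Hom A a b"
      note ab = A.Hom_objs[OF f]
      have "Cmp B (Cmp B (cmpnt \<theta> b) (cmpnt \<eta> b)) (Fm F f) 
          = Cmp B (Fm H f) (Cmp B (cmpnt \<theta> a) (cmpnt \<eta> a))"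
        using B.Cmp_assoc[OF functor_Hom[OF F f] nt_cmpnt[OF e ab(2)] nt_cmpnt[OF t ab(2)]]
          B.Cmp_assoc[OF nt_cmpnt[OF e ab(1)] functor_Hom[OF G f] nt_cmpnt[OF t ab(2)]]
          B.Cmp_assoc[OF nt_cmpnt[OF e ab(1)] nt_cmpnt[OF t ab(1)] functor_Hom[OF H f]]
          nt_natural[OF e f] nt_natural[OF t f] by simp
      then show "Cmp B ((\<lambda>a \<in> Obj A. Cmp B (cmpnt \<theta> a) (cmpnt \<eta> a)) b) (Fm F f)
          = Cmp B (Fm H f) ((\<lambda>a \<in> Obj A. Cmp B (cmpnt \<theta> a) (cmpnt \<eta> a)) a)" using ab by simp
    qed (simp_all add: B.Cmp_Hom[OF nt_cmpnt[OF e] nt_cmpnt[OF t]])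
    moreover have "Cmp ?M \<theta> \<eta> = Nt F H (\<lambda>a \<in> Obj A. Cmp B (cmpnt \<theta> a) (cmpnt \<eta> a))"
      using nt_src[OF e] nt_tgt[OF t] by (simp add: functor_category_def)
    ultimately show ?thesis by simp
  qed
  show ?thesis
  proof
    fix f assume "f \<in> Arr ?M"
    then show "Dom ?M f \<in> Obj ?M" "Cod ?M f \<in> Obj ?M" 
      by (auto simp: functor_category_def is_ntrans_def)
  next
    fix f F G assume f: "f \<in> Hom ?M F G"
    have FG: "F \<in> Obj ?M" "G \<in> Obj ?M" using nt_functors[OF f] by simp_all
    show "Cmp ?M (Idn ?M G) f = f"
      by (rule nt_eqI[OF Co[OF f Id[OF FG(2)]] f]) 
        (simp add: B.Cmp_Idn_left[OF nt_cmpnt[OF f]])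
    show "Cmp ?M f (Idn ?M F) = f"
      by (rule nt_eqI[OF Co[OF Id[OF FG(1)] f] f]) 
        (simp add: B.Cmp_Idn_right[OF nt_cmpnt[OF f]])
  next
    fix f g h F G H K assume f: "f \<in> Hom ?M F G" and g: "g \<in> Hom ?M G H" and h: "h \<in> Hom ?M H K"
    show "Cmp ?M h (Cmp ?M g f) = Cmp ?M (Cmp ?M h g) f"
      by (rule nt_eqI[OF Co[OF Co[OF f g] h] Co[OF f Co[OF g h]]])
        (simp add: B.Cmp_assoc[OF nt_cmpnt[OF f] nt_cmpnt[OF g] nt_cmpnt[OF h]])
  qed (use Id Co in auto)
qed

lemma Fo_comp [simp]: "a \<in> Obj A \<Longrightarrow> Fo (comp_ftor A G F) a = Fo G (Fo F a)"
  and Fm_comp [simp]: "f \<in> Arr A \<Longrightarrow> Fm (comp_ftor A G F) f = Fm G (Fm F f)"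
  by (simp_all add: comp_ftor_def compose_def)

lemma is_functor_comp:
  assumes "category A" and F: "is_functor A B F" and G: "is_functor B C G"
  shows "is_functor A C (comp_ftor A G F)"
proof -
  interpret A: category A by fact
  show ?thesis
  proof (rule is_functorI)
    fix f a b assume f: "f \<in> Hom A a b"
    show "Fm (comp_ftor A G F) f \<in> Hom C (Fo (comp_ftor A G F) a) (Fo (comp_ftor A G F) b)"
      using functor_Hom[OF G functor_Hom[OF F f]] A.Hom_objs[OF f] by (simp add: Hom_Arr[OF f])
    fix g c assume g: "g \<in> Hom A b c"
    show "Fm (comp_ftor A G F) (Cmp A g f) = Cmp C (Fm (comp_ftor A G F) g) (Fm (comp_ftor A G F) f)"
      using Hom_Arr[OF f] Hom_Arr[OF g] Hom_Arr[OF A.Cmp_Hom[OF f g]]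
      by (simp add: functor_Cmp[OF F f g] functor_Cmp[OF G functor_Hom[OF F f] functor_Hom[OF F g]])
  qed (auto simp: functor_Obj[OF F] functor_Obj[OF G] functor_Idn[OF F] functor_Idn[OF G]
        A.Idn_Hom[THEN Hom_Arr], simp_all add: comp_ftor_def)
qed

lemma is_functor_id: 
  assumes "category A" shows "is_functor A A (id_ftor A)"
proof -
  interpret A: category A by fact
  show ?thesis
    by (rule is_functorI)
      (auto simp: id_ftor_def Hom_Arr A.Hom_objs A.Idn_Hom[THEN Hom_Arr] A.Cmp_Hom[THEN Hom_Arr])
qed

lemma whisker_left_Hom:
  assumes "category J" and G: "is_functor B C G" and e: "\<eta> \<in> Hom (functor_category J B) X Y"
  shows "whisker_left J G \<eta> \<in> Hom (functor_category J C) (comp_ftor J G X) (comp_ftor J G Y)"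
proof -
  interpret J: category J by fact
  note X = nt_functors(1)[OF e] and Y = nt_functors(2)[OF e]
  have [simp]: "src \<eta> = X" "tgt \<eta> = Y" using e by (auto simp: functor_Hom_eq)
  show ?thesis unfolding whisker_left_def
  proof (simp, rule nt_HomI[OF is_functor_comp[OF J.category_axioms X G] is_functor_comp[OF J.category_axioms Y G]])
    fix f a b assume f: "f \<in> Hom J a b"
    note ab = J.Hom_objs[OF f]
    show "Cmp C ((\<lambda>a\<in>Obj J. Fm G (cmpnt \<eta> a)) b) (Fm (comp_ftor J G X) f) 
        = Cmp C (Fm (comp_ftor J G Y) f) ((\<lambda>a\<in>Obj J. Fm G (cmpnt \<eta> a)) a)"
      using ab f nt_natural[OF e f] functor_Hom[OF X f] functor_Hom[OF Y f]
        nt_cmpnt[OF e ab(1)] nt_cmpnt[OF e ab(2)]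
      by (simp add: Hom_Arr[OF f] functor_Cmp[OF G, symmetric])
  qed (auto intro!: functor_Hom[OF G] nt_cmpnt[OF e])
qed

lemma is_functor_post:
  assumes J: "category J" and B: "category B" "category C" and G: "is_functor B C G"
  shows "is_functor (functor_category J B) (functor_category J C) (post_ftor J B G)"
proof -
  let ?M = "functor_category J B" and ?N = "functor_category J C"
  interpret M: category ?M using category_functor_category[OF J B(1)] .
  interpret N: category ?N using category_functor_category[OF J B(2)] .
  have H: "Fm (post_ftor J B G) \<eta> \<in> Hom ?N (Fo (post_ftor J B G) X) (Fo (post_ftor J B G) Y)"
    if "\<eta> \<in> Hom ?M X Y" for \<eta> X Y
    using whisker_left_Hom[OF J G that] nt_functors[OF that] Hom_Arr[OF that] 
    by (simp add: post_ftor_def)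
  show ?thesis
  proof (rule is_functorI)
    show "Fo (post_ftor J B G) a \<in> Obj ?N" if "a \<in> Obj ?M" for a
      using that is_functor_comp[OF J _ G] by (auto simp: post_ftor_def)
  next
    fix X assume X: "X \<in> Obj ?M"
    have X': "is_functor J C (comp_ftor J G X)" using X is_functor_comp[OF J _ G] by auto
    note * = M.Idn_Hom[OF X]
    show "Fm (post_ftor J B G) (Idn ?M X) = Idn ?N (Fo (post_ftor J B G) X)"
      by (rule nt_eqI[OF H[OF *]])
        (use X X' Hom_Arr[OF *] in \<open>auto intro: N.Idn_Hom simp: post_ftor_def whisker_left_def 
          functor_Idn[OF G] functor_Obj\<close>)
  next
    fix f g X Y Z assume f: "f \<in> Hom ?M X Y" and g: "g \<in> Hom ?M Y Z"
    note * = M.Cmp_Hom[OF f g]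
    show "Fm (post_ftor J B G) (Cmp ?M g f) = Cmp ?N (Fm (post_ftor J B G) g) (Fm (post_ftor J B G) f)"
      by (rule nt_eqI[OF H[OF *] N.Cmp_Hom[OF H[OF f] H[OF g]]])
        (use Hom_Arr[OF *] Hom_Arr[OF f] Hom_Arr[OF g] in 
          \<open>simp add: post_ftor_def whisker_left_def functor_Cmp[OF G nt_cmpnt[OF f] nt_cmpnt[OF g]]\<close>)
  qed (use H in \<open>auto simp: post_ftor_def\<close>)
qed

lemma is_functor_eval:
  assumes J: "category J" and B: "category B" and j: "j \<in> Obj J"
  shows "is_functor (functor_category J B) B (eval_ftor J B j)"
proof -
  interpret M: category "functor_category J B" using category_functor_category[OF J B] .
  show ?thesis
    by (rule is_functorI)
      (use j in \<open>auto simp: eval_ftor_def functor_Obj Hom_Arr nt_functors M.Idn_Hom[THEN Hom_Arr]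
        M.Cmp_Hom[THEN Hom_Arr] intro: nt_cmpnt\<close>)
qed

section \<open>The category of finite ordinals\<close>

lemma opposite_simps [simp]: "Obj (opposite C) = Obj C" "Arr (opposite C) = Arr C"
  "Dom (opposite C) = Cod C" "Cod (opposite C) = Dom C" "Idn (opposite C) = Idn C"
  "Cmp (opposite C) g f = Cmp C f g" "Hom (opposite C) a b = Hom C b a"
  by (auto simp: opposite_def Hom_def)

lemma category_opposite: "category C \<Longrightarrow> category (opposite C)"
  by unfold_locales (auto simp: category.Dom_Obj category.Cod_Obj category.Idn_Hom 
      category.Cmp_Idn_left category.Cmp_Idn_right category.Cmp_assoc intro: category.Cmp_Hom)

lemma Hom_Delta: "u \<in> Hom Delta m n \<longleftrightarrow> 
    (\<exists>f. u = (m, n, f) \<and> f \<in> {0..m} \<rightarrow>\<^sub>E {0..n} \<and> mono_on {0..m} f)"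
  by (auto simp: Hom_def Delta_def)

lemma Cmp_Delta: "Cmp Delta (n, k, g) (m, n', f) = (m, k, compose {0..m} g f)"
  and Idn_Delta: "Idn Delta n = (n, n, \<lambda>i \<in> {0..n}. i)"
  and Obj_Delta [simp]: "Obj Delta = UNIV"
  by (simp_all add: Delta_def)

lemma category_Delta: "category Delta"
proof
  fix f assume "f \<in> Arr Delta" 
  then show "Dom Delta f \<in> Obj Delta" "Cod Delta f \<in> Obj Delta" by auto
next
  fix a show "Idn Delta a \<in> Hom Delta a a" 
    by (auto simp: Hom_Delta Idn_Delta mono_on_def)
next
  fix f g h a b c d assume f: "f \<in> Hom Delta a b" and g: "g \<in> Hom Delta b c"
  then show "Cmp Delta g f \<in> Hom Delta a c" 
    by (auto simp: Hom_Delta Cmp_Delta compose_def mono_on_def PiE_iff) 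
  assume "h \<in> Hom Delta c d" 
  with f g show "Cmp Delta h (Cmp Delta g f) = Cmp Delta (Cmp Delta h g) f"
    by (auto simp: Hom_Delta Cmp_Delta compose_def fun_eq_iff PiE_iff)
next
  fix f a b assume "f \<in> Hom Delta a b"
  then show "Cmp Delta (Idn Delta b) f = f" "Cmp Delta f (Idn Delta a) = f"
    by (auto simp: Hom_Delta Cmp_Delta Idn_Delta compose_def fun_eq_iff PiE_iff extensional_def)
qed

lemmas category_Delta_op = category_opposite[OF category_Delta]

lemma category_Simp: "category C \<Longrightarrow> category (Simp C)"
  by (rule category_functor_category[OF category_Delta_op])

lemma finite_Hom_Delta: "finite (Hom Delta m n)"
proof -
  have "Hom Delta m n \<subseteq> (\<lambda>f. (m, n, f)) ` ({0..m} \<rightarrow>\<^sub>E {0..n})" by (auto simp: Hom_Delta)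
  then show ?thesis by (rule finite_subset) (simp add: finite_PiE)
qed

section \<open>Isomorphisms and the localization\<close>

lemma is_isoI:
  assumes "f \<in> Hom C a b" "g \<in> Hom C b a" "Cmp C g f = Idn C a" "Cmp C f g = Idn C b"
  shows "is_iso C f"
  using assms by (auto simp: is_iso_def Hom_def)

lemma is_isoE:
  assumes "is_iso C f" "f \<in> Hom C a b"
  obtains g where "g \<in> Hom C b a" "Cmp C g f = Idn C a" "Cmp C f g = Idn C b"
  using assms by (auto simp: is_iso_def Hom_def)

context category begin

lemma iso_Idn: "a \<in> Obj C \<Longrightarrow> is_iso C (Idn C a)"
  using Idn_Hom[of a] Cmp_Idn_left[OF Idn_Hom[of a]] by (auto intro: is_isoI)

lemma iso_Cmp:
  assumes f: "f \<in> Hom C a b" and g: "g \<in> Hom C b c" and "is_iso C f" "is_iso C g"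
  shows "is_iso C (Cmp C g f)"
proof -
  obtain f' where f': "f' \<in> Hom C b a" "Cmp C f' f = Idn C a" "Cmp C f f' = Idn C b"
    using is_isoE assms(1,3) by metis
  obtain g' where g': "g' \<in> Hom C c b" "Cmp C g' g = Idn C b" "Cmp C g g' = Idn C c"
    using is_isoE assms(2,4) by metis
  have "Cmp C (Cmp C f' g') (Cmp C g f) = Cmp C f' (Cmp C (Cmp C g' g) f)"
    using Cmp_assoc[OF Cmp_Hom[OF f g] g'(1) f'(1)] Cmp_assoc[OF f g g'(1)] by simp
  then have 1: "Cmp C (Cmp C f' g') (Cmp C g f) = Idn C a" 
    using f' g' Cmp_Idn_left[OF f] by simp
  have "Cmp C (Cmp C g f) (Cmp C f' g') = Cmp C g (Cmp C (Cmp C f f') g')"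
    using Cmp_assoc[OF Cmp_Hom[OF g'(1) f'(1)] f g] Cmp_assoc[OF g'(1) f'(1) f] by simp
  then have 2: "Cmp C (Cmp C g f) (Cmp C f' g') = Idn C c"
    using f' g' Cmp_Idn_left[OF g'(1)] by simp
  show ?thesis by (rule is_isoI[OF Cmp_Hom[OF f g] Cmp_Hom[OF g'(1) f'(1)] 1 2])
qed

lemma iso_cancel_right:
  assumes f: "f \<in> Hom C a b" and g: "g \<in> Hom C b c" and "is_iso C f" "is_iso C (Cmp C g f)"
  shows "is_iso C g"
proof -
  obtain f' where f': "f' \<in> Hom C b a" "Cmp C f' f = Idn C a" "Cmp C f f' = Idn C b"
    using is_isoE assms(1,3) by metis
  have "is_iso C f'" using is_isoI[OF f'(1) f f'(3,2)] .
  then have "is_iso C (Cmp C (Cmp C g f) f')"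
    using iso_Cmp[OF f'(1) Cmp_Hom[OF f g] _ assms(4)] by blast
  then show ?thesis using Cmp_assoc[OF f'(1) f g] f'(3) Cmp_Idn_right[OF g] by simp
qed

lemma iso_cancel_left:
  assumes f: "f \<in> Hom C a b" and g: "g \<in> Hom C b c" and "is_iso C g" "is_iso C (Cmp C g f)"
  shows "is_iso C f"
proof -
  obtain g' where g': "g' \<in> Hom C c b" "Cmp C g' g = Idn C b" "Cmp C g g' = Idn C c"
    using is_isoE assms(2,3) by metis
  have "is_iso C g'" using is_isoI[OF g'(1) g g'(3,2)] .
  then have "is_iso C (Cmp C g' (Cmp C g f))"
    using iso_Cmp[OF Cmp_Hom[OF f g] g'(1) assms(4)] by blast
  then show ?thesis using Cmp_assoc[OF f g g'(1)] g'(2) Cmp_Idn_left[OF f] by simp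
qed

lemma iso_left_inverse:
  assumes p: "p \<in> Hom C b a" and d: "d \<in> Hom C a b" and "Cmp C p d = Idn C a" "is_iso C d"
  shows "is_iso C p"
  using iso_cancel_right[OF d p] assms iso_Idn Hom_objs[OF d] by simp

lemma iso_monic:
  assumes p: "p \<in> Hom C b c" and "is_iso C p" and x: "x \<in> Hom C a b" and y: "y \<in> Hom C a b"
    and eq: "Cmp C p x = Cmp C p y"
  shows "x = y"
proof -
  obtain q where q: "q \<in> Hom C c b" "Cmp C q p = Idn C b" using is_isoE assms(1,2) by metis
  show ?thesis 
    using Cmp_assoc[OF x p q(1)] Cmp_assoc[OF y p q(1)] q(2) eq Cmp_Idn_left[OF x] Cmp_Idn_left[OF y] 
    by metis
qed

lemma zz_path_objs: "zz_path C W a u b \<Longrightarrow> a \<in> Obj C \<and> b \<in> Obj C"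
proof (induction u arbitrary: a)
  case (Cons l u) then show ?case by (cases l) (auto simp: Dom_Obj Cod_Obj)
qed simp

lemma zz_path_append: 
  "zz_path C W a (u @ v) b \<longleftrightarrow> (\<exists>x. zz_path C W a u x \<and> zz_path C W x v b)"
proof (induction u arbitrary: a)
  case Nil then show ?case using zz_path_objs by auto
next
  case (Cons l u) then show ?case by (cases l) auto
qed

lemma zz_equiv_path: "zz_equiv C W a b u v \<Longrightarrow> zz_path C W a u b \<and> zz_path C W a v b"
  by (induction rule: zz_equiv.induct) (auto simp: zz_path_append)

lemma zz_equiv_append_right:
  "zz_equiv C W a b u u' \<Longrightarrow> zz_path C W b v c \<Longrightarrow> zz_equiv C W a c (u @ v) (u' @ v)"
proof (induction rule: zz_equiv.induct)
  case (zz_step r r' u x y w)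
  have "zz_path C W y (w @ v) c" using zz_step by (auto simp: zz_path_append)
  from zz_equiv.zz_step[OF zz_step(1-4) this] show ?case by simp
qed (auto intro: zz_equiv.zz_sym zz_equiv.zz_trans, auto intro!: zz_equiv.zz_refl simp: zz_path_append)

lemma zz_equiv_append_left:
  "zz_equiv C W b c v v' \<Longrightarrow> zz_path C W a u b \<Longrightarrow> zz_equiv C W a c (u @ v) (u @ v')"
proof (induction rule: zz_equiv.induct)
  case (zz_step r r' w x y z)
  have "zz_path C W a (u @ w) x" using zz_step by (auto simp: zz_path_append)
  from zz_equiv.zz_step[OF zz_step(1) this zz_step(3-5)] show ?case by simp
qed (auto intro: zz_equiv.zz_sym zz_equiv.zz_trans, auto intro!: zz_equiv.zz_refl simp: zz_path_append)

lemma zz_equiv_append: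
  assumes u: "zz_equiv C W a b u u'" and v: "zz_equiv C W b c v v'"
  shows "zz_equiv C W a c (u @ v) (u' @ v')"
  by (rule zz_trans[OF zz_equiv_append_right[OF u] zz_equiv_append_left[OF v]])
    (use zz_equiv_path[OF u] zz_equiv_path[OF v] in auto)

lemma zz_equiv_basic:
  assumes "zz_basic C W r r'" "zz_path C W a r b" "zz_path C W a r' b"
  shows "zz_equiv C W a b r r'"
  using zz_step[OF assms(1) _ assms(2,3), of a "[]" "[]" b] zz_path_objs[OF assms(2)] by simp

lemma zz_arr_eqI: "zz_equiv C W a b u v \<Longrightarrow> zz_arr C W a b u = zz_arr C W a b v"
  unfolding zz_arr_def by (auto intro: zz_sym zz_trans)

lemma zz_arr_Hom: "zz_path C W a u b \<Longrightarrow> zz_arr C W a b u \<in> Hom (localization C W) a b"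
  by (auto simp: Hom_def localization_def zz_arr_def)

lemma localization_HomE:
  assumes "f \<in> Hom (localization C W) a b"
  obtains u where "zz_path C W a u b" "f = zz_arr C W a b u"
  using assms by (auto simp: Hom_def localization_def zz_arr_def)

text \<open>Composition in the localization is concatenation of zigzags, in path order.\<close>

lemma localization_Cmp:
  assumes u: "zz_path C W a u b" and v: "zz_path C W b v c"
  shows "Cmp (localization C W) (zz_arr C W b c v) (zz_arr C W a b u) = zz_arr C W a c (u @ v)"
proof -
  have "(\<exists>u'\<in>{u'. zz_equiv C W a b u u'}. \<exists>v'\<in>{v'. zz_equiv C W b c v v'}. zz_equiv C W a c (u' @ v') w)
      \<longleftrightarrow> zz_equiv C W a c (u @ v) w" for w
    using zz_refl[OF u] zz_refl[OF v] by (auto intro: zz_trans zz_equiv_append)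
  then show ?thesis by (simp add: localization_def zz_arr_def)
qed

lemma category_localization: "category (localization C W)"
proof -
  let ?L = "localization C W"
  have obj: "a \<in> Obj C \<and> b \<in> Obj C" if "f \<in> Hom ?L a b" for f a b
    using that by (auto elim!: localization_HomE dest: zz_path_objs)
  have O: "Obj ?L = Obj C" by (simp add: localization_def)
  have I: "Idn ?L a = zz_arr C W a a []" for a by (simp add: localization_def)
  show ?thesis
  proof
    fix f assume "f \<in> Arr ?L" 
    from obj[OF Arr_Hom[OF this]] O show "Dom ?L f \<in> Obj ?L" "Cod ?L f \<in> Obj ?L" by auto
  next
    fix a assume "a \<in> Obj ?L" then show "Idn ?L a \<in> Hom ?L a a"
      unfolding I O by (auto intro: zz_arr_Hom)
  next
    fix f a b assume f: "f \<in> Hom ?L a b"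
    from f obtain u where "zz_path C W a u b" "f = zz_arr C W a b u" by (rule localization_HomE)
    with obj[OF f] show "Cmp ?L (Idn ?L b) f = f" "Cmp ?L f (Idn ?L a) = f"
      unfolding I using localization_Cmp[of W a u b "[]" b] localization_Cmp[of W a "[]" a u b] by auto
  next
    fix f g h a b c d assume f: "f \<in> Hom ?L a b" and g: "g \<in> Hom ?L b c"
    from f obtain u where u: "zz_path C W a u b" "f = zz_arr C W a b u" by (rule localization_HomE)
    from g obtain v where v: "zz_path C W b v c" "g = zz_arr C W b c v" by (rule localization_HomE)
    have uv: "zz_path C W a (u @ v) c" using u v by (auto simp: zz_path_append)
    then show "Cmp ?L g f \<in> Hom ?L a c" using u v by (simp add: localization_Cmp zz_arr_Hom)
    assume h: "h \<in> Hom ?L c d"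
    from h obtain w where w: "zz_path C W c w d" "h = zz_arr C W c d w" by (rule localization_HomE)
    have vw: "zz_path C W b (v @ w) d" using v w by (auto simp: zz_path_append)
    show "Cmp ?L h (Cmp ?L g f) = Cmp ?L (Cmp ?L h g) f"
      using u v w uv vw by (simp add: localization_Cmp[OF u(1) v(1)] localization_Cmp[OF v(1) w(1)]
       localization_Cmp[OF uv w(1)] localization_Cmp[OF u(1) vw])
  qed
qed

end

text \<open>The canonical functor from a category to its localization.\<close>

definition loc_ftor ::
  "('o, 'm) category \<Rightarrow> 'm set \<Rightarrow> ('o, 'm, 'o, 'o \<times> 'o \<times> 'm letter list set) ftor" where
  "loc_ftor C W = Ftor (\<lambda>a \<in> Obj C. a) (\<lambda>f \<in> Arr C. zz_arr C W (Dom C f) (Cod C f) [Fwd f])"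

context category begin

lemma is_functor_loc: "is_functor C (localization C W) (loc_ftor C W)"
proof (rule is_functorI)
  fix f a b assume f: "f \<in> Hom C a b"
  have pf: "zz_path C W a [Fwd f] b" using f Hom_objs[OF f] by (auto simp: Hom_def)
  have Fm: "Fm (loc_ftor C W) f = zz_arr C W a b [Fwd f]" using f by (auto simp: loc_ftor_def Hom_def)
  show "Fm (loc_ftor C W) f \<in> Hom (localization C W) (Fo (loc_ftor C W) a) (Fo (loc_ftor C W) b)"
    using zz_arr_Hom[OF pf] Fm Hom_objs[OF f] by (simp add: loc_ftor_def)
  fix g c assume g: "g \<in> Hom C b c"
  have pg: "zz_path C W b [Fwd g] c" using g Hom_objs[OF g] by (auto simp: Hom_def)
  have gf: "Cmp C g f \<in> Hom C a c" by (rule Cmp_Hom[OF f g])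
  have "zz_equiv C W a c [Fwd f, Fwd g] [Fwd (Cmp C g f)]"
    by (rule zz_equiv_basic[OF zz_comp]) (use f g gf Hom_objs[OF gf] in \<open>auto simp: Hom_def\<close>)
  then have "Cmp (localization C W) (zz_arr C W b c [Fwd g]) (zz_arr C W a b [Fwd f]) 
      = zz_arr C W a c [Fwd (Cmp C g f)]"
    using localization_Cmp[OF pf pg] by (simp add: zz_arr_eqI)
  then show "Fm (loc_ftor C W) (Cmp C g f) 
      = Cmp (localization C W) (Fm (loc_ftor C W) g) (Fm (loc_ftor C W) f)"
    using Fm g gf by (auto simp: loc_ftor_def Hom_def)
next
  fix a assume a: "a \<in> Obj C"
  have "zz_equiv C W a a [Fwd (Idn C a)] []"
    by (rule zz_equiv_basic[OF zz_id]) (use a Idn_Hom[OF a] in \<open>auto simp: Hom_def\<close>)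
  then show "Fm (loc_ftor C W) (Idn C a) = Idn (localization C W) (Fo (loc_ftor C W) a)"
    using a Idn_Hom[OF a] by (auto simp: loc_ftor_def Hom_def localization_def intro: zz_arr_eqI)
qed (auto simp: loc_ftor_def localization_def)

text \<open>A saturated class is the preimage of the isomorphisms under the localization functor; it
  therefore inherits their closure properties.\<close>

lemma saturated_iff:
  assumes "saturated C W" "f \<in> Arr C"
  shows "f \<in> W \<longleftrightarrow> is_iso (localization C W) (Fm (loc_ftor C W) f)"
  using assms by (subst (asm) saturated_def) (auto simp: loc_ftor_def)

lemma functor_iso:
  assumes F: "is_functor C B F" and f: "f \<in> Hom C a b" and "is_iso C f"
  shows "is_iso B (Fm F f)"
proof -
  obtain g where g: "g \<in> Hom C b a" "Cmp C g f = Idn C a" "Cmp C f g = Idn C b"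
    using is_isoE assms(2,3) by metis
  show ?thesis
    using is_isoI[OF functor_Hom[OF F f] functor_Hom[OF F g(1)]] functor_Cmp[OF F f g(1)] g
      functor_Cmp[OF F g(1) f] functor_Idn[OF F] Hom_objs[OF f] by simp
qed

lemma saturated_iso:
  assumes W: "saturated C W" and f: "f \<in> Hom C a b" and "is_iso C f"
  shows "f \<in> W"
  using functor_iso[OF is_functor_loc f assms(3)] saturated_iff[OF W Hom_Arr[OF f]] by simp

lemma saturated_two_out_of_three:
  assumes W: "saturated C W"
  shows "two_out_of_three C W"
proof -
  interpret L: category "localization C W" by (rule category_localization)
  show ?thesis
    unfolding two_out_of_three_def
  proof (intro ballI impI)
    fix f g assume fg: "f \<in> Arr C" "g \<in> Arr C" "Cod C f = Dom C g"
    have f: "f \<in> Hom C (Dom C f) (Cod C f)" and g: "g \<in> Hom C (Cod C f) (Cod C g)"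
      using fg by (auto simp: Hom_def)
    note F = functor_Hom[OF is_functor_loc f, of W] and G = functor_Hom[OF is_functor_loc g, of W]
    show "(f \<in> W \<and> g \<in> W \<longrightarrow> Cmp C g f \<in> W) \<and> (f \<in> W \<and> Cmp C g f \<in> W \<longrightarrow> g \<in> W) \<and>
      (g \<in> W \<and> Cmp C g f \<in> W \<longrightarrow> f \<in> W)"
      using saturated_iff[OF W Hom_Arr[OF f]] saturated_iff[OF W Hom_Arr[OF g]]
        saturated_iff[OF W Hom_Arr[OF Cmp_Hom[OF f g]]] functor_Cmp[OF is_functor_loc f g, of W]
        L.iso_Cmp[OF F G] L.iso_cancel_left[OF F G] L.iso_cancel_right[OF F G] by auto
  qed
qed

end

lemma saturated_subset: "saturated C W \<Longrightarrow> W \<subseteq> Arr C"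
  by (subst (asm) saturated_def) auto

lemma two_out_of_threeD:
  assumes "two_out_of_three C W" "f \<in> Hom C a b" "g \<in> Hom C b c"
  shows "f \<in> W \<Longrightarrow> g \<in> W \<Longrightarrow> Cmp C g f \<in> W" "f \<in> W \<Longrightarrow> Cmp C g f \<in> W \<Longrightarrow> g \<in> W"
    "g \<in> W \<Longrightarrow> Cmp C g f \<in> W \<Longrightarrow> f \<in> W"
  using assms by (auto simp: two_out_of_three_def Hom_def)

section \<open>Finite coproducts, also in functor categories\<close>

lemma coproduct_Obj: "is_coproduct C I X P \<iota> \<Longrightarrow> P \<in> Obj C"
  and coproduct_inj: "is_coproduct C I X P \<iota> \<Longrightarrow> i \<in> I \<Longrightarrow> \<iota> i \<in> Hom C (X i) P"
  by (auto simp: is_coproduct_def)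

lemma coproduct_factor:
  assumes "is_coproduct C I X P \<iota>" "Q \<in> Obj C" "\<And>i. i \<in> I \<Longrightarrow> q i \<in> Hom C (X i) Q"
  shows "\<exists>!h. h \<in> Hom C P Q \<and> (\<forall>i \<in> I. Cmp C h (\<iota> i) = q i)"
  using assms unfolding is_coproduct_def by blast

lemma is_coproduct_cong:
  assumes "is_coproduct C I X P \<iota>" "\<And>i. i \<in> I \<Longrightarrow> X i = X' i" "\<And>i. i \<in> I \<Longrightarrow> \<iota> i = \<iota>' i"
  shows "is_coproduct C I X' P \<iota>'"
  using assms unfolding is_coproduct_def by auto

lemma is_coproductI:
  assumes "P \<in> Obj C" "\<And>i. i \<in> I \<Longrightarrow> \<iota> i \<in> Hom C (X i) P"
    and "\<And>Q q. Q \<in> Obj C \<Longrightarrow> (\<And>i. i \<in> I \<Longrightarrow> q i \<in> Hom C (X i) Q) \<Longrightarrow>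
           \<exists>h. h \<in> Hom C P Q \<and> (\<forall>i \<in> I. Cmp C h (\<iota> i) = q i)"
    and "\<And>Q h k. h \<in> Hom C P Q \<Longrightarrow> k \<in> Hom C P Q \<Longrightarrow> 
           (\<And>i. i \<in> I \<Longrightarrow> Cmp C h (\<iota> i) = Cmp C k (\<iota> i)) \<Longrightarrow> h = k"
  shows "is_coproduct C I X P \<iota>"
  unfolding is_coproduct_def
proof (intro conjI ballI allI impI)
  fix Q q assume "Q \<in> Obj C" "\<forall>i\<in>I. q i \<in> Hom C (X i) Q"
  then obtain h where h: "h \<in> Hom C P Q \<and> (\<forall>i \<in> I. Cmp C h (\<iota> i) = q i)" using assms(3) by blast
  show "\<exists>!h. h \<in> Hom C P Q \<and> (\<forall>i \<in> I. Cmp C h (\<iota> i) = q i)"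
    by (rule ex1I[of _ h]) (use h assms(4) in auto)
qed (use assms in auto)

context category begin

lemma coproduct_eqI:
  assumes P: "is_coproduct C I X P \<iota>" and h: "h \<in> Hom C P Q" and k: "k \<in> Hom C P Q"
    and eq: "\<And>i. i \<in> I \<Longrightarrow> Cmp C h (\<iota> i) = Cmp C k (\<iota> i)"
  shows "h = k"
proof -
  have "\<exists>!h. h \<in> Hom C P Q \<and> (\<forall>i \<in> I. Cmp C h (\<iota> i) = Cmp C k (\<iota> i))"
    using Cmp_Hom[OF coproduct_inj[OF P] k] Hom_objs[OF k]
    by (intro coproduct_factor[OF P]) auto
  then show ?thesis using h k eq by blast
qed

lemma coproduct_comparison_iso:
  assumes P: "is_coproduct C I X P \<iota>" and P': "is_coproduct C I X P' \<iota>'"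
    and h: "h \<in> Hom C P P'" and eq: "\<And>i. i \<in> I \<Longrightarrow> Cmp C h (\<iota> i) = \<iota>' i"
  shows "is_iso C h"
proof -
  obtain k where k: "k \<in> Hom C P' P" "\<And>i. i \<in> I \<Longrightarrow> Cmp C k (\<iota>' i) = \<iota> i"
    using coproduct_factor[OF P' coproduct_Obj[OF P], of \<iota>] coproduct_inj[OF P] by blast
  have "Cmp C k h = Idn C P"
    by (rule coproduct_eqI[OF P Cmp_Hom[OF h k(1)] Idn_Hom[OF coproduct_Obj[OF P]]])
      (use eq k Cmp_assoc[OF coproduct_inj[OF P] h k(1)] Cmp_Idn_left[OF coproduct_inj[OF P]] in simp)
  moreover have "Cmp C h k = Idn C P'"
    by (rule coproduct_eqI[OF P' Cmp_Hom[OF k(1) h] Idn_Hom[OF coproduct_Obj[OF P']]])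
      (use eq k Cmp_assoc[OF coproduct_inj[OF P'] k(1) h] Cmp_Idn_left[OF coproduct_inj[OF P']] in simp)
  ultimately show ?thesis using is_isoI[OF h k(1)] by blast
qed

lemma coproduct_transport:
  assumes P: "is_coproduct C I X P \<iota>" and f: "f \<in> Hom C P P'" and "is_iso C f"
    and eq: "\<And>i. i \<in> I \<Longrightarrow> Cmp C f (\<iota> i) = \<iota>' i"
  shows "is_coproduct C I X P' \<iota>'"
proof -
  obtain g where g: "g \<in> Hom C P' P" "Cmp C g f = Idn C P" "Cmp C f g = Idn C P'"
    using is_isoE assms(2,3) by metis
  have i: "\<iota>' i \<in> Hom C (X i) P'" if "i \<in> I" for i
    using Cmp_Hom[OF coproduct_inj[OF P that] f] eq that by simp
  have gi: "Cmp C g (\<iota>' i) = \<iota> i" if "i \<in> I" for i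
    using Cmp_assoc[OF coproduct_inj[OF P that] f g(1)] eq that g 
      Cmp_Idn_left[OF coproduct_inj[OF P that]] by simp
  show ?thesis
  proof (rule is_coproductI)
    show "P' \<in> Obj C" using Hom_objs[OF f] by simp
  next
    fix Q q assume "Q \<in> Obj C" "\<And>i. i \<in> I \<Longrightarrow> q i \<in> Hom C (X i) Q"
    then obtain h where h: "h \<in> Hom C P Q" "\<And>i. i \<in> I \<Longrightarrow> Cmp C h (\<iota> i) = q i"
      using coproduct_factor[OF P] by metis
    have "Cmp C (Cmp C h g) (\<iota>' i) = q i" if "i \<in> I" for i
      using Cmp_assoc[OF i[OF that] g(1) h(1)] gi h that by simp
    then show "\<exists>h. h \<in> Hom C P' Q \<and> (\<forall>i \<in> I. Cmp C h (\<iota>' i) = q i)"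
      using Cmp_Hom[OF g(1) h(1)] by blast
  next
    fix Q h k assume h: "h \<in> Hom C P' Q" and k: "k \<in> Hom C P' Q" 
      and hk: "\<And>i. i \<in> I \<Longrightarrow> Cmp C h (\<iota>' i) = Cmp C k (\<iota>' i)"
    have "Cmp C h f = Cmp C k f"
      by (rule coproduct_eqI[OF P Cmp_Hom[OF f h] Cmp_Hom[OF f k]])
        (use eq hk Cmp_assoc[OF coproduct_inj[OF P] f h] Cmp_assoc[OF coproduct_inj[OF P] f k] in simp)
    then have "Cmp C (Cmp C h f) g = Cmp C (Cmp C k f) g" by simp
    then show "h = k"
      using Cmp_assoc[OF g(1) f h] Cmp_assoc[OF g(1) f k] g(3) 
        Cmp_Idn_right[OF h] Cmp_Idn_right[OF k] by simp
  qed (use i in auto)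
qed

end

text \<open>Transport from the index sets \<open>{..<n}\<close> along an enumeration of \<open>I\<close>.\<close>

lemma finite_coproduct_exists:
  fixes I :: "'i set"
  assumes C: "has_finite_coproducts C" and I: "finite I" and X: "\<And>i. i \<in> I \<Longrightarrow> X i \<in> Obj C"
  shows "\<exists>P \<iota>. is_coproduct C I X P \<iota>"
proof -
  obtain e :: "nat \<Rightarrow> 'i" where e: "bij_betw e {..<card I} I" 
    using ex_bij_betw_nat_finite[OF I] by (auto simp: lessThan_atLeast0)
  define d where "d = inv_into {..<card I} e"
  have d: "d i < card I" "e (d i) = i" if "i \<in> I" for i
    using that e bij_betw_inv_into_right[OF e] bij_betwE[OF bij_betw_inv_into[OF e]] 
    by (auto simp: d_def)
  have de: "d (e n) = n" "e n \<in> I" if "n < card I" for n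
    using that bij_betw_inv_into_left[OF e] bij_betwE[OF e] by (auto simp: d_def)
  obtain P \<iota> where P: "is_coproduct C {..<card I} (\<lambda>n. X (e n)) P \<iota>"
    using C X de unfolding has_finite_coproducts_def by metis
  have eq: "(\<forall>i\<in>I. Cmp C h (\<iota> (d i)) = q i) \<longleftrightarrow> (\<forall>n\<in>{..<card I}. Cmp C h (\<iota> n) = q (e n))" for h q
    using d de by (metis lessThan_iff)
  have "is_coproduct C I X P (\<lambda>i. \<iota> (d i))"
    unfolding is_coproduct_def
  proof (intro conjI ballI allI impI)
    fix i assume "i \<in> I" then show "\<iota> (d i) \<in> Hom C (X i) P"
      using coproduct_inj[OF P, of "d i"] d by auto
  next
    fix Q q assume "Q \<in> Obj C" "\<forall>i\<in>I. q i \<in> Hom C (X i) Q"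
    then show "\<exists>!h. h \<in> Hom C P Q \<and> (\<forall>i\<in>I. Cmp C h (\<iota> (d i)) = q i)"
      unfolding eq using de by (intro coproduct_factor[OF P]) auto
  qed (rule coproduct_Obj[OF P])
  then show ?thesis by blast
qed

lemma coprod_is_coproduct:
  assumes "has_finite_coproducts C" "finite I" "\<And>i. i \<in> I \<Longrightarrow> X i \<in> Obj C"
  shows "is_coproduct C I X (coprod C I X) (coprod_inj C I X)"
  unfolding coprod_def coprod_inj_def coprod_cocone_def
  using someI_ex[of "\<lambda>p. is_coproduct C I X (fst p) (snd p)"] finite_coproduct_exists[OF assms] 
  by fastforce

lemma cotuple:
  assumes "has_finite_coproducts C" "finite I" "\<And>i. i \<in> I \<Longrightarrow> X i \<in> Obj C"
    and "Q \<in> Obj C" "\<And>i. i \<in> I \<Longrightarrow> q i \<in> Hom C (X i) Q"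
  shows "cotuple C I X Q q \<in> Hom C (coprod C I X) Q"
    and "i \<in> I \<Longrightarrow> Cmp C (cotuple C I X Q q) (coprod_inj C I X i) = q i"
  using theI'[OF coproduct_factor[OF coprod_is_coproduct[OF assms(1-3)] assms(4,5)]]
  unfolding cotuple_def by auto

lemma coprod2_is_coproduct:
  assumes "has_finite_coproducts C" "a \<in> Obj C" "b \<in> Obj C"
  shows "is_coproduct C UNIV (case_bool a b) (coprod2 C a b) (case_bool (inj_left C a b) (inj_right C a b))"
  by (rule is_coproduct_cong[OF coprod_is_coproduct[OF assms(1), of UNIV "case_bool a b", folded coprod2_def]])
    (use assms in \<open>auto simp: inj_left_def inj_right_def split: bool.splits\<close>)

lemma inj_left_Hom: "has_finite_coproducts C \<Longrightarrow> a \<in> Obj C \<Longrightarrow> b \<in> Obj C \<Longrightarrow> 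
    inj_left C a b \<in> Hom C a (coprod2 C a b)"
  and inj_right_Hom: "has_finite_coproducts C \<Longrightarrow> a \<in> Obj C \<Longrightarrow> b \<in> Obj C \<Longrightarrow> 
    inj_right C a b \<in> Hom C b (coprod2 C a b)"
  using coproduct_inj[OF coprod2_is_coproduct, of C a b True] 
    coproduct_inj[OF coprod2_is_coproduct, of C a b False] by auto

lemma copair:
  assumes "has_finite_coproducts C" "a \<in> Obj C" "b \<in> Obj C" "q \<in> Obj C" 
    "f \<in> Hom C a q" "g \<in> Hom C b q"
  shows "copair C a b q f g \<in> Hom C (coprod2 C a b) q"
    and "Cmp C (copair C a b q f g) (inj_left C a b) = f"
    and "Cmp C (copair C a b q f g) (inj_right C a b) = g"
  using cotuple(1)[OF assms(1), of UNIV "case_bool a b" q "case_bool f g"] 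
    cotuple(2)[OF assms(1), of UNIV "case_bool a b" q "case_bool f g" True] 
    cotuple(2)[OF assms(1), of UNIV "case_bool a b" q "case_bool f g" False] assms
  by (auto simp: copair_def coprod2_def inj_left_def inj_right_def split: bool.splits)

lemma (in category) coprod2_eqI:
  assumes "has_finite_coproducts C" "a \<in> Obj C" "b \<in> Obj C" 
    "h \<in> Hom C (coprod2 C a b) q" "k \<in> Hom C (coprod2 C a b) q"
    "Cmp C h (inj_left C a b) = Cmp C k (inj_left C a b)"
    "Cmp C h (inj_right C a b) = Cmp C k (inj_right C a b)"
  shows "h = k"
  by (rule coproduct_eqI[OF coprod2_is_coproduct[OF assms(1-3)] assms(4,5)])
    (use assms(6,7) in \<open>auto split: bool.splits\<close>)

lemma (in category) coprod2_arr:
  assumes C: "has_finite_coproducts C" and f: "f \<in> Hom C a a'" and g: "g \<in> Hom C b b'"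
  shows "coprod2_arr C f g \<in> Hom C (coprod2 C a b) (coprod2 C a' b')"
    and "Cmp C (coprod2_arr C f g) (inj_left C a b) = Cmp C (inj_left C a' b') f"
    and "Cmp C (coprod2_arr C f g) (inj_right C a b) = Cmp C (inj_right C a' b') g"
proof -
  note o = Hom_objs[OF f] Hom_objs[OF g]
  note l = inj_left_Hom[OF C o(2,4)] and r = inj_right_Hom[OF C o(2,4)]
  note * = copair[OF C o(1,3) Hom_objs(2)[OF l] Cmp_Hom[OF f l] Cmp_Hom[OF g r]]
  have [simp]: "Dom C f = a" "Cod C f = a'" "Dom C g = b" "Cod C g = b'" 
    using f g by (auto simp: Hom_def)
  show "coprod2_arr C f g \<in> Hom C (coprod2 C a b) (coprod2 C a' b')"
    "Cmp C (coprod2_arr C f g) (inj_left C a b) = Cmp C (inj_left C a' b') f"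
    "Cmp C (coprod2_arr C f g) (inj_right C a b) = Cmp C (inj_right C a' b') g"
    using * by (simp_all add: coprod2_arr_def)
qed

lemma levelwise_coproduct:
  assumes J: "category J" and B: "category B" and P: "is_functor J B P" 
    and \<eta>: "\<And>i. i \<in> I \<Longrightarrow> \<eta> i \<in> Hom (functor_category J B) (X i) P"
    and lev: "\<And>j. j \<in> Obj J \<Longrightarrow> is_coproduct B I (\<lambda>i. Fo (X i) j) (Fo P j) (\<lambda>i. cmpnt (\<eta> i) j)"
  shows "is_coproduct (functor_category J B) I X P \<eta>"
proof -
  let ?M = "functor_category J B"
  interpret J: category J by fact
  interpret B: category B by fact
  interpret M: category ?M by (rule category_functor_category[OF J B])
  show ?thesis
  proof (rule is_coproductI)
    fix Q q assume "Q \<in> Obj ?M" and q: "\<And>i. i \<in> I \<Longrightarrow> q i \<in> Hom ?M (X i) Q"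
    then have Q: "is_functor J B Q" by simp
    have "\<exists>h. h \<in> Hom B (Fo P j) (Fo Q j) \<and> (\<forall>i\<in>I. Cmp B h (cmpnt (\<eta> i) j) = cmpnt (q i) j)" 
      if "j \<in> Obj J" for j
      using coproduct_factor[OF lev[OF that] functor_Obj[OF Q that], of "\<lambda>i. cmpnt (q i) j"] 
        nt_cmpnt[OF q that] by blast
    then obtain t where t: "\<And>j. j \<in> Obj J \<Longrightarrow> t j \<in> Hom B (Fo P j) (Fo Q j)" 
      and ti: "\<And>j i. j \<in> Obj J \<Longrightarrow> i \<in> I \<Longrightarrow> Cmp B (t j) (cmpnt (\<eta> i) j) = cmpnt (q i) j"
      by metis
    define h where "h = Nt P Q (restrict t (Obj J))"
    have h: "h \<in> Hom ?M P Q" unfolding h_def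
    proof (rule nt_HomI[OF P Q])
      fix u a b assume u: "u \<in> Hom J a b"
      note ab = J.Hom_objs[OF u]
      \<comment> \<open>Naturality may be tested on the coproduct injections at \<open>a\<close>.\<close>
      have "Cmp B (t b) (Fm P u) = Cmp B (Fm Q u) (t a)"
      proof (rule B.coproduct_eqI[OF lev[OF ab(1)]])
        show "Cmp B (t b) (Fm P u) \<in> Hom B (Fo P a) (Fo Q b)" 
          "Cmp B (Fm Q u) (t a) \<in> Hom B (Fo P a) (Fo Q b)"
          using B.Cmp_Hom[OF functor_Hom[OF P u] t[OF ab(2)]] 
            B.Cmp_Hom[OF t[OF ab(1)] functor_Hom[OF Q u]] by auto
        fix i assume i: "i \<in> I"
        note X = nt_functors(1)[OF \<eta>[OF i]]
        have "Cmp B (Cmp B (t b) (Fm P u)) (cmpnt (\<eta> i) a) 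
            = Cmp B (Cmp B (t b) (cmpnt (\<eta> i) b)) (Fm (X i) u)"
          using B.Cmp_assoc[OF nt_cmpnt[OF \<eta>[OF i] ab(1)] functor_Hom[OF P u] t[OF ab(2)]]
            B.Cmp_assoc[OF functor_Hom[OF X u] nt_cmpnt[OF \<eta>[OF i] ab(2)] t[OF ab(2)]]
            nt_natural[OF \<eta>[OF i] u] by simp
        also have "\<dots> = Cmp B (Fm Q u) (cmpnt (q i) a)"
          using ti[OF ab(2) i] nt_natural[OF q[OF i] u] by simp
        also have "\<dots> = Cmp B (Cmp B (Fm Q u) (t a)) (cmpnt (\<eta> i) a)"
          using ti[OF ab(1) i] B.Cmp_assoc[OF nt_cmpnt[OF \<eta>[OF i] ab(1)] t[OF ab(1)] functor_Hom[OF Q u]]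
          by simp
        finally show "Cmp B (Cmp B (t b) (Fm P u)) (cmpnt (\<eta> i) a) = 
          Cmp B (Cmp B (Fm Q u) (t a)) (cmpnt (\<eta> i) a)" .
      qed
      then show "Cmp B (restrict t (Obj J) b) (Fm P u) = Cmp B (Fm Q u) (restrict t (Obj J) a)"
        using ab by simp
    qed (use t in auto)
    have "Cmp ?M h (\<eta> i) = q i" if "i \<in> I" for i
      by (rule nt_eqI[OF M.Cmp_Hom[OF \<eta>[OF that] h] q[OF that]]) (simp add: h_def ti that)
    then show "\<exists>h. h \<in> Hom ?M P Q \<and> (\<forall>i\<in>I. Cmp ?M h (\<eta> i) = q i)" using h by blast
  next
    fix Q h k assume h: "h \<in> Hom ?M P Q" and k: "k \<in> Hom ?M P Q"
      and hk: "\<And>i. i \<in> I \<Longrightarrow> Cmp ?M h (\<eta> i) = Cmp ?M k (\<eta> i)"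
    show "h = k"
    proof (rule nt_eqI[OF h k])
      fix j assume j: "j \<in> Obj J"
      show "cmpnt h j = cmpnt k j"
      proof (rule B.coproduct_eqI[OF lev[OF j] nt_cmpnt[OF h j] nt_cmpnt[OF k j]])
        fix i assume "i \<in> I"
        then have "cmpnt (Cmp ?M h (\<eta> i)) j = cmpnt (Cmp ?M k (\<eta> i)) j" using hk by simp
        then show "Cmp B (cmpnt h j) (cmpnt (\<eta> i) j) = Cmp B (cmpnt k j) (cmpnt (\<eta> i) j)" using j by simp
      qed
    qed
  qed (use P \<eta> in auto)
qed

text \<open>The pointwise construction of coproducts in a functor category.\<close>

lemma levelwise_coproduct_exists:
  assumes J: "category J" and B: "category B" and cop: "has_finite_coproducts B" and I: "finite I" 
    and X: "\<And>i. i \<in> I \<Longrightarrow> is_functor J B (X i)"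
  obtains P \<eta> where "is_coproduct (functor_category J B) I X P \<eta>"
    and "\<And>j. j \<in> Obj J \<Longrightarrow> is_coproduct B I (\<lambda>i. Fo (X i) j) (Fo P j) (\<lambda>i. cmpnt (\<eta> i) j)"
proof -
  interpret J: category J by fact
  interpret B: category B by fact
  define p where "p j = coprod B I (\<lambda>i. Fo (X i) j)" for j
  define e where "e j = coprod_inj B I (\<lambda>i. Fo (X i) j)" for j
  have pe: "is_coproduct B I (\<lambda>i. Fo (X i) j) (p j) (e j)" if "j \<in> Obj J" for j
    unfolding p_def e_def by (rule coprod_is_coproduct[OF cop I functor_Obj[OF X that]])
  define m where "m u = cotuple B I (\<lambda>i. Fo (X i) (Dom J u)) (p (Cod J u)) 
    (\<lambda>i. Cmp B (e (Cod J u) i) (Fm (X i) u))" for u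
  have m: "m u \<in> Hom B (p a) (p b)"
    and me: "i \<in> I \<Longrightarrow> Cmp B (m u) (e a i) = Cmp B (e b i) (Fm (X i) u)"
    if u: "u \<in> Hom J a b" for u a b i
  proof -
    note ab = J.Hom_objs[OF u]
    have [simp]: "Dom J u = a" "Cod J u = b" using u by (auto simp: Hom_def)
    note * = cotuple[OF cop I, of "\<lambda>i. Fo (X i) a" "p b" "\<lambda>i. Cmp B (e b i) (Fm (X i) u)"] 
    have q: "Cmp B (e b i) (Fm (X i) u) \<in> Hom B (Fo (X i) a) (p b)" if "i \<in> I" for i
      using B.Cmp_Hom[OF functor_Hom[OF X[OF that] u] coproduct_inj[OF pe[OF ab(2)] that]] .
    show "m u \<in> Hom B (p a) (p b)" 
      "i \<in> I \<Longrightarrow> Cmp B (m u) (e a i) = Cmp B (e b i) (Fm (X i) u)"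
      using * functor_Obj[OF X ab(1)] coproduct_Obj[OF pe[OF ab(2)]] q
      by (simp_all add: m_def p_def[of a] e_def[of a])
  qed
  define P where "P = Ftor (restrict p (Obj J)) (restrict m (Arr J))"
  have P: "is_functor J B P"
  proof (rule is_functorI)
    fix a assume a: "a \<in> Obj J" then show "Fo P a \<in> Obj B" by (simp add: P_def coproduct_Obj[OF pe])
    note ida = J.Idn_Hom[OF a]
    have "m (Idn J a) = Idn B (p a)"
      by (rule B.coproduct_eqI[OF pe[OF a] m[OF ida] B.Idn_Hom[OF coproduct_Obj[OF pe[OF a]]]])
        (simp add: me[OF ida] functor_Idn[OF X a] B.Cmp_Idn_left[OF coproduct_inj[OF pe[OF a]]]
          B.Cmp_Idn_right[OF coproduct_inj[OF pe[OF a]]])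
    then show "Fm P (Idn J a) = Idn B (Fo P a)" using a Hom_Arr[OF ida] by (simp add: P_def)
  next
    fix u a b assume u: "u \<in> Hom J a b"
    then show "Fm P u \<in> Hom B (Fo P a) (Fo P b)" 
      using m[OF u] J.Hom_objs[OF u] Hom_Arr[OF u] by (simp add: P_def)
    fix v c assume v: "v \<in> Hom J b c"
    note vu = J.Cmp_Hom[OF u v]
    have "m (Cmp J v u) = Cmp B (m v) (m u)"
    proof (rule B.coproduct_eqI[OF pe m[OF vu] B.Cmp_Hom[OF m[OF u] m[OF v]]])
      show "a \<in> Obj J" using J.Hom_objs[OF u] by simp
      fix i assume i: "i \<in> I"
      note ea = coproduct_inj[OF pe[OF \<open>a \<in> Obj J\<close>] i] and eb = coproduct_inj[OF pe[OF J.Hom_objs(2)[OF u]] i]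
        and ec = coproduct_inj[OF pe[OF J.Hom_objs(2)[OF v]] i]
      note Xu = functor_Hom[OF X[OF i] u] and Xv = functor_Hom[OF X[OF i] v]
      show "Cmp B (m (Cmp J v u)) (e a i) = Cmp B (Cmp B (m v) (m u)) (e a i)"
        using B.Cmp_assoc[OF ea m[OF u] m[OF v]] me[OF u i] me[OF v i] me[OF vu i] 
          B.Cmp_assoc[OF Xu eb m[OF v]] B.Cmp_assoc[OF Xu Xv ec] functor_Cmp[OF X[OF i] u v] by simp
    qed
    then show "Fm P (Cmp J v u) = Cmp B (Fm P v) (Fm P u)"
      using Hom_Arr[OF u] Hom_Arr[OF v] Hom_Arr[OF vu] by (simp add: P_def)
  qed (simp_all add: P_def)
  define \<eta> where "\<eta> = (\<lambda>i. Nt (X i) P (\<lambda>j\<in>Obj J. e j i))"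
  have \<eta>: "\<eta> i \<in> Hom (functor_category J B) (X i) P" if i: "i \<in> I" for i
    unfolding \<eta>_def
  proof (rule nt_HomI[OF X[OF i] P])
    fix u a b assume u: "u \<in> Hom J a b"
    show "Cmp B ((\<lambda>j\<in>Obj J. e j i) b) (Fm (X i) u) = Cmp B (Fm P u) ((\<lambda>j\<in>Obj J. e j i) a)"
      using me[OF u i] J.Hom_objs[OF u] Hom_Arr[OF u] by (simp add: P_def)
  qed (use coproduct_inj[OF pe i] in \<open>auto simp: P_def\<close>)
  have lev: "is_coproduct B I (\<lambda>i. Fo (X i) j) (Fo P j) (\<lambda>i. cmpnt (\<eta> i) j)" if "j \<in> Obj J" for j
    using pe[OF that] that by (simp add: P_def \<eta>_def)
  show thesis by (rule that[OF levelwise_coproduct[OF J B P \<eta> lev] lev])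
qed

text \<open>Evaluation preserves finite coproducts if the target category has them: any coproduct in the
  functor category is isomorphic to the one constructed pointwise.\<close>

lemma coproduct_levelwise:
  assumes J: "category J" and B: "category B" and cop: "has_finite_coproducts B" and I: "finite I" 
    and P: "is_coproduct (functor_category J B) I X P \<eta>" and j: "j \<in> Obj J"
  shows "is_coproduct B I (\<lambda>i. Fo (X i) j) (Fo P j) (\<lambda>i. cmpnt (\<eta> i) j)"
proof -
  let ?M = "functor_category J B"
  interpret B: category B by fact
  interpret M: category ?M by (rule category_functor_category[OF J B])
  have X: "is_functor J B (X i)" if "i \<in> I" for i 
    using nt_functors(1)[OF coproduct_inj[OF P that]] .
  obtain P' \<eta>' where P': "is_coproduct ?M I X P' \<eta>'"
    and lev: "\<And>j. j \<in> Obj J \<Longrightarrow> is_coproduct B I (\<lambda>i. Fo (X i) j) (Fo P' j) (\<lambda>i. cmpnt (\<eta>' i) j)"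
    using levelwise_coproduct_exists[OF J B cop I, of X] X by blast
  obtain h where h: "h \<in> Hom ?M P' P" "\<And>i. i \<in> I \<Longrightarrow> Cmp ?M h (\<eta>' i) = \<eta> i"
    using coproduct_factor[OF P' coproduct_Obj[OF P] coproduct_inj[OF P]] by metis
  have "is_iso ?M h" by (rule M.coproduct_comparison_iso[OF P' P h])
  from M.functor_iso[OF is_functor_eval[OF J B j] h(1) this]
  have iso: "is_iso B (cmpnt h j)" using Hom_Arr[OF h(1)] by (simp add: eval_ftor_def)
  show ?thesis
    by (rule B.coproduct_transport[OF lev[OF j] nt_cmpnt[OF h(1) j] iso])
      (use h(2) cmpnt_Cmp[OF j] in metis)
qed

lemma has_finite_coproducts_functor_category:
  assumes "category J" "category B" "has_finite_coproducts B"
  shows "has_finite_coproducts (functor_category J B)"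
  unfolding has_finite_coproducts_def
  using levelwise_coproduct_exists[OF assms] by (metis Obj_functor_category finite_lessThan lessThan_iff)

section \<open>Bisimplicial objects, transposition and the diagonal\<close>

lemma is_functor_const:
  assumes J: "category J" and B: "category B"
  shows "is_functor B (functor_category J B) (const_ftor J B)"
proof -
  interpret J: category J by fact
  interpret B: category B by fact
  let ?M = "functor_category J B"
  interpret M: category ?M by (rule category_functor_category[OF J B])
  have o: "Fo (const_ftor J B) b \<in> Obj ?M" if "b \<in> Obj B" for b
    using that by (auto intro!: is_functorI 
      simp: const_ftor_def Let_def B.Idn_Hom Hom_Arr J.Hom_objs B.Cmp_Idn_left[OF B.Idn_Hom]
        J.Idn_Hom[THEN Hom_Arr] J.Cmp_Hom[THEN Hom_Arr])
  have H: "Fm (const_ftor J B) f \<in> Hom ?M (Fo (const_ftor J B) a) (Fo (const_ftor J B) b)"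
    if f: "f \<in> Hom B a b" for f a b
  proof -
    note ab = B.Hom_objs[OF f]
    have "Nt (Fo (const_ftor J B) a) (Fo (const_ftor J B) b) (\<lambda>j\<in>Obj J. f) 
        \<in> Hom ?M (Fo (const_ftor J B) a) (Fo (const_ftor J B) b)"
      by (rule nt_HomI) (use o ab f in \<open>auto simp: const_ftor_def Let_def Hom_Arr J.Hom_objs 
        B.Cmp_Idn_left[OF f] B.Cmp_Idn_right[OF f]\<close>)
    moreover have "Fm (const_ftor J B) f = Nt (Fo (const_ftor J B) a) (Fo (const_ftor J B) b) (\<lambda>j\<in>Obj J. f)"
      using ab Hom_Arr[OF f] Hom_Dom[OF f] Hom_Cod[OF f] by (simp add: const_ftor_def Let_def)
    ultimately show ?thesis by simp
  qed
  show ?thesis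
  proof (rule is_functorI)
    fix a assume a: "a \<in> Obj B"
    note i = B.Idn_Hom[OF a]
    show "Fm (const_ftor J B) (Idn B a) = Idn ?M (Fo (const_ftor J B) a)"
      by (rule nt_eqI[OF H[OF i] M.Idn_Hom[OF o[OF a]]])
        (use a Hom_Arr[OF i] in \<open>simp add: const_ftor_def Let_def\<close>)
  next
    fix f g a b c assume f: "f \<in> Hom B a b" and g: "g \<in> Hom B b c"
    note gf = B.Cmp_Hom[OF f g]
    show "Fm (const_ftor J B) (Cmp B g f) = Cmp ?M (Fm (const_ftor J B) g) (Fm (const_ftor J B) f)"
      by (rule nt_eqI[OF H[OF gf] M.Cmp_Hom[OF H[OF f] H[OF g]]])
        (use Hom_Arr[OF f] Hom_Arr[OF g] Hom_Arr[OF gf] in \<open>simp add: const_ftor_def Let_def\<close>)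
  qed (use o H in \<open>auto simp: const_ftor_def Let_def\<close>)
qed

lemma const_simps [simp]:
  "b \<in> Obj B \<Longrightarrow> j \<in> Obj J \<Longrightarrow> Fo (Fo (const_ftor J B) b) j = b"
  "b \<in> Obj B \<Longrightarrow> u \<in> Arr J \<Longrightarrow> Fm (Fo (const_ftor J B) b) u = Idn B b"
  "f \<in> Arr B \<Longrightarrow> j \<in> Obj J \<Longrightarrow> cmpnt (Fm (const_ftor J B) f) j = f"
  by (auto simp: const_ftor_def Let_def)

lemma bi_cmpnt:
  assumes Z: "is_functor J (functor_category J B) Z" and u: "u \<in> Hom J a b" and j: "j \<in> Obj J"
  shows "cmpnt (Fm Z u) j \<in> Hom B (Fo (Fo Z a) j) (Fo (Fo Z b) j)"
  using nt_cmpnt[OF functor_Hom[OF Z u] j] .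

lemma bi_row: 
  "is_functor J (functor_category J B) Z \<Longrightarrow> j \<in> Obj J \<Longrightarrow> is_functor J B (Fo Z j)"
  using functor_Obj by fastforce

lemma bi_cmpnt_Cmp:
  assumes Z: "is_functor J (functor_category J B) Z" and u: "u \<in> Hom J a b" and v: "v \<in> Hom J b c" 
    and j: "j \<in> Obj J"
  shows "cmpnt (Fm Z (Cmp J v u)) j = Cmp B (cmpnt (Fm Z v) j) (cmpnt (Fm Z u) j)"
  using functor_Cmp[OF Z u v] j by simp

lemma diag_simps [simp]:
  "is_functor J (functor_category J B) Z \<Longrightarrow> j \<in> Obj J \<Longrightarrow> Fo (Fo (diag_ftor J B) Z) j = Fo (Fo Z j) j"
  "is_functor J (functor_category J B) Z \<Longrightarrow> u \<in> Arr J \<Longrightarrow> Fm (Fo (diag_ftor J B) Z) u = 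
     Cmp B (cmpnt (Fm Z u) (Cod J u)) (Fm (Fo Z (Dom J u)) u)"
  "F \<in> Arr (functor_category J (functor_category J B)) \<Longrightarrow> j \<in> Obj J \<Longrightarrow>
     cmpnt (Fm (diag_ftor J B) F) j = cmpnt (cmpnt F j) j"
  by (auto simp: diag_ftor_def Let_def)

text \<open>In the functor law for the diagonal, the two middle arrows of a fourfold composite are
  interchanged by naturality of the structure maps of \<open>Z\<close>.\<close>

lemma is_functor_diag:
  assumes J: "category J" and B: "category B"
  shows "is_functor (functor_category J (functor_category J B)) (functor_category J B) (diag_ftor J B)"
proof -
  interpret J: category J by fact
  interpret B: category B by fact
  let ?M = "functor_category J B" and ?D = "diag_ftor J B"
  let ?MM = "functor_category J ?M"
  interpret M: category ?M by (rule category_functor_category[OF J B])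
  interpret MM: category ?MM by (rule category_functor_category[OF J M.category_axioms])
  have m: "Fm (Fo ?D Z) u = Cmp B (cmpnt (Fm Z u) b) (Fm (Fo Z a) u)"
    if Z: "is_functor J ?M Z" and u: "u \<in> Hom J a b" for Z u a b
    using Z Hom_Arr[OF u] Hom_Dom[OF u] Hom_Cod[OF u] by simp
  have o: "is_functor J B (Fo ?D Z)" if Z: "is_functor J ?M Z" for Z
  proof (rule is_functorI)
    fix a assume a: "a \<in> Obj J"
    note r = bi_row[OF Z a]
    show "Fo (Fo ?D Z) a \<in> Obj B" using functor_Obj[OF r a] Z a by simp
    show "Fm (Fo ?D Z) (Idn J a) = Idn B (Fo (Fo ?D Z) a)"
      unfolding m[OF Z J.Idn_Hom[OF a]] 
      using Z r a functor_Idn[OF Z a] functor_Idn[OF r a] B.Cmp_Idn_left[OF B.Idn_Hom[OF functor_Obj[OF r a]]]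
      by simp
  next
    fix u a b assume u: "u \<in> Hom J a b"
    note ab = J.Hom_objs[OF u]
    note ra = bi_row[OF Z ab(1)] and rb = bi_row[OF Z ab(2)]
    show "Fm (Fo ?D Z) u \<in> Hom B (Fo (Fo ?D Z) a) (Fo (Fo ?D Z) b)"
      unfolding m[OF Z u] 
      using B.Cmp_Hom[OF functor_Hom[OF ra u] bi_cmpnt[OF Z u ab(2)]] Z ab by simp
    fix v c assume v: "v \<in> Hom J b c"
    note c = J.Hom_objs(2)[OF v]
    note h1 = functor_Hom[OF ra u] and h2 = functor_Hom[OF ra v]
      and k1 = bi_cmpnt[OF Z u ab(2)] and k2 = bi_cmpnt[OF Z u c] and k3 = bi_cmpnt[OF Z v c]
      and l = functor_Hom[OF rb v]
    have "Cmp B (Cmp B (cmpnt (Fm Z v) c) (cmpnt (Fm Z u) c)) (Cmp B (Fm (Fo Z a) v) (Fm (Fo Z a) u))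
        = Cmp B (cmpnt (Fm Z v) c) (Cmp B (Cmp B (cmpnt (Fm Z u) c) (Fm (Fo Z a) v)) (Fm (Fo Z a) u))"
      using B.Cmp_assoc[OF B.Cmp_Hom[OF h1 h2] k2 k3] B.Cmp_assoc[OF h1 h2 k2] by simp
    also have "\<dots> = Cmp B (cmpnt (Fm Z v) c) (Cmp B (Cmp B (Fm (Fo Z b) v) (cmpnt (Fm Z u) b)) (Fm (Fo Z a) u))"
      using nt_natural[OF functor_Hom[OF Z u] v] by simp
    also have "\<dots> = Cmp B (Cmp B (cmpnt (Fm Z v) c) (Fm (Fo Z b) v)) (Cmp B (cmpnt (Fm Z u) b) (Fm (Fo Z a) u))"
      using B.Cmp_assoc[OF h1 k1 l] B.Cmp_assoc[OF B.Cmp_Hom[OF h1 k1] l k3] by simp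
    finally show "Fm (Fo ?D Z) (Cmp J v u) = Cmp B (Fm (Fo ?D Z) v) (Fm (Fo ?D Z) u)"
      unfolding m[OF Z u] m[OF Z v] m[OF Z J.Cmp_Hom[OF u v]] 
      by (simp add: bi_cmpnt_Cmp[OF Z u v c] functor_Cmp[OF ra u v])
  qed (use Z in \<open>simp_all add: diag_ftor_def Let_def\<close>)
  have H: "Fm ?D F \<in> Hom ?M (Fo ?D Z) (Fo ?D Z')" if F: "F \<in> Hom ?MM Z Z'" for F Z Z'
  proof -
    note Z = nt_functors(1)[OF F] and Z' = nt_functors(2)[OF F]
    have eq: "Fm ?D F = Nt (Fo ?D Z) (Fo ?D Z') (\<lambda>j \<in> Obj J. cmpnt (cmpnt F j) j)"
      using F Z Z' Hom_Arr[OF F] by (simp add: diag_ftor_def Let_def functor_Hom_eq)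
    show ?thesis unfolding eq
    proof (rule nt_HomI[OF o[OF Z] o[OF Z']])
      fix j assume j: "j \<in> Obj J"
      show "(\<lambda>j \<in> Obj J. cmpnt (cmpnt F j) j) j \<in> Hom B (Fo (Fo ?D Z) j) (Fo (Fo ?D Z') j)"
        using nt_cmpnt[OF nt_cmpnt[OF F j] j] j Z Z' by simp
    next
      fix u a b assume u: "u \<in> Hom J a b"
      note ab = J.Hom_objs[OF u]
      note x = functor_Hom[OF bi_row[OF Z ab(1)] u] functor_Hom[OF bi_row[OF Z' ab(1)] u]
        bi_cmpnt[OF Z u ab(2)] bi_cmpnt[OF Z' u ab(2)] nt_cmpnt[OF nt_cmpnt[OF F ab(1)] ab(1)] 
        nt_cmpnt[OF nt_cmpnt[OF F ab(1)] ab(2)] nt_cmpnt[OF nt_cmpnt[OF F ab(2)] ab(2)]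
      have n1: "Cmp B (cmpnt (cmpnt F b) b) (cmpnt (Fm Z u) b) = Cmp B (cmpnt (Fm Z' u) b) (cmpnt (cmpnt F a) b)"
        using arg_cong[OF nt_natural[OF F u], of "\<lambda>t. cmpnt t b"] ab by simp
      have n2: "Cmp B (cmpnt (cmpnt F a) b) (Fm (Fo Z a) u) = Cmp B (Fm (Fo Z' a) u) (cmpnt (cmpnt F a) a)"
        using nt_natural[OF nt_cmpnt[OF F ab(1)] u] .
      have "Cmp B (cmpnt (cmpnt F b) b) (Cmp B (cmpnt (Fm Z u) b) (Fm (Fo Z a) u)) 
          = Cmp B (Cmp B (cmpnt (Fm Z' u) b) (Fm (Fo Z' a) u)) (cmpnt (cmpnt F a) a)"
        using B.Cmp_assoc[OF x(1) x(3) x(7)] B.Cmp_assoc[OF x(1) x(6) x(4)] 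
          B.Cmp_assoc[OF x(5) x(2) x(4)] n1 n2 by simp
      then show "Cmp B ((\<lambda>j \<in> Obj J. cmpnt (cmpnt F j) j) b) (Fm (Fo ?D Z) u) 
          = Cmp B (Fm (Fo ?D Z') u) ((\<lambda>j \<in> Obj J. cmpnt (cmpnt F j) j) a)"
        unfolding m[OF Z u] m[OF Z' u] using ab by simp
    qed simp
  qed
  show ?thesis
  proof (rule is_functorI)
    fix Z assume Z: "Z \<in> Obj ?MM"
    note i = MM.Idn_Hom[OF Z]
    show "Fo ?D Z \<in> Obj ?M" using o Z by simp
    then show "Fm ?D (Idn ?MM Z) = Idn ?M (Fo ?D Z)"
      by (intro nt_eqI[OF H[OF i] M.Idn_Hom]) (use Z Hom_Arr[OF i] in simp_all)
  next
    fix f g a b c assume f: "f \<in> Hom ?MM a b" and g: "g \<in> Hom ?MM b c"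
    note gf = MM.Cmp_Hom[OF f g]
    show "Fm ?D (Cmp ?MM g f) = Cmp ?M (Fm ?D g) (Fm ?D f)"
      by (rule nt_eqI[OF H[OF gf] M.Cmp_Hom[OF H[OF f] H[OF g]]])
        (use Hom_Arr[OF f] Hom_Arr[OF g] Hom_Arr[OF gf] in simp)
  qed (use H in \<open>auto simp: diag_ftor_def Let_def\<close>)
qed

text \<open>The object \<open>n \<mapsto> X\<close>, constant in the first direction, has diagonal \<open>X\<close>.\<close>

lemma diag_const: 
  assumes J: "category J" and B: "category B"
  shows "comp_ftor (functor_category J B) (diag_ftor J B) (const_ftor J (functor_category J B)) 
      = id_ftor (functor_category J B)"
proof -
  interpret J: category J by fact
  interpret B: category B by fact
  let ?M = "functor_category J B" and ?D = "diag_ftor J B" 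
  let ?c = "const_ftor J ?M"
  interpret M: category ?M by (rule category_functor_category[OF J B])
  note c = is_functor_const[OF J M.category_axioms]
  note F = is_functor_comp[OF M.category_axioms c is_functor_diag[OF J B]]
  have o: "Fo ?D (Fo ?c X) = X" if X: "is_functor J B X" for X
  proof (rule functor_eqI[OF _ X])
    have cX: "is_functor J ?M (Fo ?c X)" using functor_Obj[OF c] X by simp
    show "is_functor J B (Fo ?D (Fo ?c X))"
      using functor_Obj[OF is_functor_diag[OF J B]] cX by simp
    show "Fo (Fo ?D (Fo ?c X)) a = Fo X a" if "a \<in> Obj J" for a
      using that cX X by simp
    show "Fm (Fo ?D (Fo ?c X)) u = Fm X u" if "u \<in> Arr J" for u
      using that cX X J.Dom_Obj J.Cod_Obj B.Cmp_Idn_left[OF functor_Hom[OF X Arr_Hom]] by simp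
  qed
  show ?thesis
  proof (rule functor_eqI[OF F is_functor_id[OF M.category_axioms]])
    fix X assume "X \<in> Obj ?M"
    then show "Fo (comp_ftor ?M ?D ?c) X = Fo (id_ftor ?M) X" using o by (simp add: id_ftor_def)
  next
    fix f assume f: "f \<in> Arr ?M"
    then have f': "f \<in> Hom ?M (src f) (tgt f)" using Arr_Hom[OF f] by simp
    have "Fm (comp_ftor ?M ?D ?c) f = f"
      by (rule nt_eqI[OF _ f'])
        (use functor_Hom[OF F f'] nt_functors[OF f'] f functor_Arr[OF c f] in \<open>simp_all add: o\<close>)
    then show "Fm (comp_ftor ?M ?D ?c) f = Fm (id_ftor ?M) f" using f by (simp add: id_ftor_def)
  qed
qed

text \<open>The two ways of contracting a trisimplicial object to a simplicial one, through
  \<open>(n, m) \<mapsto> Z\<^bsub>n,n,m\<^esub>\<close> and through \<open>(n, m) \<mapsto> Z\<^bsub>n,m,m\<^esub>\<close>, agree on the nose.\<close>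

lemma diag_diag: 
  assumes J: "category J" and B: "category B"
  shows "comp_ftor (functor_category J (functor_category J (functor_category J B))) 
           (diag_ftor J B) (diag_ftor J (functor_category J B)) 
       = comp_ftor (functor_category J (functor_category J (functor_category J B)))
           (diag_ftor J B) (post_ftor J (functor_category J (functor_category J B)) (diag_ftor J B))"
proof -
  interpret J: category J by fact
  interpret B: category B by fact
  let ?M = "functor_category J B" and ?D = "diag_ftor J B"
  let ?MM = "functor_category J ?M" and ?D' = "diag_ftor J ?M" 
  let ?MMM = "functor_category J ?MM" and ?P = "post_ftor J ?MM ?D"
  have M: "category ?M" by (rule category_functor_category[OF J B])
  have MM: "category ?MM" by (rule category_functor_category[OF J M])
  have MMM: "category ?MMM" by (rule category_functor_category[OF J MM])
  note D = is_functor_diag[OF J B] and D' = is_functor_diag[OF J M]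
  note P = is_functor_post[OF J MM M D]
  note F = is_functor_comp[OF MMM D' D] and G = is_functor_comp[OF MMM P D]
  have o: "Fo ?D (Fo ?D' Z) = Fo ?D (Fo ?P Z)" if Z: "is_functor J ?MM Z" for Z
  proof (rule functor_eqI)
    have D'Z: "is_functor J ?M (Fo ?D' Z)" using functor_Obj[OF D'] Z by simp
    have PZ: "is_functor J ?M (Fo ?P Z)" using functor_Obj[OF P] Z by simp
    have PZ': "Fo ?P Z = comp_ftor J ?D Z" using Z by (simp add: post_ftor_def)
    show "is_functor J B (Fo ?D (Fo ?D' Z))" "is_functor J B (Fo ?D (Fo ?P Z))"
      using functor_Obj[OF F] functor_Obj[OF G] Z by simp_all
    have row: "is_functor J ?M (Fo Z j)" if "j \<in> Obj J" for j using bi_row[OF Z that] .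
    show "Fo (Fo ?D (Fo ?D' Z)) a = Fo (Fo ?D (Fo ?P Z)) a" if "a \<in> Obj J" for a
      using that D'Z PZ Z row by (simp add: PZ')
    fix u assume u: "u \<in> Arr J"
    define a b where "a = Dom J u" and "b = Cod J u"
    have u': "u \<in> Hom J a b" using Arr_Hom[OF u] by (simp add: a_def b_def)
    note ab = J.Hom_objs[OF u']
    have Zu: "Fm Z u \<in> Hom ?MM (Fo Z a) (Fo Z b)" using functor_Hom[OF Z u'] .
    note x = functor_Hom[OF bi_row[OF row[OF ab(1)] ab(1)] u'] bi_cmpnt[OF row[OF ab(1)] u' ab(2)]
      nt_cmpnt[OF nt_cmpnt[OF Zu ab(2)] ab(2)]
    have "Fm (Fo ?D (Fo ?D' Z)) u = Cmp B (Cmp B (cmpnt (cmpnt (Fm Z u) b) b) 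
        (cmpnt (Fm (Fo Z a) u) b)) (Fm (Fo (Fo Z a) a) u)"
      using u ab Z D'Z by (simp add: a_def[symmetric] b_def[symmetric])
    also have "\<dots> = Cmp B (cmpnt (cmpnt (Fm Z u) b) b) 
        (Cmp B (cmpnt (Fm (Fo Z a) u) b) (Fm (Fo (Fo Z a) a) u))"
      using B.Cmp_assoc[OF x] by simp
    also have "\<dots> = Fm (Fo ?D (Fo ?P Z)) u"
      using u ab PZ row[OF ab(1)] Hom_Arr[OF Zu] 
      by (simp add: a_def[symmetric] b_def[symmetric]) (simp add: PZ' a_def[symmetric] b_def[symmetric])
    finally show "Fm (Fo ?D (Fo ?D' Z)) u = Fm (Fo ?D (Fo ?P Z)) u" .
  qed
  show ?thesis
  proof (rule functor_eqI[OF F G])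
    fix Z assume "Z \<in> Obj ?MMM"
    then show "Fo (comp_ftor ?MMM ?D ?D') Z = Fo (comp_ftor ?MMM ?D ?P) Z" using o by simp
  next
    fix f assume f: "f \<in> Arr ?MMM"
    then have f': "f \<in> Hom ?MMM (src f) (tgt f)" using Arr_Hom[OF f] by simp
    show "Fm (comp_ftor ?MMM ?D ?D') f = Fm (comp_ftor ?MMM ?D ?P) f"
    proof (rule nt_eqI)
      show "Fm (comp_ftor ?MMM ?D ?D') f \<in> Hom ?M (Fo ?D (Fo ?D' (src f))) (Fo ?D (Fo ?D' (tgt f)))"
        "Fm (comp_ftor ?MMM ?D ?P) f \<in> Hom ?M (Fo ?D (Fo ?D' (src f))) (Fo ?D (Fo ?D' (tgt f)))"
        using functor_Hom[OF F f'] functor_Hom[OF G f'] nt_functors[OF f'] by (simp_all add: o)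
      fix j assume j: "j \<in> Obj J"
      have 1: "cmpnt (Fm (comp_ftor ?MMM ?D ?D') f) j = cmpnt (cmpnt (cmpnt f j) j) j"
        using j f functor_Arr[OF D' f] by simp
      have "cmpnt (Fm ?P f) j = Fm ?D (cmpnt f j)"
        using f j by (simp add: post_ftor_def whisker_left_def)
      then have 2: "cmpnt (Fm (comp_ftor ?MMM ?D ?P) f) j = cmpnt (cmpnt (cmpnt f j) j) j"
        using j f functor_Arr[OF P f] Hom_Arr[OF nt_cmpnt[OF f' j]] by simp
      show "cmpnt (Fm (comp_ftor ?MMM ?D ?D') f) j = cmpnt (Fm (comp_ftor ?MMM ?D ?P) f) j"
        using 1 2 by simp
    qed
  qed
qed

text \<open>A bisimplicial object presented by its rows \<open>R i\<close> (first index fixed) and its columns \<open>K j\<close>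
  (second index fixed).  It is well formed if rows and columns agree on objects and satisfy the
  interchange law, see \<open>is_functor_bi\<close> below.\<close>

definition bi_ftor ::
  "('j, 'k) category \<Rightarrow> ('j \<Rightarrow> ('j, 'k, 'o, 'm) ftor) \<Rightarrow> ('j \<Rightarrow> ('j, 'k, 'o, 'm) ftor) \<Rightarrow>
   ('j, 'k, ('j, 'k, 'o, 'm) ftor, ('j, 'k, 'o, 'm) ntrans) ftor" where
  "bi_ftor J R K = Ftor (\<lambda>i \<in> Obj J. R i)
     (\<lambda>u \<in> Arr J. Nt (R (Dom J u)) (R (Cod J u)) (\<lambda>j \<in> Obj J. Fm (K j) u))"

lemma bi_ftor_simps [simp]:
  "i \<in> Obj J \<Longrightarrow> Fo (bi_ftor J R K) i = R i"
  "u \<in> Arr J \<Longrightarrow> j \<in> Obj J \<Longrightarrow> cmpnt (Fm (bi_ftor J R K) u) j = Fm (K j) u"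
  by (auto simp: bi_ftor_def)

lemma is_functor_bi:
  assumes J: "category J" and B: "category B"
    and R: "\<And>i. i \<in> Obj J \<Longrightarrow> is_functor J B (R i)" and K: "\<And>j. j \<in> Obj J \<Longrightarrow> is_functor J B (K j)"
    and RK: "\<And>i j. i \<in> Obj J \<Longrightarrow> j \<in> Obj J \<Longrightarrow> Fo (R i) j = Fo (K j) i"
    and interchange: "\<And>u w a b c d. u \<in> Hom J a b \<Longrightarrow> w \<in> Hom J c d \<Longrightarrow>
      Cmp B (Fm (K d) u) (Fm (R a) w) = Cmp B (Fm (R b) w) (Fm (K c) u)"
  shows "is_functor J (functor_category J B) (bi_ftor J R K)"
proof -
  interpret J: category J by fact
  let ?M = "functor_category J B"
  interpret M: category ?M by (rule category_functor_category[OF J B])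
  have H: "Fm (bi_ftor J R K) u \<in> Hom ?M (R a) (R b)" if u: "u \<in> Hom J a b" for u a b
  proof -
    note ab = J.Hom_objs[OF u]
    have "Nt (R a) (R b) (\<lambda>j \<in> Obj J. Fm (K j) u) \<in> Hom ?M (R a) (R b)"
      by (rule nt_HomI[OF R[OF ab(1)] R[OF ab(2)]])
        (use functor_Hom[OF K u] RK ab interchange[OF u] J.Hom_objs in auto)
    then show ?thesis using Hom_Arr[OF u] Hom_Dom[OF u] Hom_Cod[OF u] by (simp add: bi_ftor_def)
  qed
  show ?thesis
  proof (rule is_functorI)
    fix a assume a: "a \<in> Obj J" 
    then show "Fo (bi_ftor J R K) a \<in> Obj ?M" using R by simp
    note i = J.Idn_Hom[OF a]
    have "Fm (bi_ftor J R K) (Idn J a) = Idn ?M (R a)"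
      by (rule nt_eqI[OF H[OF i] M.Idn_Hom]) 
        (use R a Hom_Arr[OF i] functor_Idn[OF K a] RK in simp_all)
    then show "Fm (bi_ftor J R K) (Idn J a) = Idn ?M (Fo (bi_ftor J R K) a)" using a by simp
  next
    fix u a b assume u: "u \<in> Hom J a b"
    then show "Fm (bi_ftor J R K) u \<in> Hom ?M (Fo (bi_ftor J R K) a) (Fo (bi_ftor J R K) b)"
      using H[OF u] J.Hom_objs[OF u] by simp
    fix v c assume v: "v \<in> Hom J b c"
    note vu = J.Cmp_Hom[OF u v]
    show "Fm (bi_ftor J R K) (Cmp J v u) = Cmp ?M (Fm (bi_ftor J R K) v) (Fm (bi_ftor J R K) u)"
      by (rule nt_eqI[OF H[OF vu] M.Cmp_Hom[OF H[OF u] H[OF v]]])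
        (use Hom_Arr[OF u] Hom_Arr[OF v] Hom_Arr[OF vu] in \<open>simp add: functor_Cmp[OF K u v]\<close>)
  qed (simp_all add: bi_ftor_def)
qed

text \<open>A map of bisimplicial objects is a family of row maps that is natural along the columns.\<close>

lemma bi_HomI:
  assumes J: "category J" and B: "category B" 
    and Z: "is_functor J (functor_category J B) Z" and Z': "is_functor J (functor_category J B) Z'"
    and F: "\<And>i. i \<in> Obj J \<Longrightarrow> F i \<in> Hom (functor_category J B) (Fo Z i) (Fo Z' i)"
    and nat: "\<And>u a b j. u \<in> Hom J a b \<Longrightarrow> j \<in> Obj J \<Longrightarrow>
      Cmp B (cmpnt (F b) j) (cmpnt (Fm Z u) j) = Cmp B (cmpnt (Fm Z' u) j) (cmpnt (F a) j)"
  shows "Nt Z Z' (\<lambda>i \<in> Obj J. F i) \<in> Hom (functor_category J (functor_category J B)) Z Z'"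
proof -
  interpret J: category J by fact
  interpret M: category "functor_category J B" by (rule category_functor_category[OF J B])
  show ?thesis
  proof (rule nt_HomI[OF Z Z'])
    fix u a b assume u: "u \<in> Hom J a b"
    note ab = J.Hom_objs[OF u]
    have "Cmp (functor_category J B) (F b) (Fm Z u) = Cmp (functor_category J B) (Fm Z' u) (F a)"
      by (rule nt_eqI[OF M.Cmp_Hom[OF functor_Hom[OF Z u] F[OF ab(2)]] 
          M.Cmp_Hom[OF F[OF ab(1)] functor_Hom[OF Z' u]]]) (simp add: nat[OF u])
    then show "Cmp (functor_category J B) ((\<lambda>i \<in> Obj J. F i) b) (Fm Z u) 
        = Cmp (functor_category J B) (Fm Z' u) ((\<lambda>i \<in> Obj J. F i) a)" using ab by simp
  qed (use F in auto)
qed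

text \<open>The transpose of a bisimplicial object exchanges the two simplicial directions: its rows are the
  columns of \<open>Z\<close>, that is, \<open>Z\<close> followed by the evaluation functors.\<close>

definition transp_obj ::
  "('j, 'k) category \<Rightarrow> ('o, 'm) category \<Rightarrow> ('j, 'k, ('j, 'k, 'o, 'm) ftor, ('j, 'k, 'o, 'm) ntrans) ftor \<Rightarrow>
   ('j, 'k, ('j, 'k, 'o, 'm) ftor, ('j, 'k, 'o, 'm) ntrans) ftor" where
  "transp_obj J B Z = bi_ftor J (\<lambda>j. comp_ftor J (eval_ftor J B j) Z) (Fo Z)"

lemma column_simps [simp]:
  assumes "is_functor J (functor_category J B) Z"
  shows "i \<in> Obj J \<Longrightarrow> Fo (comp_ftor J (eval_ftor J B j) Z) i = Fo (Fo Z i) j"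
    and "u \<in> Arr J \<Longrightarrow> Fm (comp_ftor J (eval_ftor J B j) Z) u = cmpnt (Fm Z u) j"
  using functor_Obj[OF assms, of i] functor_Arr[OF assms, of u] by (auto simp: eval_ftor_def)

lemma is_functor_transp:
  assumes J: "category J" and B: "category B" and Z: "is_functor J (functor_category J B) Z"
  shows "is_functor J (functor_category J B) (transp_obj J B Z)"
  unfolding transp_obj_def
proof (rule is_functor_bi[OF J B])
  interpret J: category J by fact
  fix u w a b c d assume u: "u \<in> Hom J a b" and w: "w \<in> Hom J c d"
  show "Cmp B (Fm (Fo Z d) u) (Fm (comp_ftor J (eval_ftor J B a) Z) w) =
       Cmp B (Fm (comp_ftor J (eval_ftor J B b) Z) w) (Fm (Fo Z c) u)"
    using nt_natural[OF functor_Hom[OF Z w] u] Hom_Arr[OF w] Z by (simp del: Fo_comp Fm_comp)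
qed (use is_functor_comp[OF J Z is_functor_eval[OF J B]] Z bi_row[OF Z] in \<open>auto simp del: Fo_comp\<close>)

text \<open>The rows of the transpose of \<open>F\<close> are the columns of \<open>F\<close>, and transposition does not change the
  diagonal.\<close>

lemma transpose_map:
  assumes J: "category J" and B: "category B" 
    and F: "F \<in> Hom (functor_category J (functor_category J B)) Z Z'"
  obtains F' where "F' \<in> Arr (functor_category J (functor_category J B))"
    and "\<And>j. j \<in> Obj J \<Longrightarrow> cmpnt F' j = Fm (post_ftor J (functor_category J B) (eval_ftor J B j)) F"
    and "Fm (diag_ftor J B) F' = Fm (diag_ftor J B) F"
proof -
  interpret J: category J by fact
  let ?M = "functor_category J B"
  let ?MM = "functor_category J ?M" and ?S = "transp_obj J B"
  have M: "category ?M" by (rule category_functor_category[OF J B])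
  note Z = nt_functors(1)[OF F] and Z' = nt_functors(2)[OF F]
  define G where "G j = Fm (post_ftor J ?M (eval_ftor J B j)) F" for j
  have G: "G j \<in> Hom ?M (Fo (?S Z) j) (Fo (?S Z') j)" if "j \<in> Obj J" for j
    using functor_Hom[OF is_functor_post[OF J M B is_functor_eval[OF J B that]] F] that Z Z'
    by (simp add: transp_obj_def G_def post_ftor_def)
  have Gc: "cmpnt (G j) i = cmpnt (cmpnt F i) j" if "i \<in> Obj J" for i j
    using Hom_Arr[OF F] Hom_Arr[OF nt_cmpnt[OF F that]] that 
    by (simp add: G_def post_ftor_def whisker_left_def eval_ftor_def)
  define F' where "F' = Nt (?S Z) (?S Z') (\<lambda>j\<in>Obj J. G j)"
  have F': "F' \<in> Hom ?MM (?S Z) (?S Z')"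
    unfolding F'_def
  proof (rule bi_HomI[OF J B is_functor_transp[OF J B Z] is_functor_transp[OF J B Z'] G])
    fix u a b j assume u: "u \<in> Hom J a b" and j: "j \<in> Obj J"
    show "Cmp B (cmpnt (G b) j) (cmpnt (Fm (?S Z) u) j) = Cmp B (cmpnt (Fm (?S Z') u) j) (cmpnt (G a) j)"
      using nt_natural[OF nt_cmpnt[OF F j] u] Hom_Arr[OF u] j by (simp add: transp_obj_def Gc)
  qed
  have diag: "Fo (diag_ftor J B) (?S Z) = Fo (diag_ftor J B) Z" if Z: "is_functor J ?M Z" for Z
  proof (rule functor_eqI[of J B])
    note S = is_functor_transp[OF J B Z]
    show "is_functor J B (Fo (diag_ftor J B) (?S Z))" "is_functor J B (Fo (diag_ftor J B) Z)"
      using functor_Obj[OF is_functor_diag[OF J B]] S Z by auto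
    show "Fo (Fo (diag_ftor J B) (?S Z)) a = Fo (Fo (diag_ftor J B) Z) a" if "a \<in> Obj J" for a
      using that S Z by simp (simp add: transp_obj_def del: Fo_comp Fm_comp)
    show "Fm (Fo (diag_ftor J B) (?S Z)) u = Fm (Fo (diag_ftor J B) Z) u" if u: "u \<in> Arr J" for u
      using u S Z J.Dom_Obj J.Cod_Obj nt_natural[OF functor_Hom[OF Z Arr_Hom[OF u]] Arr_Hom[OF u]] 
      by simp (simp add: transp_obj_def del: Fo_comp Fm_comp)
  qed
  note D = is_functor_diag[OF J B]
  have "Fm (diag_ftor J B) F' = Fm (diag_ftor J B) F"
    by (rule nt_eqI[OF _ functor_Hom[OF D F]])
      (use functor_Hom[OF D F'] Z Z' Hom_Arr[OF F] Hom_Arr[OF F'] in 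
        \<open>simp_all add: diag, simp add: F'_def Gc\<close>)
  moreover have "cmpnt F' j = G j" if "j \<in> Obj J" for j using that by (simp add: F'_def)
  ultimately show thesis using that[OF Hom_Arr[OF F']] unfolding G_def by blast
qed

section \<open>Tensors with finite simplicial sets, cylinders and homotopies\<close>

(* The 1-simplices below are indexed by the numeral 1, which must not turn into Suc 0. *)
declare One_nat_def [simp del]

text \<open>Simplicial sets with finite levels: the arrows of \<open>Delta\<close> act contravariantly and functorially,
  and no condition is imposed on the action outside the levels.\<close>

definition finite_sset :: "'k sset \<Rightarrow> bool" where
  "finite_sset K \<longleftrightarrow> (\<forall>n. finite (Fo K n)) \<and>
     (\<forall>m n \<phi> k. \<phi> \<in> Hom Delta m n \<longrightarrow> k \<in> Fo K n \<longrightarrow> Fm K \<phi> k \<in> Fo K m) \<and>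
     (\<forall>n. \<forall>k \<in> Fo K n. Fm K (Idn Delta n) k = k) \<and>
     (\<forall>l m n \<phi> \<psi> k. \<psi> \<in> Hom Delta l m \<longrightarrow> \<phi> \<in> Hom Delta m n \<longrightarrow> k \<in> Fo K n \<longrightarrow>
        Fm K (Cmp Delta \<phi> \<psi>) k = Fm K \<psi> (Fm K \<phi> k))"

lemma finite_sset_finite: "finite_sset K \<Longrightarrow> finite (Fo K n)"
  and finite_sset_Hom: "finite_sset K \<Longrightarrow> \<phi> \<in> Hom Delta m n \<Longrightarrow> k \<in> Fo K n \<Longrightarrow> Fm K \<phi> k \<in> Fo K m"
  and finite_sset_Idn: "finite_sset K \<Longrightarrow> k \<in> Fo K n \<Longrightarrow> Fm K (Idn Delta n) k = k"
  and finite_sset_Cmp: "finite_sset K \<Longrightarrow> \<psi> \<in> Hom Delta l m \<Longrightarrow> \<phi> \<in> Hom Delta m n \<Longrightarrow> k \<in> Fo K n \<Longrightarrow>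
        Fm K (Cmp Delta \<phi> \<psi>) k = Fm K \<psi> (Fm K \<phi> k)"
  unfolding finite_sset_def by blast+

lemma finite_sset_simplex: "finite_sset (simplex p)"
proof -
  interpret category Delta by (rule category_Delta)
  show ?thesis
    by (auto simp: finite_sset_def simplex_def finite_Hom_Delta Cmp_Idn_right Cmp_assoc intro: Cmp_Hom)
qed

lemma finite_sset_const: "finite S \<Longrightarrow> finite_sset (Ftor (\<lambda>_. S) (\<lambda>_ k. k))"
  by (simp add: finite_sset_def)

text \<open>The inclusion of the summand \<open>X\<^sub>n\<close> indexed by \<open>k\<close> into level \<open>n\<close> of the tensor product.\<close>

abbreviation tensor_inj :: "('o, 'm) category \<Rightarrow> ('o, 'm) sobj \<Rightarrow> 'k sset \<Rightarrow> nat \<Rightarrow> 'k \<Rightarrow> 'm" where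
  "tensor_inj C X K n k \<equiv> coprod_inj C (Fo K n) (\<lambda>_. Fo X n) k"

text \<open>The constant \<open>n\<close>-simplex of the standard 1-simplex with value \<open>1 - i\<close>, for \<open>i \<le> 1\<close>.  It is the degenerate
  simplex on the vertex given by the coface omitting \<open>i\<close>, and so it indexes the summand that \<open>cyl_incl C i\<close>
  includes.\<close>

definition vertex :: "nat \<Rightarrow> nat \<Rightarrow> dmor" where
  "vertex i n = (n, 1, \<lambda>_ \<in> {0..n}. 1 - i)"

lemma vertex_eq: "Cmp Delta (coface01 i) (n, 0, \<lambda>_ \<in> {0..n}. 0) = vertex i n"
  by (auto simp: coface01_def vertex_def Cmp_Delta compose_def)

lemma vertex_Hom: "vertex i n \<in> Hom Delta n 1"
  by (auto simp: vertex_def Hom_Delta mono_on_def)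

lemma vertex_Cmp: "\<phi> \<in> Hom Delta m n \<Longrightarrow> Cmp Delta (vertex i n) \<phi> = vertex i m"
  by (auto simp: vertex_def Hom_Delta Cmp_Delta compose_def fun_eq_iff PiE_iff)

text \<open>The pointwise maximum of two \<open>n\<close>-simplices of the standard 1-simplex, a simplicial map
  \<open>\<Delta>[1] \<times> \<Delta>[1] \<rightarrow> \<Delta>[1]\<close>; the dimension \<open>n\<close> is the first entry of \<open>v\<close>.\<close>

definition simplex_max :: "dmor \<Rightarrow> dmor \<Rightarrow> dmor" where
  "simplex_max v u = (fst v, 1, \<lambda>i \<in> {0..fst v}. max (snd (snd v) i) (snd (snd u) i))"

lemma simplex_max_Hom: "v \<in> Hom Delta n 1 \<Longrightarrow> u \<in> Hom Delta n 1 \<Longrightarrow> simplex_max v u \<in> Hom Delta n 1"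
  by (auto simp: simplex_max_def Hom_Delta PiE_iff mono_on_def max.coboundedI1 max.coboundedI2)

lemma simplex_max_Cmp: 
  "v \<in> Hom Delta n 1 \<Longrightarrow> u \<in> Hom Delta n 1 \<Longrightarrow> \<phi> \<in> Hom Delta m n \<Longrightarrow>
   simplex_max (Cmp Delta v \<phi>) (Cmp Delta u \<phi>) = Cmp Delta (simplex_max v u) \<phi>"
  by (auto simp: simplex_max_def Hom_Delta Cmp_Delta compose_def fun_eq_iff PiE_iff)

lemma simplex_max_vertex0: "u \<in> Hom Delta n 1 \<Longrightarrow> simplex_max (vertex 0 n) u = vertex 0 n"
  and simplex_max_vertex1: "u \<in> Hom Delta n 1 \<Longrightarrow> simplex_max (vertex 1 n) u = u"
  by (auto simp: simplex_max_def vertex_def Hom_Delta fun_eq_iff PiE_iff extensional_def max_def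
      intro: le_antisym)

text \<open>A category with finite coproducts.  The property passes to simplicial objects, so that the results
  below also apply to \<open>Simp C\<close>.\<close>

locale coproduct_category = category +
  assumes finite_coproducts: "has_finite_coproducts C"
begin

sublocale Simp: category "Simp C"
  by (rule category_Simp[OF category_axioms])

lemma coproduct_category_Simp: "coproduct_category (Simp C)"
  by (intro coproduct_category.intro coproduct_category_axioms.intro Simp.category_axioms
      has_finite_coproducts_functor_category category_Delta_op category_axioms finite_coproducts)

context
  fixes X :: "('a, 'b) sobj" and K :: "'k sset"
  assumes X: "is_functor Delta_op C X" and K: "finite_sset K"
begin

lemma tensor_coproduct:
  "is_coproduct C (Fo K n) (\<lambda>_. Fo X n) (Fo (tensor C X K) n) (tensor_inj C X K n)"
  using coprod_is_coproduct[OF finite_coproducts, of "Fo K n" "\<lambda>_. Fo X n"] finite_sset_finite[OF K] functor_Obj[OF X, of n]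
  by (simp add: tensor_def)

lemmas tensor_inj_Hom = coproduct_inj[OF tensor_coproduct]

lemma tensor_Fm:
  assumes \<phi>: "\<phi> \<in> Hom Delta m n"
  shows "Fm (tensor C X K) \<phi> \<in> Hom C (Fo (tensor C X K) n) (Fo (tensor C X K) m)"
    and "k \<in> Fo K n \<Longrightarrow> Cmp C (Fm (tensor C X K) \<phi>) (tensor_inj C X K n k)
           = Cmp C (tensor_inj C X K m (Fm K \<phi> k)) (Fm X \<phi>)"
proof -
  have q: "Cmp C (tensor_inj C X K m (Fm K \<phi> k)) (Fm X \<phi>) \<in> Hom C (Fo X n) (Fo (tensor C X K) m)"
    if "k \<in> Fo K n" for k
    using Cmp_Hom[OF functor_Hom[OF X] tensor_inj_Hom[OF finite_sset_Hom[OF K \<phi> that]], of \<phi> n] \<phi> by simp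
  have "Fm (tensor C X K) \<phi> = cotuple C (Fo K n) (\<lambda>_. Fo X n) (Fo (tensor C X K) m) 
      (\<lambda>k. Cmp C (tensor_inj C X K m (Fm K \<phi> k)) (Fm X \<phi>))"
    using \<phi> by (simp add: tensor_def Hom_def)
  moreover note cotuple[OF finite_coproducts, of "Fo K n" "\<lambda>_. Fo X n" "Fo (tensor C X K) m" 
      "\<lambda>k. Cmp C (tensor_inj C X K m (Fm K \<phi> k)) (Fm X \<phi>)"]
  moreover have "Fo (tensor C X K) n = coprod C (Fo K n) (\<lambda>_. Fo X n)" by (simp add: tensor_def)
  ultimately show "Fm (tensor C X K) \<phi> \<in> Hom C (Fo (tensor C X K) n) (Fo (tensor C X K) m)"
    and "k \<in> Fo K n \<Longrightarrow> Cmp C (Fm (tensor C X K) \<phi>) (tensor_inj C X K n k)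
           = Cmp C (tensor_inj C X K m (Fm K \<phi> k)) (Fm X \<phi>)"
    using q finite_sset_finite[OF K] functor_Obj[OF X] coproduct_Obj[OF tensor_coproduct] by auto
qed

lemma is_functor_tensor: "is_functor Delta_op C (tensor C X K)"
proof (rule is_functorI)
  interpret D: category Delta by (rule category_Delta)
  fix n :: nat
  show "Fo (tensor C X K) n \<in> Obj C" by (rule coproduct_Obj[OF tensor_coproduct])
  have i: "Idn Delta n \<in> Hom Delta n n" by (rule D.Idn_Hom) simp
  show "Fm (tensor C X K) (Idn Delta_op n) = Idn C (Fo (tensor C X K) n)"
    unfolding opposite_simps
  proof (rule coproduct_eqI[OF tensor_coproduct tensor_Fm(1)[OF i] Idn_Hom])
    show "Cmp C (Fm (tensor C X K) (Idn Delta n)) (tensor_inj C X K n k) 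
        = Cmp C (Idn C (Fo (tensor C X K) n)) (tensor_inj C X K n k)" if k: "k \<in> Fo K n" for k
      using tensor_Fm(2)[OF i k] functor_Idn[OF X, of n] finite_sset_Idn[OF K k]
        Cmp_Idn_left[OF tensor_inj_Hom[OF k]] Cmp_Idn_right[OF tensor_inj_Hom[OF k]] 
      by simp
  qed (rule coproduct_Obj[OF tensor_coproduct])
next
  interpret D: category Delta by (rule category_Delta)
  fix \<phi> \<psi> l m n assume p: "\<phi> \<in> Hom Delta_op n m" and q: "\<psi> \<in> Hom Delta_op m l"
  then have \<phi>: "\<phi> \<in> Hom Delta m n" and \<psi>: "\<psi> \<in> Hom Delta l m" by auto
  note c = D.Cmp_Hom[OF \<psi> \<phi>]
  show "Fm (tensor C X K) (Cmp Delta_op \<psi> \<phi>) = Cmp C (Fm (tensor C X K) \<psi>) (Fm (tensor C X K) \<phi>)"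
    unfolding opposite_simps
  proof (rule coproduct_eqI[OF tensor_coproduct tensor_Fm(1)[OF c] 
        Cmp_Hom[OF tensor_Fm(1)[OF \<phi>] tensor_Fm(1)[OF \<psi>]]])
    fix k assume k: "k \<in> Fo K n"
    have k1: "Fm K \<phi> k \<in> Fo K m" by (rule finite_sset_Hom[OF K \<phi> k])
    have k2: "Fm K \<psi> (Fm K \<phi> k) \<in> Fo K l" by (rule finite_sset_Hom[OF K \<psi> k1])
    note k3 = finite_sset_Cmp[OF K \<psi> \<phi> k]
    note X1 = functor_Hom[OF X p] and X2 = functor_Hom[OF X q]
    show "Cmp C (Fm (tensor C X K) (Cmp Delta \<phi> \<psi>)) (tensor_inj C X K n k) =
      Cmp C (Cmp C (Fm (tensor C X K) \<psi>) (Fm (tensor C X K) \<phi>)) (tensor_inj C X K n k)"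
      using Cmp_assoc[OF tensor_inj_Hom[OF k] tensor_Fm(1)[OF \<phi>] tensor_Fm(1)[OF \<psi>]]
        tensor_Fm(2)[OF \<phi> k] tensor_Fm(2)[OF \<psi> k1] tensor_Fm(2)[OF c k] k3
        Cmp_assoc[OF X1 X2 tensor_inj_Hom[OF k2]] 
        Cmp_assoc[OF X1 tensor_inj_Hom[OF k1] tensor_Fm(1)[OF \<psi>]] 
        functor_Cmp[OF X p q] by simp
  qed
qed (use tensor_Fm(1) in \<open>auto simp: tensor_def extensional_def\<close>)

text \<open>A map out of a tensor product is a compatible family of maps indexed by the simplices.\<close>

lemma tensor_map_exists:
  assumes Y: "is_functor Delta_op C Y"
    and t: "\<And>n k. k \<in> Fo K n \<Longrightarrow> t n k \<in> Hom C (Fo X n) (Fo Y n)"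
    and nat: "\<And>m n \<phi> k. \<phi> \<in> Hom Delta m n \<Longrightarrow> k \<in> Fo K n \<Longrightarrow> 
      Cmp C (Fm Y \<phi>) (t n k) = Cmp C (t m (Fm K \<phi> k)) (Fm X \<phi>)"
  obtains h where "h \<in> Hom (Simp C) (tensor C X K) Y"
    and "\<And>n k. k \<in> Fo K n \<Longrightarrow> Cmp C (cmpnt h n) (tensor_inj C X K n k) = t n k"
proof -
  have "\<exists>h. h \<in> Hom C (Fo (tensor C X K) n) (Fo Y n) \<and> 
      (\<forall>k \<in> Fo K n. Cmp C h (tensor_inj C X K n k) = t n k)" for n
    using coproduct_factor[OF tensor_coproduct, of "Fo Y n" n "t n"] functor_Obj[OF Y, of n] t
    by (simp, blast)
  then obtain h where h: "\<And>n. h n \<in> Hom C (Fo (tensor C X K) n) (Fo Y n)"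
    and hk: "\<And>n k. k \<in> Fo K n \<Longrightarrow> Cmp C (h n) (tensor_inj C X K n k) = t n k" by metis
  have "Nt (tensor C X K) Y h \<in> Hom (Simp C) (tensor C X K) Y"
  proof (rule nt_HomI[OF is_functor_tensor Y])
    fix \<phi> n m assume f: "\<phi> \<in> Hom Delta_op n m"
    then have \<phi>: "\<phi> \<in> Hom Delta m n" by simp
    show "Cmp C (h m) (Fm (tensor C X K) \<phi>) = Cmp C (Fm Y \<phi>) (h n)"
    proof (rule coproduct_eqI[OF tensor_coproduct Cmp_Hom[OF tensor_Fm(1)[OF \<phi>] h] 
          Cmp_Hom[OF h functor_Hom[OF Y f]]])
      fix k assume k: "k \<in> Fo K n"
      have k1: "Fm K \<phi> k \<in> Fo K m" by (rule finite_sset_Hom[OF K \<phi> k])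
      show "Cmp C (Cmp C (h m) (Fm (tensor C X K) \<phi>)) (tensor_inj C X K n k) =
         Cmp C (Cmp C (Fm Y \<phi>) (h n)) (tensor_inj C X K n k)"
        using Cmp_assoc[OF tensor_inj_Hom[OF k] tensor_Fm(1)[OF \<phi>] h]
          Cmp_assoc[OF tensor_inj_Hom[OF k] h functor_Hom[OF Y f]]
          Cmp_assoc[OF functor_Hom[OF X f] tensor_inj_Hom[OF k1] h]
          tensor_Fm(2)[OF \<phi> k] hk[OF k] hk[OF k1] nat[OF \<phi> k] by simp
    qed
  qed (use h in \<open>auto simp: extensional_def\<close>)
  then show thesis using that hk by fastforce
qed

end

lemma is_functor_cylinder: "is_functor Delta_op C X \<Longrightarrow> is_functor Delta_op C (cylinder C X)"
  unfolding cylinder_def by (rule is_functor_tensor[OF _ finite_sset_simplex])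

lemma cyl_incl_cmpnt: "cmpnt (cyl_incl C i X) n = tensor_inj C X (simplex 1) n (vertex i n)"
  by (simp add: cyl_incl_def vertex_eq simplex_def)

lemma vertex_simplex: "vertex i n \<in> Fo (simplex 1) n"
  and vertex_face: "\<phi> \<in> Hom Delta m n \<Longrightarrow> Fm (simplex 1) \<phi> (vertex i n) = vertex i m"
  by (simp_all add: simplex_def vertex_Hom vertex_Cmp)

lemma cyl_incl_Hom:
  assumes X: "is_functor Delta_op C X"
  shows "cyl_incl C i X \<in> Hom (Simp C) X (cylinder C X)"
proof -
  note S = finite_sset_simplex[of 1]
  have "Nt X (cylinder C X) (cmpnt (cyl_incl C i X)) \<in> Hom (Simp C) X (cylinder C X)"
  proof (rule nt_HomI[OF X is_functor_cylinder[OF X]])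
    show "cmpnt (cyl_incl C i X) n \<in> Hom C (Fo X n) (Fo (cylinder C X) n)" for n
      unfolding cyl_incl_cmpnt cylinder_def by (rule tensor_inj_Hom[OF X S vertex_simplex])
    fix \<phi> n m assume "\<phi> \<in> Hom Delta_op n m"
    then have \<phi>: "\<phi> \<in> Hom Delta m n" by simp
    show "Cmp C (cmpnt (cyl_incl C i X) m) (Fm X \<phi>) = Cmp C (Fm (cylinder C X) \<phi>) (cmpnt (cyl_incl C i X) n)"
      unfolding cyl_incl_cmpnt cylinder_def using tensor_Fm(2)[OF X S \<phi> vertex_simplex] vertex_face[OF \<phi>]
      by simp
  qed (simp add: extensional_def)
  then show ?thesis by (simp add: cyl_incl_def)
qed

lemma cylinder_projection:
  assumes X: "is_functor Delta_op C X"
  obtains p where "p \<in> Hom (Simp C) (cylinder C X) X"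
    and "\<And>i. Cmp (Simp C) p (cyl_incl C i X) = Idn (Simp C) X"
    and "\<And>n u. u \<in> Hom Delta n 1 \<Longrightarrow> Cmp C (cmpnt p n) (tensor_inj C X (simplex 1) n u) = Idn C (Fo X n)"
proof -
  have Xo: "Fo X n \<in> Obj C" for n using functor_Obj[OF X, of n] by simp
  have m: "Cmp C (Fm X \<phi>) (Idn C (Fo X n)) = Cmp C (Idn C (Fo X m)) (Fm X \<phi>)" 
    if "\<phi> \<in> Hom Delta m n" for \<phi> m n
    using Cmp_Idn_left Cmp_Idn_right functor_Hom[OF X, of \<phi> n m] that by simp
  obtain p where p: "p \<in> Hom (Simp C) (cylinder C X) X" 
    and pk: "\<And>n u. u \<in> Fo (simplex 1) n \<Longrightarrow> Cmp C (cmpnt p n) (tensor_inj C X (simplex 1) n u) = Idn C (Fo X n)"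
    using tensor_map_exists[OF X finite_sset_simplex X, of 1 "\<lambda>n u. Idn C (Fo X n)"] Idn_Hom[OF Xo] m
    unfolding cylinder_def by metis
  have "Cmp (Simp C) p (cyl_incl C i X) = Idn (Simp C) X" for i
    by (rule nt_eqI[OF Simp.Cmp_Hom[OF cyl_incl_Hom[OF X] p] Simp.Idn_Hom])
      (use X pk[OF vertex_simplex] in \<open>simp_all add: cyl_incl_cmpnt\<close>)
  then show thesis using that p pk by (simp add: simplex_def)
qed

text \<open>A functor that inverts one inclusion into each cylinder identifies homotopic maps, since both 
  inclusions are sections of the same projection.\<close>

lemma functor_homotopic:
  assumes L: "category L" and T: "is_functor (Simp C) L T"
    and incl: "\<And>X. X \<in> Obj (Simp C) \<Longrightarrow> is_iso L (Fm T (cyl_incl C 0 X))"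
    and "simplicially_homotopic C f g"
  shows "Fm T f = Fm T g"
proof -
  interpret L: category L by fact
  have step: "Fm T f = Fm T g" if "simplicial_homotopy C f g H" for f g H
  proof -
    define X where "X = src f"
    have f: "f \<in> Hom (Simp C) X (tgt f)" and H: "H \<in> Hom (Simp C) (cylinder C X) (tgt f)"
      and eq: "Cmp (Simp C) H (cyl_incl C 0 X) = f" "Cmp (Simp C) H (cyl_incl C 1 X) = g"
      using that Arr_Hom by (fastforce simp: simplicial_homotopy_def X_def)+
    have X: "is_functor Delta_op C X" using nt_functors[OF f] by simp
    obtain p where p: "p \<in> Hom (Simp C) (cylinder C X) X" 
      and pd: "\<And>i. Cmp (Simp C) p (cyl_incl C i X) = Idn (Simp C) X" using cylinder_projection[OF X] by metis
    note d = cyl_incl_Hom[OF X]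
    note Tp = functor_Hom[OF T p] and Td = functor_Hom[OF T d]
    have Tpd: "Cmp L (Fm T p) (Fm T (cyl_incl C i X)) = Idn L (Fo T X)" for i
      using functor_Cmp[OF T d p] pd functor_Idn[OF T] X by simp
    \<comment> \<open>The projection inherits invertibility from its section \<open>d\<^sub>0\<close>, and then cancels from the left.\<close>
    have "is_iso L (Fm T p)"
      using L.iso_left_inverse[OF Tp Td Tpd incl] X by simp
    then have "Fm T (cyl_incl C 0 X) = Fm T (cyl_incl C 1 X)"
      using L.iso_monic[OF Tp _ Td Td] Tpd by simp
    then show ?thesis using functor_Cmp[OF T d H] eq by metis
  qed
  have "equivclp (\<lambda>f g. \<exists>H. simplicial_homotopy C f g H) f g"
    using assms(4) by (simp add: simplicially_homotopic_def)
  then show ?thesis by (induction rule: equivclp_induct) (use step in metis)+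
qed

lemma functor_homotopy_equivalence:
  assumes L: "category L" and T: "is_functor (Simp C) L T"
    and incl: "\<And>X. X \<in> Obj (Simp C) \<Longrightarrow> is_iso L (Fm T (cyl_incl C 0 X))"
    and f: "simplicial_homotopy_equivalence C f"
  shows "is_iso L (Fm T f)"
proof -
  interpret L: category L by fact
  have f': "f \<in> Hom (Simp C) (src f) (tgt f)" 
    using f Arr_Hom by (fastforce simp: simplicial_homotopy_equivalence_def)
  obtain g where g: "g \<in> Hom (Simp C) (tgt f) (src f)"
    and gf: "simplicially_homotopic C (Cmp (Simp C) g f) (Idn (Simp C) (src f))"
    and fg: "simplicially_homotopic C (Cmp (Simp C) f g) (Idn (Simp C) (tgt f))"
    using f by (auto simp: simplicial_homotopy_equivalence_def)
  note h = functor_homotopic[OF L T, OF incl]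
  show ?thesis
    by (rule is_isoI[OF functor_Hom[OF T f'] functor_Hom[OF T g]])
      (use h[OF _ gf] h[OF _ fg] functor_Cmp[OF T f' g] functor_Cmp[OF T g f'] functor_Idn[OF T] 
         nt_functors[OF f'] in auto)
qed

text \<open>The inclusion \<open>d\<^sub>0\<close> is inverse to the projection \<open>p\<close> up to homotopy.  The homotopy from \<open>d\<^sub>0 p\<close> to the
  identity is induced by the maximum: a simplex \<open>u\<close> of the cylinder moves to \<open>max v u\<close>, which is
  constant \<open>1\<close> for \<open>v = 1\<close> and \<open>u\<close> for \<open>v = 0\<close>.\<close>

lemma cyl_incl_homotopy_equivalence:
  assumes X: "is_functor Delta_op C X"
  shows "simplicial_homotopy_equivalence C (cyl_incl C 0 X)"
proof -
  let ?Y = "cylinder C X" and ?d = "cyl_incl C 0 X" and ?S = "simplex 1 :: dmor sset"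
  let ?in = "tensor_inj C X ?S"
  note S = finite_sset_simplex[of 1]
  note Y = is_functor_cylinder[OF X] and d = cyl_incl_Hom[OF X]
  have Xo: "Fo X n \<in> Obj C" for n using functor_Obj[OF X, of n] by simp
  have [simp]: "Fo ?S n = Hom Delta n 1" for n by (simp add: simplex_def)
  have [simp]: "Fm ?S \<phi> u = Cmp Delta u \<phi>" for \<phi> u by (simp add: simplex_def)
  interpret D: category Delta by (rule category_Delta)
  note cop = tensor_coproduct[OF X S, folded cylinder_def]
  note inj = tensor_inj_Hom[OF X S, folded cylinder_def, simplified]
  note Ym = tensor_Fm[OF X S, folded cylinder_def]
  obtain p where p: "p \<in> Hom (Simp C) ?Y X" 
    and pd: "\<And>i. Cmp (Simp C) p (cyl_incl C i X) = Idn (Simp C) X"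
    and pi: "\<And>n u. u \<in> Hom Delta n 1 \<Longrightarrow> Cmp C (cmpnt p n) (?in n u) = Idn C (Fo X n)"
    using cylinder_projection[OF X] by metis
  \<comment> \<open>The homotopy on the summand of the cylinder of \<open>cylinder C X\<close> that is indexed by \<open>v\<close>.\<close>
  define t where "t n v = cotuple C (Hom Delta n 1) (\<lambda>_. Fo X n) (Fo ?Y n) (\<lambda>u. ?in n (simplex_max v u))"
    for n v
  have t: "t n v \<in> Hom C (Fo ?Y n) (Fo ?Y n)"
    and ti: "\<And>u. u \<in> Hom Delta n 1 \<Longrightarrow> Cmp C (t n v) (?in n u) = ?in n (simplex_max v u)"
    if v: "v \<in> Hom Delta n 1" for n v
  proof -
    have Yn: "Fo ?Y n = coprod C (Hom Delta n 1) (\<lambda>_. Fo X n)" 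
      by (simp add: cylinder_def tensor_def)
    note * = cotuple[OF finite_coproducts finite_Hom_Delta[of n 1], of "\<lambda>_. Fo X n" "Fo ?Y n" 
        "\<lambda>u. ?in n (simplex_max v u)"]
    show "t n v \<in> Hom C (Fo ?Y n) (Fo ?Y n)"
      unfolding t_def by (subst (2) Yn, rule *(1)) 
        (use v in \<open>simp_all add: Xo coproduct_Obj[OF cop] inj simplex_max_Hom\<close>)
    show "Cmp C (t n v) (?in n u) = ?in n (simplex_max v u)" if "u \<in> Hom Delta n 1" for u
      unfolding t_def using *(2)[of u] that v by (simp add: Xo coproduct_Obj[OF cop] inj simplex_max_Hom)
  qed
  have nat: "Cmp C (Fm ?Y \<phi>) (t n v) = Cmp C (t m (Cmp Delta v \<phi>)) (Fm ?Y \<phi>)"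
    if \<phi>: "\<phi> \<in> Hom Delta m n" and v: "v \<in> Hom Delta n 1" for m n \<phi> v
  proof (rule coproduct_eqI[OF cop])
    note v' = D.Cmp_Hom[OF \<phi> v]
    show "Cmp C (Fm ?Y \<phi>) (t n v) \<in> Hom C (Fo ?Y n) (Fo ?Y m)" using Cmp_Hom[OF t[OF v] Ym(1)[OF \<phi>]] .
    show "Cmp C (t m (Cmp Delta v \<phi>)) (Fm ?Y \<phi>) \<in> Hom C (Fo ?Y n) (Fo ?Y m)" 
      using Cmp_Hom[OF Ym(1)[OF \<phi>] t[OF v']] .
    fix u assume "u \<in> Fo ?S n"
    then have u: "u \<in> Hom Delta n 1" by simp
    note u' = D.Cmp_Hom[OF \<phi> u]
    have X\<phi>: "Fm X \<phi> \<in> Hom C (Fo X n) (Fo X m)" using functor_Hom[OF X] \<phi> by simp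
    show "Cmp C (Cmp C (Fm ?Y \<phi>) (t n v)) (?in n u) = Cmp C (Cmp C (t m (Cmp Delta v \<phi>)) (Fm ?Y \<phi>)) (?in n u)"
      using Cmp_assoc[OF inj[OF u] t[OF v] Ym(1)[OF \<phi>]] Cmp_assoc[OF inj[OF u] Ym(1)[OF \<phi>] t[OF v']]
        Ym(2)[OF \<phi>, of "simplex_max v u"] Ym(2)[OF \<phi>, of u] ti[OF v u] ti[OF v' u'] u
        simplex_max_Hom[OF v u] simplex_max_Cmp[OF v u \<phi>] Cmp_assoc[OF X\<phi> inj[OF u'] t[OF v']] by simp
  qed
  obtain H where H: "H \<in> Hom (Simp C) (cylinder C ?Y) ?Y"
    and Hk: "\<And>n v. v \<in> Hom Delta n 1 \<Longrightarrow> Cmp C (cmpnt H n) (tensor_inj C ?Y ?S n v) = t n v"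
    using tensor_map_exists[OF Y S Y, of t] t nat unfolding cylinder_def[of C ?Y] by (simp, metis)
  have eqY: "k = l" if "k \<in> Hom (Simp C) ?Y ?Y" "l \<in> Hom (Simp C) ?Y ?Y"
    and eq: "\<And>n u. u \<in> Hom Delta n 1 \<Longrightarrow> Cmp C (cmpnt k n) (?in n u) = Cmp C (cmpnt l n) (?in n u)" for k l
    by (rule nt_eqI[OF that(1,2)], rule coproduct_eqI[OF cop])
      (use eq nt_cmpnt[OF that(1)] nt_cmpnt[OF that(2)] in auto)
  note dY = cyl_incl_Hom[OF Y]
  have "Cmp (Simp C) H (cyl_incl C 0 ?Y) = Cmp (Simp C) ?d p"
  proof (rule eqY[OF Simp.Cmp_Hom[OF dY H] Simp.Cmp_Hom[OF p d]])
    fix n u assume u: "u \<in> Hom Delta n 1"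
    note di = inj[OF vertex_Hom[of 0 n]]
    show "Cmp C (cmpnt (Cmp (Simp C) H (cyl_incl C 0 ?Y)) n) (?in n u) 
        = Cmp C (cmpnt (Cmp (Simp C) ?d p) n) (?in n u)"
      using Hk[OF vertex_Hom] ti[OF vertex_Hom u] simplex_max_vertex0[OF u] pi[OF u] 
        Cmp_assoc[OF inj[OF u] nt_cmpnt[OF p, of n, simplified] di] Cmp_Idn_right[OF di]
      by (simp add: cyl_incl_cmpnt)
  qed
  moreover have "Cmp (Simp C) H (cyl_incl C 1 ?Y) = Idn (Simp C) ?Y"
  proof (rule eqY[OF Simp.Cmp_Hom[OF dY H] Simp.Idn_Hom])
    fix n u assume u: "u \<in> Hom Delta n 1"
    show "Cmp C (cmpnt (Cmp (Simp C) H (cyl_incl C 1 ?Y)) n) (?in n u) 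
        = Cmp C (cmpnt (Idn (Simp C) ?Y) n) (?in n u)"
      using Hk[OF vertex_Hom] ti[OF vertex_Hom u] simplex_max_vertex1[OF u] Cmp_Idn_left[OF inj[OF u]]
      by (simp add: cyl_incl_cmpnt)
  qed (use Y in simp)
  ultimately have "simplicial_homotopy C (Cmp (Simp C) ?d p) (Idn (Simp C) ?Y) H"
    using H Simp.Cmp_Hom[OF p d] Simp.Idn_Hom[of ?Y] Y nt_src[OF Simp.Cmp_Hom[OF p d]] 
      nt_tgt[OF Simp.Cmp_Hom[OF p d]]
      Hom_Arr[OF Simp.Cmp_Hom[OF p d]]
    by (simp add: simplicial_homotopy_def)
  then have "simplicially_homotopic C (Cmp (Simp C) ?d p) (Idn (Simp C) ?Y)"
    by (auto simp: simplicially_homotopic_def)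
  moreover have "simplicially_homotopic C (Cmp (Simp C) p ?d) (Idn (Simp C) X)"
    by (simp add: pd simplicially_homotopic_def)
  ultimately show ?thesis
    using p d nt_src[OF d] nt_tgt[OF d] Hom_Arr[OF d] by (auto simp: simplicial_homotopy_equivalence_def)
qed

end

section \<open>The cylinder as the diagonal of a bisimplicial object\<close>

context coproduct_category begin

text \<open>The bisimplicial object \<open>G\<close> has the rows \<open>A \<boxtimes> K\<close>, with \<open>K\<close> the constant simplicial set on the
  \<open>n\<close>-simplices of \<open>\<Delta>[1]\<close>, and the columns \<open>A\<^sub>m \<boxtimes> \<Delta>[1]\<close>.  Its rows are coproducts of copies of
  \<open>A\<close>; the map \<open>\<Phi>\<close> compares the chosen coproducts of simplicial objects with these.\<close>

lemma bisimplicial_cylinder: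
  assumes A: "is_functor Delta_op C A"
  obtains G F \<Phi> where "F \<in> Hom (Simp (Simp C)) (Fo (const_simp (Simp C)) A) G"
    and "\<And>m. Fm (post_ftor Delta_op (Simp C) (eval_ftor Delta_op C m)) F
           = cyl_incl C 0 (Fo (const_simp C) (Fo A m))"
    and "Fm (diagonal C) F = cyl_incl C 0 A"
    and "\<Phi> \<in> Hom (Simp (Simp C)) (cylinder (Simp C) (Fo (const_simp (Simp C)) A)) G"
    and "\<And>n. is_iso (Simp C) (cmpnt \<Phi> n)"
    and "Cmp (Simp (Simp C)) \<Phi> (cyl_incl (Simp C) 0 (Fo (const_simp (Simp C)) A)) = F"
proof -
  interpret D: category Delta by (rule category_Delta)
  interpret SC: coproduct_category "Simp C" by (rule coproduct_category_Simp)
  let ?S = "simplex 1 :: dmor sset"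
  let ?cs = "\<lambda>n. Ftor (\<lambda>_. Hom Delta n 1) (\<lambda>_ k. k) :: dmor sset"
  let ?c = "\<lambda>m. Fo (const_simp C) (Fo A m)"
  \<comment> \<open>Rows, columns and the injections \<open>A\<^sub>m \<rightarrow> G\<^bsub>n,m\<^esub>\<close>.\<close>
  define R where "R n = tensor C A (?cs n)" for n
  define K where "K m = cylinder C (?c m)" for m
  define \<iota> where "\<iota> n k m = coprod_inj C (Hom Delta n 1) (\<lambda>_. Fo A m) k" for n k m
  define G where "G = bi_ftor Delta_op R K"
  note S = finite_sset_simplex[of 1]
  note cs = finite_sset_const[OF finite_Hom_Delta[of _ 1]]
  have [simp]: "Fo ?S n = Hom Delta n 1" "Fm ?S \<phi> u = Cmp Delta u \<phi>" for n \<phi> u 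
    by (simp_all add: simplex_def)
  have Ao: "Fo A m \<in> Obj C" for m using functor_Obj[OF A, of m] by simp
  have Am: "Fm A w \<in> Hom C (Fo A c) (Fo A d)" if "w \<in> Hom Delta d c" for w c d
    using functor_Hom[OF A] that by simp
  have c: "is_functor Delta_op C (?c m)" for m 
    using functor_Obj[OF is_functor_const[OF category_Delta_op category_axioms] Ao] by simp
  have c_simps [simp]: "Fo (?c m) n = Fo A m" "w \<in> Arr Delta \<Longrightarrow> Fm (?c m) w = Idn C (Fo A m)" for m n w
    using Ao by simp_all
  have R: "is_functor Delta_op C (R n)" for n unfolding R_def by (rule is_functor_tensor[OF A cs])
  have K: "is_functor Delta_op C (K m)" for m unfolding K_def by (rule is_functor_cylinder[OF c])
  have RK: "Fo (R n) m = Fo (K m) n" for n m by (simp add: R_def K_def cylinder_def tensor_def)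
  have cop: "is_coproduct C (Hom Delta n 1) (\<lambda>_. Fo A m) (Fo (R n) m) (\<lambda>k. \<iota> n k m)" for n m
    using tensor_coproduct[OF A cs, of n m] by (simp add: R_def \<iota>_def)
  note \<iota> = coproduct_inj[OF cop]
  note Rm = functor_Hom[OF R, of _ c d for c d, simplified] 
    and Km = functor_Hom[OF K, of _ c d for c d, simplified, folded RK]
  have R\<iota>: "Cmp C (Fm (R n) w) (\<iota> n k c) = Cmp C (\<iota> n k d) (Fm A w)"
    if "w \<in> Hom Delta d c" "k \<in> Hom Delta n 1" for n w c d k
    using tensor_Fm(2)[OF A cs that(1), of k n] that by (simp add: R_def \<iota>_def)
  have K\<iota>: "Cmp C (Fm (K m) u) (\<iota> a k m) = \<iota> b (Cmp Delta k u) m"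
    if "u \<in> Hom Delta b a" "k \<in> Hom Delta a 1" for m u a b k
    using tensor_Fm(2)[OF c S that(1), of k m] that Hom_Arr[OF that(1)]
      Cmp_Idn_right[OF \<iota>[OF D.Cmp_Hom[OF that]]]
    by (simp add: K_def \<iota>_def cylinder_def)
  have RK\<iota>: "Cmp C (Cmp C (Fm (K d) u) (Fm (R a) w)) (\<iota> a k c) = Cmp C (\<iota> b (Cmp Delta k u) d) (Fm A w)"
    if u: "u \<in> Hom Delta b a" and w: "w \<in> Hom Delta d c" and k: "k \<in> Hom Delta a 1" for u w a b c d k
    using Cmp_assoc[OF \<iota>[OF k] Rm[OF w] Km[OF u]] R\<iota>[OF w k] Cmp_assoc[OF Am[OF w] \<iota>[OF k] Km[OF u]] 
      K\<iota>[OF u k] by simp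
  have G: "is_functor Delta_op (Simp C) G"
    unfolding G_def
  proof (rule is_functor_bi[OF category_Delta_op category_axioms R K RK])
    fix u w a b c d assume "u \<in> Hom Delta_op a b" "w \<in> Hom Delta_op c d"
    then have u: "u \<in> Hom Delta b a" and w: "w \<in> Hom Delta d c" by simp_all
    show "Cmp C (Fm (K d) u) (Fm (R a) w) = Cmp C (Fm (R b) w) (Fm (K c) u)"
    proof (rule coproduct_eqI[OF cop Cmp_Hom[OF Rm[OF w] Km[OF u]] Cmp_Hom[OF Km[OF u] Rm[OF w]]])
      fix k assume k: "k \<in> Hom Delta a 1"
      note k' = D.Cmp_Hom[OF u k]
      show "Cmp C (Cmp C (Fm (K d) u) (Fm (R a) w)) (\<iota> a k c) 
          = Cmp C (Cmp C (Fm (R b) w) (Fm (K c) u)) (\<iota> a k c)"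
        using RK\<iota>[OF u w k] Cmp_assoc[OF \<iota>[OF k] Km[OF u] Rm[OF w]] K\<iota>[OF u k] R\<iota>[OF w k'] by simp
    qed
  qed
  \<comment> \<open>The injections assembled into maps from \<open>A\<close> to the rows, which exhibit these as coproducts.\<close>
  define r where "r n k = Nt A (R n) (\<iota> n k)" for n k
  have r: "r n k \<in> Hom (Simp C) A (R n)" if k: "k \<in> Hom Delta n 1" for n k
    unfolding r_def
    by (rule nt_HomI[OF A R]) (use \<iota>[OF k] R\<iota>[OF _ k] in \<open>auto simp: extensional_def\<close>)
  have rcop: "is_coproduct (Simp C) (Hom Delta n 1) (\<lambda>_. A) (R n) (r n)" for n
    by (rule levelwise_coproduct[OF category_Delta_op category_axioms R r]) (simp_all add: r_def cop)
  let ?cA = "Fo (const_simp (Simp C)) A"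
  have Ao': "A \<in> Obj (Simp C)" using A by simp
  have cA: "is_functor Delta_op (Simp C) ?cA"
    using functor_Obj[OF is_functor_const[OF category_Delta_op Simp.category_axioms] Ao'] by simp
  define F where "F = Nt ?cA G (\<lambda>n \<in> Obj Delta_op. r n (vertex 0 n))"
  have F: "F \<in> Hom (Simp (Simp C)) ?cA G"
    unfolding F_def
  proof (rule bi_HomI[OF category_Delta_op category_axioms cA G])
    show "r i (vertex 0 i) \<in> Hom (Simp C) (Fo ?cA i) (Fo G i)" for i
      using r[OF vertex_Hom] A by (simp add: G_def)
    fix u a b j assume "u \<in> Hom Delta_op a b"
    then have u: "u \<in> Hom Delta b a" by simp
    show "Cmp C (cmpnt (r b (vertex 0 b)) j) (cmpnt (Fm ?cA u) j) 
        = Cmp C (cmpnt (Fm G u) j) (cmpnt (r a (vertex 0 a)) j)"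
      using Hom_Arr[OF u] A K\<iota>[OF u vertex_Hom] Cmp_Idn_right[OF \<iota>[OF vertex_Hom]]
      by (simp add: G_def r_def vertex_Cmp[OF u])
  qed
  have Fc: "cmpnt (cmpnt F n) m = \<iota> n (vertex 0 n) m" for n m by (simp add: F_def r_def)
  have column: "Fm (post_ftor Delta_op (Simp C) (eval_ftor Delta_op C m)) F = cyl_incl C 0 (?c m)" for m
  proof -
    let ?P = "post_ftor Delta_op (Simp C) (eval_ftor Delta_op C m)"
    have ev: "is_functor (Simp C) C (eval_ftor Delta_op C m)"
      by (rule is_functor_eval[OF category_Delta_op category_axioms]) simp
    have P: "is_functor (Simp (Simp C)) (Simp C) ?P"
      by (rule is_functor_post[OF category_Delta_op Simp.category_axioms category_axioms ev])
    have "Fo ?P ?cA = ?c m"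
    proof (rule functor_eqI[OF _ c])
      show "is_functor Delta_op C (Fo ?P ?cA)" using functor_Obj[OF P, of ?cA] cA by simp
    qed (use cA A in \<open>simp_all add: post_ftor_def del: Fo_comp Fm_comp\<close>)
    moreover have "Fo ?P G = cylinder C (?c m)"
    proof (rule functor_eqI[OF _ is_functor_cylinder[OF c]])
      show "is_functor Delta_op C (Fo ?P G)" using functor_Obj[OF P, of G] G by simp
      show "Fo (Fo ?P G) n = Fo (cylinder C (?c m)) n" for n
        using RK[of n m] G by (simp add: post_ftor_def del: Fo_comp Fm_comp) (simp add: G_def K_def)
      show "Fm (Fo ?P G) w = Fm (cylinder C (?c m)) w" if "w \<in> Arr Delta_op" for w
        using that G by (simp add: post_ftor_def del: Fo_comp Fm_comp) (simp add: G_def K_def)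
    qed
    ultimately have PF: "Fm ?P F \<in> Hom (Simp C) (?c m) (cylinder C (?c m))" using functor_Hom[OF P F] by simp
    show ?thesis
    proof (rule nt_eqI[OF PF cyl_incl_Hom[OF c]])
      fix n assume n: "n \<in> Obj Delta_op"
      have "cmpnt F n \<in> Arr (Simp C)" by (rule Hom_Arr[OF nt_cmpnt[OF F n]])
      then show "cmpnt (Fm ?P F) n = cmpnt (cyl_incl C 0 (?c m)) n"
        using n Hom_Arr[OF F]
        by (simp add: post_ftor_def whisker_left_def eval_ftor_def Fc cyl_incl_cmpnt \<iota>_def)
    qed
  qed
  have diag: "Fm (diagonal C) F = cyl_incl C 0 A"
  proof -
    note dg = is_functor_diag[OF category_Delta_op category_axioms]
    have "Fo (diagonal C) ?cA = A"
      using arg_cong[OF diag_const[OF category_Delta_op category_axioms], of "\<lambda>H. Fo H A"] Ao'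
      by (simp add: id_ftor_def)
    moreover have "Fo (diagonal C) G = cylinder C A"
    proof (rule functor_eqI[OF _ is_functor_cylinder[OF A]])
      show "is_functor Delta_op C (Fo (diagonal C) G)" using functor_Obj[OF dg, of G] G by simp
      have FoG: "Fo (Fo (diagonal C) G) n = Fo (R n) n" for n using G by simp (simp add: G_def)
      show "Fo (Fo (diagonal C) G) n = Fo (cylinder C A) n" for n
        unfolding FoG by (simp add: R_def cylinder_def tensor_def)
      then have FoR: "Fo (R n) n = Fo (cylinder C A) n" for n by (simp add: FoG)
      fix w assume "w \<in> Arr Delta_op"
      define a b where "a = Cod Delta w" and "b = Dom Delta w"
      have w: "w \<in> Hom Delta b a" using Arr_Hom \<open>w \<in> Arr Delta_op\<close> by (simp add: a_def b_def)
      have "Fm (Fo (diagonal C) G) w = Cmp C (Fm (K b) w) (Fm (R a) w)"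
        using G Hom_Arr[OF w] by simp (simp add: G_def a_def b_def)
      also have "\<dots> = Fm (cylinder C A) w"
      proof (rule coproduct_eqI[OF cop Cmp_Hom[OF Rm[OF w] Km[OF w]]])
        show "Fm (cylinder C A) w \<in> Hom C (Fo (R a) a) (Fo (R b) b)"
          unfolding FoR using functor_Hom[OF is_functor_cylinder[OF A]] w by simp
        show "Cmp C (Cmp C (Fm (K b) w) (Fm (R a) w)) (\<iota> a k a) = Cmp C (Fm (cylinder C A) w) (\<iota> a k a)"
          if k: "k \<in> Hom Delta a 1" for k
          using RK\<iota>[OF w w k] tensor_Fm(2)[OF A S w, of k] k by (simp add: cylinder_def \<iota>_def)
      qed
      finally show "Fm (Fo (diagonal C) G) w = Fm (cylinder C A) w" .
    qed
    ultimately have DF: "Fm (diagonal C) F \<in> Hom (Simp C) A (cylinder C A)" 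
      using functor_Hom[OF dg F] by simp
    show ?thesis
      by (rule nt_eqI[OF DF cyl_incl_Hom[OF A]])
        (use Hom_Arr[OF F] in \<open>simp add: Fc cyl_incl_cmpnt \<iota>_def\<close>)
  qed
  have Gr: "Cmp (Simp C) (Fm G \<phi>) (r n k) = Cmp (Simp C) (r m (Cmp Delta k \<phi>)) (Fm ?cA \<phi>)"
    if \<phi>: "\<phi> \<in> Hom Delta m n" and k: "k \<in> Hom Delta n 1" for \<phi> m n k
  proof (rule nt_eqI)
    note k' = D.Cmp_Hom[OF \<phi> k]
    have g: "Fm G \<phi> \<in> Hom (Simp C) (R n) (R m)" using functor_Hom[OF G, of \<phi> n m] \<phi> by (simp add: G_def)
    have a: "Fm ?cA \<phi> \<in> Hom (Simp C) A A" using functor_Hom[OF cA, of \<phi> n m] \<phi> A by simp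
    show "Cmp (Simp C) (Fm G \<phi>) (r n k) \<in> Hom (Simp C) A (R m)" using Simp.Cmp_Hom[OF r[OF k] g] .
    show "Cmp (Simp C) (r m (Cmp Delta k \<phi>)) (Fm ?cA \<phi>) \<in> Hom (Simp C) A (R m)"
      using Simp.Cmp_Hom[OF a r[OF k']] .
    show "cmpnt (Cmp (Simp C) (Fm G \<phi>) (r n k)) j = cmpnt (Cmp (Simp C) (r m (Cmp Delta k \<phi>)) (Fm ?cA \<phi>)) j" for j
      using K\<iota>[OF \<phi> k, of j] Cmp_Idn_right[OF \<iota>[OF k']] Hom_Arr[OF \<phi>] A by (simp add: r_def G_def)
  qed
  have Gr': "Cmp (Simp C) (Fm G \<phi>) (r n k) = Cmp (Simp C) (r m (Fm ?S \<phi> k)) (Fm ?cA \<phi>)"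
    if "\<phi> \<in> Hom Delta m n" "k \<in> Fo ?S n" for \<phi> m n k
    using Gr that by simp
  have rG: "r n k \<in> Hom (Simp C) (Fo ?cA n) (Fo G n)" if "k \<in> Fo ?S n" for n k
    using r that A by (simp add: G_def)
  have "\<exists>\<Phi>. \<Phi> \<in> Hom (Simp (Simp C)) (cylinder (Simp C) ?cA) G \<and>
      (\<forall>n. \<forall>k \<in> Fo ?S n. Cmp (Simp C) (cmpnt \<Phi> n) (tensor_inj (Simp C) ?cA ?S n k) = r n k)"
  proof (rule SC.tensor_map_exists[OF cA S G, of r, folded cylinder_def])
    show ?thesis if "h \<in> Hom (Simp (Simp C)) (cylinder (Simp C) ?cA) G"
      "\<And>n k. k \<in> Fo ?S n \<Longrightarrow> Cmp (Simp C) (cmpnt h n) (tensor_inj (Simp C) ?cA ?S n k) = r n k" for h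
      using that by blast
  qed (fact rG Gr')+
  then obtain \<Phi> where \<Phi>: "\<Phi> \<in> Hom (Simp (Simp C)) (cylinder (Simp C) ?cA) G"
    and \<Phi>r': "\<And>n k. k \<in> Fo ?S n \<Longrightarrow> Cmp (Simp C) (cmpnt \<Phi> n) (tensor_inj (Simp C) ?cA ?S n k) = r n k"
    by blast
  have \<Phi>r: "Cmp (Simp C) (cmpnt \<Phi> n) (tensor_inj (Simp C) ?cA ?S n k) = r n k" if "k \<in> Hom Delta n 1" for n k
    using \<Phi>r' that by simp
  have "is_iso (Simp C) (cmpnt \<Phi> n)" for n
  proof (rule Simp.coproduct_comparison_iso)
    show "is_coproduct (Simp C) (Fo ?S n) (\<lambda>_. Fo ?cA n) (Fo (cylinder (Simp C) ?cA) n) (tensor_inj (Simp C) ?cA ?S n)"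
      unfolding cylinder_def by (rule SC.tensor_coproduct[OF cA S])
    show "is_coproduct (Simp C) (Fo ?S n) (\<lambda>_. Fo ?cA n) (R n) (r n)" using rcop[of n] A by simp
    show "cmpnt \<Phi> n \<in> Hom (Simp C) (Fo (cylinder (Simp C) ?cA) n) (R n)"
      using nt_cmpnt[OF \<Phi>, of n] by (simp add: G_def)
  qed (use \<Phi>r in simp)
  moreover have "Cmp (Simp (Simp C)) \<Phi> (cyl_incl (Simp C) 0 ?cA) = F"
    by (rule nt_eqI[OF SC.Simp.Cmp_Hom[OF SC.cyl_incl_Hom[OF cA] \<Phi>] F])
      (use \<Phi>r[OF vertex_Hom] in \<open>simp add: SC.cyl_incl_cmpnt F_def\<close>)
  ultimately show thesis using that[OF F column diag \<Phi>] by blast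
qed

text \<open>Membership in a saturated class is invertibility in the localization, hence homotopy equivalences
  land in \<open>E\<close> as soon as the inclusions into cylinders do.\<close>

lemma homotopy_equivalence_saturated:
  assumes B: "category B" and E: "saturated B E" and T: "is_functor (Simp C) B T"
    and incl: "\<And>X. is_functor Delta_op C X \<Longrightarrow> Fm T (cyl_incl C 0 X) \<in> E"
    and f: "simplicial_homotopy_equivalence C f"
  shows "Fm T f \<in> E"
proof -
  interpret B: category B by fact
  let ?L = "localization B E" and ?Q = "loc_ftor B E"
  have iff: "is_iso ?L (Fm (comp_ftor (Simp C) ?Q T) g) \<longleftrightarrow> Fm T g \<in> E" if "g \<in> Arr (Simp C)" for g
    using B.saturated_iff[OF E functor_Arr[OF T that]] that by simp
  have "is_iso ?L (Fm (comp_ftor (Simp C) ?Q T) f)"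
    by (rule functor_homotopy_equivalence[OF B.category_localization 
          is_functor_comp[OF Simp.category_axioms T B.is_functor_loc] _ f])
      (use incl iff Hom_Arr[OF cyl_incl_Hom] in auto)
  then show ?thesis using iff f by (auto simp: simplicial_homotopy_equivalence_def)
qed

end

section \<open>Simplicial descent structures and closed classes\<close>

text \<open>Functors connected by a zigzag of natural weak equivalences send the same arrows to weak
  equivalences, by two-out-of-three in each naturality square.\<close>

lemma weq_zigzag_iff:
  assumes A: "category A" and B: "category B" and E: "two_out_of_three B E"
    and zz: "weq_zigzag (functor_category A B) (objectwise A B E) F us G" and f: "f \<in> Hom A a b"
  shows "Fm F f \<in> E \<longleftrightarrow> Fm G f \<in> E"
  using zz
proof (induction us arbitrary: F)
  case Nil then show ?case by (simp add: weq_zigzag_def)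
next
  case (Cons l us)
  interpret A: category A by fact
  have step: "Fm (src \<eta>) f \<in> E \<longleftrightarrow> Fm (tgt \<eta>) f \<in> E" if "\<eta> \<in> objectwise A B E" for \<eta>
  proof -
    have \<eta>: "\<eta> \<in> Hom (functor_category A B) (src \<eta>) (tgt \<eta>)" 
      using that Arr_Hom by (fastforce simp: objectwise_def)
    note ab = A.Hom_objs[OF f]
    have E': "cmpnt \<eta> a \<in> E" "cmpnt \<eta> b \<in> E" using that ab by (auto simp: objectwise_def)
    note S = functor_Hom[OF nt_functors(1)[OF \<eta>] f] and T = functor_Hom[OF nt_functors(2)[OF \<eta>] f]
    have "Fm (src \<eta>) f \<in> E \<longleftrightarrow> Cmp B (cmpnt \<eta> b) (Fm (src \<eta>) f) \<in> E"
      using two_out_of_threeD(1,3)[OF E S nt_cmpnt[OF \<eta> ab(2)]] E' by blast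
    moreover have "Fm (tgt \<eta>) f \<in> E \<longleftrightarrow> Cmp B (Fm (tgt \<eta>) f) (cmpnt \<eta> a) \<in> E"
      using two_out_of_threeD(1,2)[OF E nt_cmpnt[OF \<eta> ab(1)] T] E' by blast
    ultimately show ?thesis by (simp only: nt_natural[OF \<eta> f])
  qed
  show ?case
    by (cases l) (use Cons step in \<open>auto simp: weq_zigzag_def\<close>)
qed

text \<open>The class of maps that the simple functor sends to weak equivalences is closed.  Diagonals of
  row-wise members come from S4 and \<open>\<mu>\<close>; column-wise members reduce to these by transposition, and the
  inclusions \<open>d\<^sub>0\<close> are such diagonals by \<open>bisimplicial_cylinder\<close>.\<close>

lemma descent_class_closed:
  fixes D :: "('o, 'm) category"
  assumes "simplicial_descent_category D E s"
  shows "Delta_coprod_closed D {f \<in> Arr (Simp D). Fm s f \<in> E}"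
proof -
  obtain mu lam where "simplicial_descent_structure D E s mu lam"
    using assms by (auto simp: simplicial_descent_category_def)
  then interpret st: simplicial_descent_structure D E s mu lam .
  have sat: "saturated D E" using st.relative by (simp add: relative_category_def)
  interpret coproduct_category D
    using st.relative st.coproducts
    by (simp add: coproduct_category_def coproduct_category_axioms_def relative_category_def 
        closed_by_finite_coproducts_def)
  let ?S = "{f \<in> Arr (Simp D). Fm s f \<in> E}"
  let ?D = "diagonal D"
  note s = st.S1_functor
  note E3 = saturated_two_out_of_three[OF sat]
  interpret SS: category "Simp (Simp D)" by (rule category_Simp[OF Simp.category_axioms])
  note dg = is_functor_diag[OF category_Delta_op category_axioms]
  have three: "two_out_of_three (Simp D) ?S"
    unfolding two_out_of_three_def
  proof (intro ballI impI)
    fix f g assume fg: "f \<in> Arr (Simp D)" "g \<in> Arr (Simp D)" "Cod (Simp D) f = Dom (Simp D) g"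
    then have f: "f \<in> Hom (Simp D) (src f) (tgt f)" and g: "g \<in> Hom (Simp D) (tgt f) (tgt g)"
      by (auto simp: Hom_def)
    show "(f \<in> ?S \<and> g \<in> ?S \<longrightarrow> Cmp (Simp D) g f \<in> ?S) \<and> (f \<in> ?S \<and> Cmp (Simp D) g f \<in> ?S \<longrightarrow> g \<in> ?S) \<and>
      (g \<in> ?S \<and> Cmp (Simp D) g f \<in> ?S \<longrightarrow> f \<in> ?S)"
      using two_out_of_threeD[OF E3 functor_Hom[OF s f] functor_Hom[OF s g]] functor_Cmp[OF s f g]
        fg Hom_Arr[OF Simp.Cmp_Hom[OF f g]] by auto
  qed
  have rows: "Fm ?D F \<in> ?S" if F: "F \<in> Arr (Simp (Simp D))" and r: "\<And>n. cmpnt F n \<in> ?S" for F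
  proof -
    let ?P = "post_ftor Delta_op (Simp D) s"
    have F': "F \<in> Hom (Simp (Simp D)) (src F) (tgt F)" using Arr_Hom[OF F] by simp
    note P = is_functor_post[OF category_Delta_op Simp.category_axioms category_axioms s]
    \<comment> \<open>S4 for the map \<open>n \<mapsto> s(F\<^sub>n)\<close>; then \<open>\<mu>\<close> passes from the iterated simple to the simple of the diagonal.\<close>
    have "Fm s (Fm ?P F) \<in> E"
      by (rule st.S4[OF functor_Arr[OF P F]]) 
        (use r F in \<open>simp add: post_ftor_def whisker_left_def\<close>)
    then show ?thesis
      using weq_zigzag_iff[OF SS.category_axioms category_axioms E3 st.S2 F'] F functor_Arr[OF dg F] by simp
  qed
  have columns: "Fm ?D F \<in> ?S" if F: "F \<in> Arr (Simp (Simp D))" 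
    and c: "\<And>n. Fm (post_ftor Delta_op (Simp D) (eval_ftor Delta_op D n)) F \<in> ?S" for F
    using transpose_map[OF category_Delta_op category_axioms Arr_Hom[OF F]] rows c
    by (metis (no_types, lifting) UNIV_I Obj_Delta opposite_simps(1))
  have incl: "Fm s (cyl_incl D 0 X) \<in> E" if X: "is_functor Delta_op D X" for X
  proof -
    obtain G F \<Phi> where F: "F \<in> Hom (Simp (Simp D)) (Fo (const_simp (Simp D)) X) G"
      and col: "\<And>m. Fm (post_ftor Delta_op (Simp D) (eval_ftor Delta_op D m)) F
           = cyl_incl D 0 (Fo (const_simp D) (Fo X m))"
      and diag: "Fm ?D F = cyl_incl D 0 X"
      by (rule bisimplicial_cylinder[OF X]) blast
    \<comment> \<open>The columns are the maps of S5.\<close>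
    have "Fm (post_ftor Delta_op (Simp D) (eval_ftor Delta_op D m)) F \<in> ?S" for m
    proof -
      have Xm: "Fo X m \<in> Obj D" using functor_Obj[OF X, of m] by simp
      have "is_functor Delta_op D (Fo (const_simp D) (Fo X m))"
        using functor_Obj[OF is_functor_const[OF category_Delta_op category_axioms] Xm] by simp
      then show ?thesis using Hom_Arr[OF cyl_incl_Hom] st.S5[OF Xm] by (simp add: col)
    qed
    then show ?thesis using columns[OF Hom_Arr[OF F]] diag by simp
  qed
  have homotopy: "f \<in> ?S" if "simplicial_homotopy_equivalence D f" for f
    using homotopy_equivalence_saturated[OF category_axioms sat s incl that] that 
    by (simp add: simplicial_homotopy_equivalence_def)
  have cop: "coprod2_arr (Simp D) F G \<in> ?S" if FS: "F \<in> ?S" and GS: "G \<in> ?S" for F G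
  proof -
    interpret SD: coproduct_category "Simp D" by (rule coproduct_category_Simp)
    define X X' Y Y' where "X = src F" and "X' = tgt F" and "Y = src G" and "Y' = tgt G"
    have F: "F \<in> Hom (Simp D) X X'" and G: "G \<in> Hom (Simp D) Y Y'" 
      using FS GS Arr_Hom by (fastforce simp: X_def X'_def Y_def Y'_def)+
    note o = Simp.Hom_objs[OF F] Simp.Hom_objs[OF G]
    note fcD = finite_coproducts and fcS = SD.finite_coproducts
    note FG = Simp.coprod2_arr[OF fcS F G]
    let ?c = "\<lambda>X Y. copair D (Fo s X) (Fo s Y) (Fo s (coprod2 (Simp D) X Y))
        (Fm s (inj_left (Simp D) X Y)) (Fm s (inj_right (Simp D) X Y))"
    have so: "Fo s X \<in> Obj D" if "X \<in> Obj (Simp D)" for X using functor_Obj[OF s that] .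
    note il = inj_left_Hom[OF fcS] and ir = inj_right_Hom[OF fcS]
    have c: "?c X Y \<in> Hom D (coprod2 D (Fo s X) (Fo s Y)) (Fo s (coprod2 (Simp D) X Y))"
      "Cmp D (?c X Y) (inj_left D (Fo s X) (Fo s Y)) = Fm s (inj_left (Simp D) X Y)"
      "Cmp D (?c X Y) (inj_right D (Fo s X) (Fo s Y)) = Fm s (inj_right (Simp D) X Y)"
      if X: "X \<in> Obj (Simp D)" and Y: "Y \<in> Obj (Simp D)" for X Y
      using copair[OF fcD so[OF X] so[OF Y] so[OF Simp.Hom_objs(2)[OF il[OF X Y]]] 
          functor_Hom[OF s il[OF X Y]] functor_Hom[OF s ir[OF X Y]]] by auto
    note c1 = c[OF o(1,3)] and c2 = c[OF o(2,4)]
    note sF = functor_Hom[OF s F] and sG = functor_Hom[OF s G] and sFG = functor_Hom[OF s FG(1)]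
    note FG' = coprod2_arr[OF fcD sF sG]
    note i1 = inj_left_Hom[OF fcD so[OF o(1)] so[OF o(3)]] inj_right_Hom[OF fcD so[OF o(1)] so[OF o(3)]]
      and i2 = inj_left_Hom[OF fcD so[OF o(2)] so[OF o(4)]] inj_right_Hom[OF fcD so[OF o(2)] so[OF o(4)]]
    \<comment> \<open>Naturality of the comparison map of S1.\<close>
    have "Cmp D (?c X' Y') (coprod2_arr D (Fm s F) (Fm s G)) = Cmp D (Fm s (coprod2_arr (Simp D) F G)) (?c X Y)"
    proof (rule coprod2_eqI[OF fcD so[OF o(1)] so[OF o(3)] Cmp_Hom[OF FG'(1) c2(1)] Cmp_Hom[OF c1(1) sFG]])
      show "Cmp D (Cmp D (?c X' Y') (coprod2_arr D (Fm s F) (Fm s G))) (inj_left D (Fo s X) (Fo s Y)) 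
        = Cmp D (Cmp D (Fm s (coprod2_arr (Simp D) F G)) (?c X Y)) (inj_left D (Fo s X) (Fo s Y))"
        using Cmp_assoc[OF i1(1) FG'(1) c2(1)] Cmp_assoc[OF i1(1) c1(1) sFG] c1(2) c2(2) FG(2) FG'(2)
          Cmp_assoc[OF sF i2(1) c2(1)] functor_Cmp[OF s F il[OF o(2,4)]] functor_Cmp[OF s il[OF o(1,3)] FG(1)]
        by simp
      show "Cmp D (Cmp D (?c X' Y') (coprod2_arr D (Fm s F) (Fm s G))) (inj_right D (Fo s X) (Fo s Y)) 
        = Cmp D (Cmp D (Fm s (coprod2_arr (Simp D) F G)) (?c X Y)) (inj_right D (Fo s X) (Fo s Y))"
        using Cmp_assoc[OF i1(2) FG'(1) c2(1)] Cmp_assoc[OF i1(2) c1(1) sFG] c1(3) c2(3) FG(3) FG'(3)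
          Cmp_assoc[OF sG i2(2) c2(1)] functor_Cmp[OF s G ir[OF o(2,4)]] functor_Cmp[OF s ir[OF o(1,3)] FG(1)]
        by simp
    qed
    moreover have "coprod2_arr D (Fm s F) (Fm s G) \<in> E"
      using st.coproducts FS GS by (simp add: closed_by_finite_coproducts_def)
    note two_out_of_threeD(1)[OF E3 FG'(1) c2(1) this st.S1_coproduct[OF o(2,4)]]
    ultimately have "Cmp D (Fm s (coprod2_arr (Simp D) F G)) (?c X Y) \<in> E" by (simp only:)
    note two_out_of_threeD(2)[OF E3 c1(1) sFG st.S1_coproduct[OF o(1,3)] this]
    then show ?thesis using Hom_Arr[OF FG(1)] by simp
  qed
  show ?thesis
    unfolding Delta_coprod_closed_def Delta_closed_def using homotopy three rows columns cop by blast
qed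

context coproduct_category begin

lemma closed_of_diagonal_descent:
  assumes "simplicial_descent_category (Simp C) W (diagonal C)"
  shows "Delta_coprod_closed C W"
proof -
  obtain mu lam where "simplicial_descent_structure (Simp C) W (diagonal C) mu lam"
    using assms by (auto simp: simplicial_descent_category_def)
  then interpret st: simplicial_descent_structure "Simp C" W "diagonal C" mu lam .
  interpret SC: coproduct_category "Simp C" by (rule coproduct_category_Simp)
  have sat: "saturated (Simp C) W" using st.relative by (simp add: relative_category_def)
  note W3 = Simp.saturated_two_out_of_three[OF sat]
  note dg = is_functor_diag[OF category_Delta_op category_axioms]
  have columns: "Fm (diagonal C) F \<in> W" if F: "F \<in> Arr (Simp (Simp C))" 
    and c: "\<And>n. Fm (post_ftor Delta_op (Simp C) (eval_ftor Delta_op C n)) F \<in> W" for F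
    using transpose_map[OF category_Delta_op category_axioms Arr_Hom[OF F]] st.S4 c
    by (metis (no_types, lifting) UNIV_I Obj_Delta opposite_simps(1))
  have incl: "cyl_incl C 0 X \<in> W" if X: "is_functor Delta_op C X" for X
  proof -
    let ?cX = "Fo (const_simp (Simp C)) X"
    have X': "X \<in> Obj (Simp C)" using X by simp
    have cX: "is_functor Delta_op (Simp C) ?cX"
      using functor_Obj[OF is_functor_const[OF category_Delta_op Simp.category_axioms] X'] by simp
    obtain G F \<Phi> where F: "F \<in> Hom (Simp (Simp C)) ?cX G"
      and diag: "Fm (diagonal C) F = cyl_incl C 0 X"
      and \<Phi>: "\<Phi> \<in> Hom (Simp (Simp C)) (cylinder (Simp C) ?cX) G"
      and iso: "\<And>n. is_iso (Simp C) (cmpnt \<Phi> n)"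
      and eq: "Cmp (Simp (Simp C)) \<Phi> (cyl_incl (Simp C) 0 ?cX) = F"
      using bisimplicial_cylinder[OF X] by metis
    have rows\<Phi>: "cmpnt \<Phi> n \<in> W" for n
      using Simp.saturated_iso[OF sat nt_cmpnt[OF \<Phi>] iso, of n] by simp
    note d = SC.cyl_incl_Hom[OF cX, of 0]
    have "Fm (diagonal C) \<Phi> \<in> W" using rows\<Phi> st.S4[OF Hom_Arr[OF \<Phi>]] by simp
    moreover have "Fm (diagonal C) (cyl_incl (Simp C) 0 ?cX) \<in> W" using st.S5[OF X'] .
    ultimately show ?thesis
      using two_out_of_threeD(1)[OF W3 functor_Hom[OF dg d] functor_Hom[OF dg \<Phi>]] functor_Cmp[OF dg d \<Phi>] 
        eq diag by simp
  qed
  have homotopy: "f \<in> W" if f: "simplicial_homotopy_equivalence C f" for f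
  proof -
    have "Fm (id_ftor (Simp C)) f \<in> W"
      by (rule homotopy_equivalence_saturated[OF Simp.category_axioms sat 
            is_functor_id[OF Simp.category_axioms] _ f])
        (use incl Hom_Arr[OF cyl_incl_Hom] in \<open>simp add: id_ftor_def\<close>)
    then show ?thesis using f by (simp add: id_ftor_def simplicial_homotopy_equivalence_def)
  qed
  show ?thesis
    unfolding Delta_coprod_closed_def Delta_closed_def 
    using saturated_subset[OF sat] homotopy W3 st.S4 columns st.coproducts 
    by (auto simp: closed_by_finite_coproducts_def)
qed

text \<open>Diagonals preserve binary coproducts, because coproducts of bisimplicial objects are computed in
  each bidegree.\<close>

lemma diagonal_coproduct_iso:
  assumes X: "X \<in> Obj (Simp (Simp C))" and Y: "Y \<in> Obj (Simp (Simp C))"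
  defines "c \<equiv> copair (Simp C) (Fo (diagonal C) X) (Fo (diagonal C) Y) 
      (Fo (diagonal C) (coprod2 (Simp (Simp C)) X Y))
      (Fm (diagonal C) (inj_left (Simp (Simp C)) X Y)) (Fm (diagonal C) (inj_right (Simp (Simp C)) X Y))"
  shows "c \<in> Hom (Simp C) (coprod2 (Simp C) (Fo (diagonal C) X) (Fo (diagonal C) Y)) 
      (Fo (diagonal C) (coprod2 (Simp (Simp C)) X Y))" and "is_iso (Simp C) c"
proof -
  interpret SC: coproduct_category "Simp C" by (rule coproduct_category_Simp)
  interpret SSC: coproduct_category "Simp (Simp C)" by (rule SC.coproduct_category_Simp)
  let ?D = "diagonal C" and ?P = "coprod2 (Simp (Simp C)) X Y"
  let ?l = "inj_left (Simp (Simp C)) X Y" and ?r = "inj_right (Simp (Simp C)) X Y"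
  note dg = is_functor_diag[OF category_Delta_op category_axioms]
  note l = inj_left_Hom[OF SSC.finite_coproducts X Y] and r = inj_right_Hom[OF SSC.finite_coproducts X Y]
  note P = SC.Simp.Hom_objs(2)[OF l]
  note Dl = functor_Hom[OF dg l] and Dr = functor_Hom[OF dg r]
  note Do = functor_Obj[OF dg X] functor_Obj[OF dg Y] functor_Obj[OF dg P]
  note c = copair[OF SC.finite_coproducts Do Dl Dr, folded c_def]
  show "c \<in> Hom (Simp C) (coprod2 (Simp C) (Fo ?D X) (Fo ?D Y)) (Fo ?D ?P)" by (rule c(1))
  have lev: "is_coproduct C UNIV (\<lambda>i. Fo (Fo (case_bool X Y i) n) n) (Fo (Fo ?P n) n) 
      (\<lambda>i. cmpnt (cmpnt (case_bool ?l ?r i) n) n)" for n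
    by (rule coproduct_levelwise[OF category_Delta_op category_axioms finite_coproducts finite
          coproduct_levelwise[OF category_Delta_op Simp.category_axioms SC.finite_coproducts finite
          coprod2_is_coproduct[OF SSC.finite_coproducts X Y]]]) simp_all
  have D: "is_coproduct (Simp C) UNIV (case_bool (Fo ?D X) (Fo ?D Y)) (Fo ?D ?P) (case_bool (Fm ?D ?l) (Fm ?D ?r))"
  proof (rule levelwise_coproduct[OF category_Delta_op category_axioms])
    show "is_functor Delta_op C (Fo ?D ?P)" using Do by simp
    show "case_bool (Fm ?D ?l) (Fm ?D ?r) i \<in> Hom (Simp C) (case_bool (Fo ?D X) (Fo ?D Y) i) (Fo ?D ?P)" for i
      using Dl Dr by (cases i) auto
    fix n :: nat
    have "Fo (Fo ?D ?P) n = Fo (Fo ?P n) n" using P by simp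
    then show "is_coproduct C UNIV (\<lambda>i. Fo (case_bool (Fo ?D X) (Fo ?D Y) i) n) (Fo (Fo ?D ?P) n)
        (\<lambda>i. cmpnt (case_bool (Fm ?D ?l) (Fm ?D ?r) i) n)"
      using is_coproduct_cong[OF lev[of n], of "\<lambda>i. Fo (case_bool (Fo ?D X) (Fo ?D Y) i) n"
          "\<lambda>i. cmpnt (case_bool (Fm ?D ?l) (Fm ?D ?r) i) n"] X Y Hom_Arr[OF l] Hom_Arr[OF r]
      by (auto split: bool.splits)
  qed
  show "is_iso (Simp C) c"
    by (rule Simp.coproduct_comparison_iso[OF coprod2_is_coproduct[OF SC.finite_coproducts Do(1,2)] D c(1)])
      (use c(2,3) in \<open>simp split: bool.splits\<close>)
qed

lemma diagonal_descent_of_closed: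
  assumes sat: "saturated (Simp C) W" and closed: "Delta_coprod_closed C W"
  shows "simplicial_descent_category (Simp C) W (diagonal C)"
proof -
  interpret SC: coproduct_category "Simp C" by (rule coproduct_category_Simp)
  interpret SSC: coproduct_category "Simp (Simp C)" by (rule SC.coproduct_category_Simp)
  note W3 = Simp.saturated_two_out_of_three[OF sat]
  note dg = is_functor_diag[OF category_Delta_op category_axioms]
  have rows: "Fm (diagonal C) F \<in> W" if "F \<in> Arr (Simp (Simp C))" "\<And>n. cmpnt F n \<in> W" for F
    using closed that by (simp add: Delta_coprod_closed_def Delta_closed_def)
  have "simplicial_descent_structure (Simp C) W (diagonal C) [] []"
  proof
    show "relative_category (Simp C) W" using Simp.category_axioms sat by (simp add: relative_category_def)
    show "closed_by_finite_coproducts (Simp C) W"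
      using SC.finite_coproducts closed by (simp add: closed_by_finite_coproducts_def Delta_coprod_closed_def)
    show "is_functor (Simp (Simp C)) (Simp C) (diagonal C)" by (rule dg)
    show "copair (Simp C) (Fo (diagonal C) X) (Fo (diagonal C) Y) (Fo (diagonal C) (coprod2 (Simp (Simp C)) X Y))
        (Fm (diagonal C) (inj_left (Simp (Simp C)) X Y)) (Fm (diagonal C) (inj_right (Simp (Simp C)) X Y)) \<in> W"
      if "X \<in> Obj (Simp (Simp C))" "Y \<in> Obj (Simp (Simp C))" for X Y
      using Simp.saturated_iso[OF sat diagonal_coproduct_iso[OF that]] .
    show "weq_zigzag (functor_category (Simp (Simp (Simp C))) (Simp C)) 
        (objectwise (Simp (Simp (Simp C))) (Simp C) W)
        (comp_ftor (Simp (Simp (Simp C))) (diagonal C) (diagonal (Simp C))) []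
        (comp_ftor (Simp (Simp (Simp C))) (diagonal C) (post_ftor Delta_op (Simp (Simp C)) (diagonal C)))"
      using diag_diag[OF category_Delta_op category_axioms]
        is_functor_comp[OF SSC.Simp.category_axioms 
          is_functor_diag[OF category_Delta_op Simp.category_axioms] dg]
      by (simp add: weq_zigzag_def)
    show "weq_zigzag (functor_category (Simp C) (Simp C)) (objectwise (Simp C) (Simp C) W)
        (comp_ftor (Simp C) (diagonal C) (const_simp (Simp C))) [] (id_ftor (Simp C))"
      using diag_const[OF category_Delta_op category_axioms] is_functor_id[OF Simp.category_axioms]
      by (simp add: weq_zigzag_def)
    show "Fm (diagonal C) f \<in> W" if "f \<in> Arr (Simp (Simp C))" "\<And>n. cmpnt f n \<in> W" for f
      by (rule rows[OF that])
    show "Fm (diagonal C) (cyl_incl (Simp C) 0 (Fo (const_simp (Simp C)) A)) \<in> W"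
      if A': "A \<in> Obj (Simp C)" for A
    proof -
      let ?cA = "Fo (const_simp (Simp C)) A"
      have A: "is_functor Delta_op C A" using A' by simp
      have cA: "is_functor Delta_op (Simp C) ?cA"
        using functor_Obj[OF is_functor_const[OF category_Delta_op Simp.category_axioms] A'] by simp
      obtain G F \<Phi> where F: "F \<in> Hom (Simp (Simp C)) ?cA G"
        and diag: "Fm (diagonal C) F = cyl_incl C 0 A"
        and \<Phi>: "\<Phi> \<in> Hom (Simp (Simp C)) (cylinder (Simp C) ?cA) G"
        and iso: "\<And>n. is_iso (Simp C) (cmpnt \<Phi> n)"
        and eq: "Cmp (Simp (Simp C)) \<Phi> (cyl_incl (Simp C) 0 ?cA) = F"
        using bisimplicial_cylinder[OF A] by metis
      have rows\<Phi>: "cmpnt \<Phi> n \<in> W" for n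
        using Simp.saturated_iso[OF sat nt_cmpnt[OF \<Phi>] iso, of n] by simp
      note d = SC.cyl_incl_Hom[OF cA, of 0]
      have "Fm (diagonal C) \<Phi> \<in> W" using rows\<Phi> rows[OF Hom_Arr[OF \<Phi>]] by simp
      moreover have "cyl_incl C 0 A \<in> W"
        using closed cyl_incl_homotopy_equivalence[OF A] by (simp add: Delta_coprod_closed_def Delta_closed_def)
      ultimately show ?thesis
        using two_out_of_threeD(3)[OF W3 functor_Hom[OF dg d] functor_Hom[OF dg \<Phi>]] functor_Cmp[OF dg d \<Phi>] 
          eq diag by simp
    qed
  qed (simp_all add: localization_def)
  then show ?thesis by (auto simp: simplicial_descent_category_def)
qed

end

theorem proposition4p2:
  fixes C :: "('o, 'm) category" and W :: "('o, 'm) smor set"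
    and D :: "('p, 'n) category" and E :: "'n set"
    and s :: "(('p, 'n) sobj, ('p, 'n) smor, 'p, 'n) ftor"
  shows "(category C \<and> has_finite_coproducts C \<and> saturated (Simp C) W \<longrightarrow>
            (Delta_coprod_closed C W \<longleftrightarrow> simplicial_descent_category (Simp C) W (diagonal C))) \<and>
         (simplicial_descent_category D E s \<longrightarrow>
            Delta_coprod_closed D {f \<in> Arr (Simp D). Fm s f \<in> E})"
proof (intro conjI impI)
  assume C: "category C \<and> has_finite_coproducts C \<and> saturated (Simp C) W"
  then interpret coproduct_category C
    by (simp add: coproduct_category_def coproduct_category_axioms_def)
  show "Delta_coprod_closed C W \<longleftrightarrow> simplicial_descent_category (Simp C) W (diagonal C)"
    using C diagonal_descent_of_closed closed_of_diagonal_descent by blast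
qed (rule descent_class_closed)

end
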